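(* Let $S$ be an $m$-Koszul Artin-Schelter regular algebra. The Nakayama automorphism of $S$ belongs to the center of $\operatorname{Aut}(S)$.
   Context: $k$ is a field; all vector spaces and algebras are over $k$. Algebras are $\mathbb{N}$-graded, $A=\bigoplus_{i\ge 0}A_i$; $A$ is connected if $A_0=k$, and then $k=A/A_{\ge 1}$. Shifts: $M(n)_i=M_{n+i}$. A connected graded algebra $A$ is $m$-Koszul ($m\ge 2$) if it is finitely presented, its relations are homogeneous of degree $m$ (so $A\cong TV/(R)$ with $V=A_1$ finite dimensional, $R\subseteq V^{\otimes m}$), and $\operatorname{Ext}^i_A(k,k)$ is concentrated in a single degree for every $i$. It is Artin-Schelter (AS) regular of dimension $d$ with Gorenstein parameter $\ell$ if $\operatorname{gldim}(A)=d<\infty$, $\operatorname{Ext}^d_A(k,A)\cong k(\ell)$ and $\operatorname{Ext}^i_A(k,A)=0$ for $i\ne d$; no noetherian hypothesis is made. $\operatorname{Aut}(S)$ is the group of graded $k$-algebra automorphisms of $S$. Nakayama automorphism $\nu$ of $S$ (of dimension $d$, Gorenstein parameter $\ell$): with $S^e=S\otimes S^\circ$, one has $\operatorname{Ext}^i_{S^e}(S,S^e)=0$ for $i\ne d$ and $\operatorname{Ext}^d_{S^e}(S,S^e)\cong{}_\nu S_1(\ell)$ as graded right $S^e$-modules (equivalently, graded $S$-bimodules) for a unique graded algebra automorphism $\nu$, where ${}_\nu S_1$ is $S$ with bimodule action $a\cdot c\cdot b=\nu(a)cb$. *)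

theory Defs
  imports "HOL-Algebra.Module" "HOL-Algebra.QuotRing" "HOL-Algebra.Bij"
    "HOL-Library.Extended_Nat"
begin

section \<open>Graded algebras and graded modules\<close>

text \<open>
  All gradings are indexed by the integers. As with the library record \<^type>\<open>module\<close>, one record
  type serves two purposes: a graded algebra over \<open>K\<close> uses all fields, with \<^const>\<open>smult\<close> the
  action of the scalars; for a graded module over a ring the fields \<^const>\<open>mult\<close> and \<^const>\<open>one\<close>
  are ignored. A right module is stored with \<open>x \<cdot> t\<close> written as \<open>t \<odot> x\<close>.
  In a bimodule \<^const>\<open>smult\<close> is the left action, and \<open>rsmult t x\<close> is the right action \<open>x \<cdot> t\<close>.
\<close>

record ('r, 'm) graded = "('r, 'm) module" +
  hpart :: "int \<Rightarrow> 'm set"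

record ('r, 't, 'm) graded_bimod = "('r, 'm) graded" +
  rsmult :: "'t \<Rightarrow> 'm \<Rightarrow> 'm"

definition homog_decomp :: "('r, 'm, 'x) graded_scheme \<Rightarrow> (int \<Rightarrow> 'm) \<Rightarrow> 'm \<Rightarrow> bool" where
  "homog_decomp M c x \<longleftrightarrow>
     (\<forall>i. c i \<in> hpart M i) \<and> finite {i. c i \<noteq> \<zero>\<^bsub>M\<^esub>} \<and>
     x = (\<Oplus>\<^bsub>M\<^esub> i \<in> {i. c i \<noteq> \<zero>\<^bsub>M\<^esub>}. c i)"

locale direct_grading =
  fixes M (structure)
  assumes hpart_subgroup: "additive_subgroup (hpart M i) M"
    and unique_decomp: "x \<in> carrier M \<Longrightarrow> \<exists>!c. homog_decomp M c x"

definition shift :: "('r, 'm, 'x) graded_scheme \<Rightarrow> int \<Rightarrow> ('r, 'm, 'x) graded_scheme" where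
  "shift M n = M\<lparr>hpart := \<lambda>i. hpart M (n + i)\<rparr>"

text \<open>Noncommutative associative unital algebras; the library's \<^locale>\<open>algebra\<close> is commutative.\<close>

locale assoc_algebra = Module.module K A + ring A for K (structure) and A (structure) +
  assumes smult_mult_left:
    "\<lbrakk>c \<in> carrier K; x \<in> carrier A; y \<in> carrier A\<rbrakk> \<Longrightarrow>
      (c \<odot>\<^bsub>A\<^esub> x) \<otimes>\<^bsub>A\<^esub> y = c \<odot>\<^bsub>A\<^esub> (x \<otimes>\<^bsub>A\<^esub> y)"
    and smult_mult_right:
    "\<lbrakk>c \<in> carrier K; x \<in> carrier A; y \<in> carrier A\<rbrakk> \<Longrightarrow>
      x \<otimes>\<^bsub>A\<^esub> (c \<odot>\<^bsub>A\<^esub> y) = c \<odot>\<^bsub>A\<^esub> (x \<otimes>\<^bsub>A\<^esub> y)"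

locale nat_graded_algebra = field K + assoc_algebra K A + direct_grading A
  for K (structure) and A (structure) +
  assumes hpart_subspace: "submodule (hpart A i) K A"
    and hpart_neg: "i < 0 \<Longrightarrow> hpart A i = {\<zero>\<^bsub>A\<^esub>}"
    and hpart_one: "\<one>\<^bsub>A\<^esub> \<in> hpart A 0"
    and hpart_mult: "\<lbrakk>x \<in> hpart A i; y \<in> hpart A j\<rbrakk> \<Longrightarrow> x \<otimes>\<^bsub>A\<^esub> y \<in> hpart A (i + j)"

locale connected_graded_algebra = nat_graded_algebra +
  assumes one_neq_zero: "\<one>\<^bsub>A\<^esub> \<noteq> \<zero>\<^bsub>A\<^esub>"
    and hpart_zero: "hpart A 0 = {c \<odot>\<^bsub>A\<^esub> \<one>\<^bsub>A\<^esub> | c. c \<in> carrier K}"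

definition galg_iso ::
  "('k, 'z) ring_scheme \<Rightarrow> ('k, 'a, 'x) graded_scheme \<Rightarrow> ('k, 'b, 'y) graded_scheme \<Rightarrow> ('a \<Rightarrow> 'b) set"
  where
  "galg_iso K A B = {f \<in> ring_iso A B.
     (\<forall>c \<in> carrier K. \<forall>x \<in> carrier A. f (c \<odot>\<^bsub>A\<^esub> x) = c \<odot>\<^bsub>B\<^esub> f x) \<and>
     (\<forall>i. f ` hpart A i = hpart B i)}"

text \<open>
  \<^const>\<open>Bij\<close> normalises automorphisms to be undefined outside the carrier, so that distinct
  elements of the group are distinct maps on the carrier.
\<close>

definition Aut_group :: "('k, 'z) ring_scheme \<Rightarrow> ('k, 'a, 'x) graded_scheme \<Rightarrow> ('a \<Rightarrow> 'a) monoid" where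
  "Aut_group K A = (BijGroup (carrier A))\<lparr>carrier := Bij (carrier A) \<inter> galg_iso K A A\<rparr>"

definition group_center :: "('g, 'x) monoid_scheme \<Rightarrow> 'g set" where
  "group_center G = {z \<in> carrier G. \<forall>g \<in> carrier G. z \<otimes>\<^bsub>G\<^esub> g = g \<otimes>\<^bsub>G\<^esub> z}"


section \<open>Quotients\<close>

text \<open>
  Extends the library's quotient ring by the action on cosets and the image grading. When \<open>M\<close> is
  only a module, the resulting multiplication has no meaning.
\<close>

definition quot :: "('r, 'm, 'x) graded_scheme \<Rightarrow> 'm set \<Rightarrow> ('r, 'm set) graded" where
  "quot M I =
     \<lparr>carrier = carrier (M Quot I), mult = mult (M Quot I), one = one (M Quot I),
      zero = zero (M Quot I), add = add (M Quot I),
      smult = (\<lambda>r X. \<Union>x \<in> X. I +>\<^bsub>M\<^esub> (r \<odot>\<^bsub>M\<^esub> x)),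
      hpart = (\<lambda>n. (\<lambda>x. I +>\<^bsub>M\<^esub> x) ` hpart M n)\<rparr>"

definition quot_bimod ::
  "('r, 't, 'm, 'x) graded_bimod_scheme \<Rightarrow> 'm set \<Rightarrow> ('r, 't, 'm set) graded_bimod" where
  "quot_bimod B I = graded.extend (quot B I)
     (graded_bimod.fields (\<lambda>t X. \<Union>x \<in> X. I +>\<^bsub>B\<^esub> rsmult B t x))"


section \<open>Modules over noncommutative rings and global dimension\<close>

text \<open>The library's \<^locale>\<open>Module.module\<close> requires a commutative ring.\<close>

locale left_module = R?: ring R + M?: abelian_group M for R (structure) and M (structure) +
  assumes smult_closed: "\<lbrakk>a \<in> carrier R; x \<in> carrier M\<rbrakk> \<Longrightarrow> a \<odot>\<^bsub>M\<^esub> x \<in> carrier M"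
    and smult_l_distr: "\<lbrakk>a \<in> carrier R; b \<in> carrier R; x \<in> carrier M\<rbrakk> \<Longrightarrow>
      (a \<oplus>\<^bsub>R\<^esub> b) \<odot>\<^bsub>M\<^esub> x = a \<odot>\<^bsub>M\<^esub> x \<oplus>\<^bsub>M\<^esub> b \<odot>\<^bsub>M\<^esub> x"
    and smult_r_distr: "\<lbrakk>a \<in> carrier R; x \<in> carrier M; y \<in> carrier M\<rbrakk> \<Longrightarrow>
      a \<odot>\<^bsub>M\<^esub> (x \<oplus>\<^bsub>M\<^esub> y) = a \<odot>\<^bsub>M\<^esub> x \<oplus>\<^bsub>M\<^esub> a \<odot>\<^bsub>M\<^esub> y"
    and smult_assoc: "\<lbrakk>a \<in> carrier R; b \<in> carrier R; x \<in> carrier M\<rbrakk> \<Longrightarrow>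
      (a \<otimes>\<^bsub>R\<^esub> b) \<odot>\<^bsub>M\<^esub> x = a \<odot>\<^bsub>M\<^esub> (b \<odot>\<^bsub>M\<^esub> x)"
    and smult_one: "x \<in> carrier M \<Longrightarrow> \<one>\<^bsub>R\<^esub> \<odot>\<^bsub>M\<^esub> x = x"

definition mod_hom ::
  "('r, 'z) ring_scheme \<Rightarrow> ('r, 'm, 'x) module_scheme \<Rightarrow> ('r, 'n, 'y) module_scheme \<Rightarrow> ('m \<Rightarrow> 'n) set"
  where
  "mod_hom R M N = {f \<in> carrier M \<rightarrow> carrier N.
     (\<forall>x \<in> carrier M. \<forall>y \<in> carrier M. f (x \<oplus>\<^bsub>M\<^esub> y) = f x \<oplus>\<^bsub>N\<^esub> f y) \<and>
     (\<forall>r \<in> carrier R. \<forall>x \<in> carrier M. f (r \<odot>\<^bsub>M\<^esub> x) = r \<odot>\<^bsub>N\<^esub> f x)}"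

text \<open>
  HOL cannot quantify over all modules of all types, so the test modules in the lifting property have
  elements in the type of \<open>P\<close>. This is used only for the type \<open>('r, 'm) univ\<close>. Unless \<open>'r\<close> is a
  singleton (and so \<open>R = 0\<close>) that type is infinite and at least as large as \<open>'r\<close>, so it hosts a free
  module mapping onto \<open>P\<close>, and the property is equivalent to projectivity.
\<close>

definition projective :: "('r, 'z) ring_scheme \<Rightarrow> ('r, 'p, 'x) module_scheme \<Rightarrow> bool" where
  "projective R P \<longleftrightarrow> left_module R P \<and>
     (\<forall>(N :: ('r, 'p) module) (N' :: ('r, 'p) module) g f.
        left_module R N \<and> left_module R N' \<and>
        g \<in> mod_hom R N N' \<and> g ` carrier N = carrier N' \<and> f \<in> mod_hom R P N' \<longrightarrow>
        (\<exists>h \<in> mod_hom R P N. \<forall>x \<in> carrier P. g (h x) = f x))"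

definition projective_resolution ::
  "('r, 'z) ring_scheme \<Rightarrow> ('r, 'm, 'x) module_scheme \<Rightarrow>
   (nat \<Rightarrow> ('r, 'p, 'y) module_scheme) \<Rightarrow> (nat \<Rightarrow> 'p \<Rightarrow> 'p) \<Rightarrow> ('p \<Rightarrow> 'm) \<Rightarrow> bool" where
  "projective_resolution R M P d e \<longleftrightarrow>
     (\<forall>i. projective R (P i)) \<and>
     e \<in> mod_hom R (P 0) M \<and> e ` carrier (P 0) = carrier M \<and>
     (\<forall>i. d i \<in> mod_hom R (P (Suc i)) (P i)) \<and>
     d 0 ` carrier (P 1) = a_kernel (P 0) M e \<and>
     (\<forall>i. d (Suc i) ` carrier (P (Suc (Suc i))) = a_kernel (P (Suc i)) (P i) (d i))"

text \<open>
  The type from which the terms of a projective resolution of an \<open>R\<close>-module with elements in \<open>'m\<close> are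
  taken. It contains, as finitely supported functions, the free \<open>R\<close>-modules on sets of generators in
  \<open>('r + 'm) list\<close>. That index type is infinite and at least as large as \<open>'r\<close> and \<open>'m\<close>, and hence
  suffices for a set of generators of the module and of all its iterated syzygies.
\<close>

type_synonym ('r, 'm) univ = "('r + 'm) list \<Rightarrow> 'r"

definition proj_dim :: "('r, 'z) ring_scheme \<Rightarrow> ('r, 'm, 'x) module_scheme \<Rightarrow> enat" where
  "proj_dim R M = Inf {enat n | n.
     \<exists>(P :: nat \<Rightarrow> ('r, ('r, 'm) univ) module) d e.
       projective_resolution R M P d e \<and> (\<forall>i > n. carrier (P i) = {\<zero>\<^bsub>P i\<^esub>})}"

text \<open>
  Left global dimension: the supremum over all left modules with elements in \<open>'r list \<Rightarrow> 'r\<close>. That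
  type has room for every cyclic module \<open>R / J\<close>; by Auslander's theorem these already determine the
  supremum over all modules.
\<close>

definition global_dim :: "('r, 'z) ring_scheme \<Rightarrow> enat" where
  "global_dim R = (SUP M \<in> {M :: ('r, 'r list \<Rightarrow> 'r) module. left_module R M}. proj_dim R M)"


section \<open>Graded Ext\<close>

definition graded_module :: "('k, 'r, 'z) graded_scheme \<Rightarrow> ('r, 'm, 'x) graded_scheme \<Rightarrow> bool" where
  "graded_module R M \<longleftrightarrow> left_module R M \<and> direct_grading M \<and>
     (\<forall>i j. \<forall>r \<in> hpart R i. \<forall>x \<in> hpart M j. r \<odot>\<^bsub>M\<^esub> x \<in> hpart M (i + j))"

definition degree_hom ::
  "('r, 'z) ring_scheme \<Rightarrow> int \<Rightarrow> ('r, 'm, 'x) graded_scheme \<Rightarrow> ('r, 'n, 'y) graded_scheme \<Rightarrow> ('m \<Rightarrow> 'n) set"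
  where
  "degree_hom R j M N = {f \<in> mod_hom R M N. \<forall>i. f ` hpart M i \<subseteq> hpart N (i + j)}"

definition graded_projective_resolution ::
  "('k, 'r, 'z) graded_scheme \<Rightarrow> ('r, 'm, 'x) graded_scheme \<Rightarrow>
   (nat \<Rightarrow> ('r, 'p, 'y) graded_scheme) \<Rightarrow> (nat \<Rightarrow> 'p \<Rightarrow> 'p) \<Rightarrow> ('p \<Rightarrow> 'm) \<Rightarrow> bool" where
  "graded_projective_resolution R M P d e \<longleftrightarrow>
     projective_resolution R M P d e \<and> (\<forall>i. graded_module R (P i)) \<and>
     e \<in> degree_hom R 0 (P 0) M \<and> (\<forall>i. d i \<in> degree_hom R 0 (P (Suc i)) (P i))"

definition hom_bimod ::
  "('r, 'z) ring_scheme \<Rightarrow> ('r, 'm, 'x) graded_scheme \<Rightarrow> ('r, 't, 'n, 'y) graded_bimod_scheme \<Rightarrow>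
   ('t, 'm \<Rightarrow> 'n) graded" where
  "hom_bimod R M N =
     \<lparr>carrier = mod_hom R M N \<inter> extensional (carrier M),
      mult = undefined, one = undefined,
      zero = (\<lambda>x \<in> carrier M. \<zero>\<^bsub>N\<^esub>),
      add = (\<lambda>f g. \<lambda>x \<in> carrier M. f x \<oplus>\<^bsub>N\<^esub> g x),
      smult = (\<lambda>t f. \<lambda>x \<in> carrier M. rsmult N t (f x)),
      hpart = (\<lambda>j. degree_hom R j M N \<inter> extensional (carrier M))\<rparr>"

text \<open>
  The graded Hom: the sum over all \<open>j\<close> of the homomorphisms of degree \<open>j\<close>, i.e. of
  \<open>Hom\<^bsub>GrMod R\<^esub>(M, N(j))\<close>. It is a right module through the right action on \<open>N\<close>.
\<close>

definition graded_Hom ::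
  "('r, 'z) ring_scheme \<Rightarrow> ('r, 'm, 'x) graded_scheme \<Rightarrow> ('r, 't, 'n, 'y) graded_bimod_scheme \<Rightarrow>
   ('t, 'm \<Rightarrow> 'n) graded" where
  "graded_Hom R M N = (hom_bimod R M N)
     \<lparr>carrier := {f. \<exists>c. homog_decomp (hom_bimod R M N) c f}\<rparr>"

definition cocycles where
  "cocycles R P d N i = {f \<in> carrier (graded_Hom R (P i) N).
     \<forall>x \<in> carrier (P (Suc i)). f (d i x) = \<zero>\<^bsub>N\<^esub>}"

definition coboundaries where
  "coboundaries R P d N i =
     (case i of 0 \<Rightarrow> {\<zero>\<^bsub>graded_Hom R (P 0) N\<^esub>}
      | Suc j \<Rightarrow> (\<lambda>f. compose (carrier (P (Suc j))) f (d j)) ` carrier (graded_Hom R (P j) N))"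

definition cohomology ::
  "('r, 'z) ring_scheme \<Rightarrow> (nat \<Rightarrow> ('r, 'p, 'x) graded_scheme) \<Rightarrow> (nat \<Rightarrow> 'p \<Rightarrow> 'p) \<Rightarrow>
   ('r, 't, 'n, 'y) graded_bimod_scheme \<Rightarrow> nat \<Rightarrow> ('t, ('p \<Rightarrow> 'n) set) graded" where
  "cohomology R P d N i = quot
     ((graded_Hom R (P i) N)
        \<lparr>carrier := cocycles R P d N i,
         hpart := \<lambda>j. hpart (graded_Hom R (P i) N) j \<inter> cocycles R P d N i\<rparr>)
     (coboundaries R P d N i)"

text \<open>
  \<open>graded_Ext R i M N\<close> is the sum over \<open>j\<close> of \<open>Ext\<^sup>i\<^bsub>GrMod R\<^esub>(M, N(j))\<close>, computed from a chosen
  graded projective resolution of \<open>M\<close>. It is a graded right module through the right action on the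
  bimodule \<open>N\<close>.
\<close>

definition graded_Ext ::
  "('k, 'r, 'z) graded_scheme \<Rightarrow> nat \<Rightarrow> ('r, 'm, 'x) graded_scheme \<Rightarrow>
   ('r, 't, 'n, 'y) graded_bimod_scheme \<Rightarrow> ('t, (('r, 'm) univ \<Rightarrow> 'n) set) graded" where
  "graded_Ext R i M N =
     (let (P, d, e) = (SOME (P :: nat \<Rightarrow> ('r, ('r, 'm) univ) graded, d, e).
            graded_projective_resolution R M P d e)
      in cohomology R P d N i)"

definition zero_module :: "('r, 'm, 'x) graded_scheme \<Rightarrow> bool" where
  "zero_module E \<longleftrightarrow> carrier E = {\<zero>\<^bsub>E\<^esub>}"

text \<open>Isomorphism of graded modules, left or right, over a ring \<open>T\<close>.\<close>

definition gmod_isomorphic ::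
  "('t, 'z) ring_scheme \<Rightarrow> ('t, 'm, 'x) graded_scheme \<Rightarrow> ('t, 'n, 'y) graded_scheme \<Rightarrow> bool" where
  "gmod_isomorphic T M N \<longleftrightarrow>
     (\<exists>f \<in> mod_hom T M N. bij_betw f (carrier M) (carrier N) \<and> (\<forall>i. f ` hpart M i = hpart N i))"

definition regular_bimod :: "('k, 'a, 'x) graded_scheme \<Rightarrow> ('a, 'a, 'a) graded_bimod" where
  "regular_bimod A =
     \<lparr>carrier = carrier A, mult = mult A, one = one A, zero = zero A, add = add A,
      smult = mult A, hpart = hpart A, rsmult = (\<lambda>t x. x \<otimes>\<^bsub>A\<^esub> t)\<rparr>"

definition right_part :: "('r, 't, 'm, 'x) graded_bimod_scheme \<Rightarrow> ('t, 'm) graded" where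
  "right_part B =
     \<lparr>carrier = carrier B, mult = mult B, one = one B, zero = zero B, add = add B,
      smult = rsmult B, hpart = hpart B\<rparr>"

definition positive_part :: "('k, 'a, 'x) graded_scheme \<Rightarrow> 'a set" where
  "positive_part A = {x. \<exists>c. homog_decomp A c x \<and> (\<forall>i < 1. c i = \<zero>\<^bsub>A\<^esub>)}"

text \<open>The bimodule \<open>k = A / A\<^bsub>\<ge> 1\<^esub>\<close>.\<close>

definition trivial_bimod :: "('k, 'a, 'x) graded_scheme \<Rightarrow> ('a, 'a, 'a set) graded_bimod" where
  "trivial_bimod A = quot_bimod (regular_bimod A) (positive_part A)"


section \<open>Free algebras and enveloping algebras\<close>

text \<open>
  Monoid algebra of \<open>G\<close> over \<open>K\<close>: finitely supported functions with the convolution product.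
  The part of degree \<open>n\<close> is spanned by the monoid elements in \<open>W n\<close>.
\<close>

definition monoid_algebra ::
  "('k, 'z) ring_scheme \<Rightarrow> ('g, 'x) monoid_scheme \<Rightarrow> (int \<Rightarrow> 'g set) \<Rightarrow> ('k, 'g \<Rightarrow> 'k) graded" where
  "monoid_algebra K G W =
     (let C = {f. (\<forall>x. f x \<in> carrier K) \<and> {x. f x \<noteq> \<zero>\<^bsub>K\<^esub>} \<subseteq> carrier G \<and> finite {x. f x \<noteq> \<zero>\<^bsub>K\<^esub>}}
      in \<lparr>carrier = C,
          mult = (\<lambda>f g z. \<Oplus>\<^bsub>K\<^esub> p \<in> {(x, y). f x \<noteq> \<zero>\<^bsub>K\<^esub> \<and> g y \<noteq> \<zero>\<^bsub>K\<^esub> \<and> x \<otimes>\<^bsub>G\<^esub> y = z}.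
                    f (fst p) \<otimes>\<^bsub>K\<^esub> g (snd p)),
          one = (\<lambda>x. if x = \<one>\<^bsub>G\<^esub> then \<one>\<^bsub>K\<^esub> else \<zero>\<^bsub>K\<^esub>),
          zero = (\<lambda>x. \<zero>\<^bsub>K\<^esub>),
          add = (\<lambda>f g x. f x \<oplus>\<^bsub>K\<^esub> g x),
          smult = (\<lambda>c f x. c \<otimes>\<^bsub>K\<^esub> f x),
          hpart = (\<lambda>n. {f \<in> C. {x. f x \<noteq> \<zero>\<^bsub>K\<^esub>} \<subseteq> W n})\<rparr>)"

text \<open>
  The tensor algebra of a vector space with basis \<open>0, \<dots>, n - 1\<close>, as the monoid algebra of the words
  in these letters; the words of length \<open>i\<close> form a basis of the \<open>i\<close>-th tensor power.
\<close>

definition tensor_algebra :: "('k, 'z) ring_scheme \<Rightarrow> nat \<Rightarrow> ('k, nat list \<Rightarrow> 'k) graded" where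
  "tensor_algebra K n = monoid_algebra K
     \<lparr>carrier = lists {..<n}, mult = (@), one = []\<rparr> (\<lambda>i. {w. int (length w) = i})"

text \<open>
  The tensor product of two graded algebras: the monoid algebra of the monoid of pairs \<open>(a, b)\<close>
  modulo the bilinearity relations. The degree \<open>n\<close> part is spanned by the tensors \<open>a \<otimes> b\<close>
  of homogeneous elements with degrees adding up to \<open>n\<close>.
\<close>

definition pairs_algebra ::
  "('k, 'z) ring_scheme \<Rightarrow> ('k, 'a, 'x) graded_scheme \<Rightarrow> ('k, 'b, 'y) graded_scheme \<Rightarrow>
   ('k, 'a \<times> 'b \<Rightarrow> 'k) graded" where
  "pairs_algebra K A B = monoid_algebra K (A \<times>\<times> B) (\<lambda>n. \<Union>i. hpart A i \<times> hpart B (n - i))"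

definition basis_elem :: "('k, 'z) ring_scheme \<Rightarrow> 'g \<Rightarrow> 'g \<Rightarrow> 'k" where
  "basis_elem K x = (\<lambda>y. if y = x then \<one>\<^bsub>K\<^esub> else \<zero>\<^bsub>K\<^esub>)"

definition bilinear_relations ::
  "('k, 'z) ring_scheme \<Rightarrow> ('k, 'a, 'x) graded_scheme \<Rightarrow> ('k, 'b, 'y) graded_scheme \<Rightarrow>
   ('a \<times> 'b \<Rightarrow> 'k) set" where
  "bilinear_relations K A B =
     (let F = pairs_algebra K A B; \<delta> = basis_elem K in
       {\<delta> (a \<oplus>\<^bsub>A\<^esub> a', b) \<ominus>\<^bsub>F\<^esub> (\<delta> (a, b) \<oplus>\<^bsub>F\<^esub> \<delta> (a', b)) | a a' b.
          a \<in> carrier A \<and> a' \<in> carrier A \<and> b \<in> carrier B} \<union>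
       {\<delta> (a, b \<oplus>\<^bsub>B\<^esub> b') \<ominus>\<^bsub>F\<^esub> (\<delta> (a, b) \<oplus>\<^bsub>F\<^esub> \<delta> (a, b')) | a b b'.
          a \<in> carrier A \<and> b \<in> carrier B \<and> b' \<in> carrier B} \<union>
       {\<delta> (c \<odot>\<^bsub>A\<^esub> a, b) \<ominus>\<^bsub>F\<^esub> c \<odot>\<^bsub>F\<^esub> \<delta> (a, b) | c a b.
          c \<in> carrier K \<and> a \<in> carrier A \<and> b \<in> carrier B} \<union>
       {\<delta> (a, c \<odot>\<^bsub>B\<^esub> b) \<ominus>\<^bsub>F\<^esub> c \<odot>\<^bsub>F\<^esub> \<delta> (a, b) | c a b.
          c \<in> carrier K \<and> a \<in> carrier A \<and> b \<in> carrier B})"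

definition tensor_product ::
  "('k, 'z) ring_scheme \<Rightarrow> ('k, 'a, 'x) graded_scheme \<Rightarrow> ('k, 'b, 'y) graded_scheme \<Rightarrow>
   ('k, ('a \<times> 'b \<Rightarrow> 'k) set) graded" where
  "tensor_product K A B =
     quot (pairs_algebra K A B) (Idl\<^bsub>pairs_algebra K A B\<^esub> (bilinear_relations K A B))"

text \<open>
  The value at an element \<open>t\<close> of the tensor product of the linear map induced by a bilinear map
  \<open>(a, b) \<mapsto> g (a, b)\<close> into the \<open>K\<close>-module \<open>X\<close>; it does not depend on the representative.
\<close>

definition tensor_lift ::
  "('k, 'z) ring_scheme \<Rightarrow> ('k, 'm, 'x) module_scheme \<Rightarrow> ('a \<times> 'b \<Rightarrow> 'm) \<Rightarrow> ('a \<times> 'b \<Rightarrow> 'k) set \<Rightarrow> 'm"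
  where
  "tensor_lift K X g t =
     (THE y. \<exists>f \<in> t. y = (\<Oplus>\<^bsub>X\<^esub> p \<in> {p. f p \<noteq> \<zero>\<^bsub>K\<^esub>}. f p \<odot>\<^bsub>X\<^esub> g p))"

definition opposite :: "('k, 'a, 'x) graded_scheme \<Rightarrow> ('k, 'a, 'x) graded_scheme" where
  "opposite A = A\<lparr>mult := \<lambda>x y. y \<otimes>\<^bsub>A\<^esub> x\<rparr>"

definition enveloping ::
  "('k, 'z) ring_scheme \<Rightarrow> ('k, 'a, 'x) graded_scheme \<Rightarrow> ('k, ('a \<times> 'a \<Rightarrow> 'k) set) graded" where
  "enveloping K S = tensor_product K S (opposite S)"

text \<open>\<open>S\<close> as a left \<open>S\<^sup>e\<close>-module, \<open>(a \<otimes> b) \<cdot> c = a c b\<close>.\<close>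

definition env_left ::
  "('k, 'z) ring_scheme \<Rightarrow> ('k, 'a, 'x) graded_scheme \<Rightarrow> (('a \<times> 'a \<Rightarrow> 'k) set, 'a) graded" where
  "env_left K S =
     \<lparr>carrier = carrier S, mult = mult S, one = one S, zero = zero S, add = add S,
      smult = (\<lambda>t c. tensor_lift K S (\<lambda>(a, b). a \<otimes>\<^bsub>S\<^esub> c \<otimes>\<^bsub>S\<^esub> b) t),
      hpart = hpart S\<rparr>"

text \<open>
  The bimodule \<open>\<^sub>\<nu>S\<^sub>1\<close>, with \<open>a \<cdot> c \<cdot> b = \<nu>(a) c b\<close>, as a right \<open>S\<^sup>e\<close>-module. A bimodule is a right
  \<open>S\<^sup>e\<close>-module through \<open>c \<cdot> (b \<otimes> a) = a \<cdot> c \<cdot> b\<close>, the left action being that of the second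
  tensor factor.
\<close>

definition env_twist ::
  "('k, 'z) ring_scheme \<Rightarrow> ('k, 'a, 'x) graded_scheme \<Rightarrow> ('a \<Rightarrow> 'a) \<Rightarrow>
   (('a \<times> 'a \<Rightarrow> 'k) set, 'a) graded" where
  "env_twist K S \<nu> =
     \<lparr>carrier = carrier S, mult = mult S, one = one S, zero = zero S, add = add S,
      smult = (\<lambda>t c. tensor_lift K S (\<lambda>(b, a). \<nu> a \<otimes>\<^bsub>S\<^esub> c \<otimes>\<^bsub>S\<^esub> b) t),
      hpart = hpart S\<rparr>"


section \<open>Koszul and Artin-Schelter regular algebras, Nakayama automorphisms\<close>

definition m_koszul ::
  "('k, 'z) ring_scheme \<Rightarrow> nat \<Rightarrow> ('k, 'a, 'x) graded_scheme \<Rightarrow> bool" where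
  "m_koszul K m A \<longleftrightarrow>
     connected_graded_algebra K A \<and> m \<ge> 2 \<and>
     (\<exists>n rels. finite rels \<and> rels \<subseteq> hpart (tensor_algebra K n) (int m) \<and>
        galg_iso K (quot (tensor_algebra K n) (Idl\<^bsub>tensor_algebra K n\<^esub> rels)) A \<noteq> {}) \<and>
     (\<forall>i. \<exists>j. \<forall>j'. j' \<noteq> j \<longrightarrow>
        (let E = graded_Ext A i (trivial_bimod A) (trivial_bimod A) in hpart E j' = {\<zero>\<^bsub>E\<^esub>}))"

definition AS_regular ::
  "('k, 'z) ring_scheme \<Rightarrow> ('k, 'a, 'x) graded_scheme \<Rightarrow> nat \<Rightarrow> int \<Rightarrow> bool" where
  "AS_regular K A d l \<longleftrightarrow>
     connected_graded_algebra K A \<and>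
     global_dim A = enat d \<and>
     gmod_isomorphic A (graded_Ext A d (trivial_bimod A) (regular_bimod A))
       (shift (right_part (trivial_bimod A)) l) \<and>
     (\<forall>i. i \<noteq> d \<longrightarrow> zero_module (graded_Ext A i (trivial_bimod A) (regular_bimod A)))"

definition nakayama_automorphism ::
  "('k, 'z) ring_scheme \<Rightarrow> ('k, 'a, 'x) graded_scheme \<Rightarrow> nat \<Rightarrow> int \<Rightarrow> ('a \<Rightarrow> 'a) \<Rightarrow> bool" where
  "nakayama_automorphism K S d l \<nu> \<longleftrightarrow>
     (let Se = enveloping K S in
       \<nu> \<in> carrier (Aut_group K S) \<and>
       (\<forall>i. i \<noteq> d \<longrightarrow> zero_module (graded_Ext Se i (env_left K S) (regular_bimod Se))) \<and>
       gmod_isomorphic Se (graded_Ext Se d (env_left K S) (regular_bimod Se))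
         (shift (env_twist K S \<nu>) l))"

end

theory Submission
  imports Defs
begin

text \<open>
  Let \<open>\<sigma>\<close> be an automorphism of \<open>S\<close>. It is semilinear for the automorphism \<open>\<sigma> \<otimes> \<sigma>\<close> of \<open>S\<^sup>e\<close>, so it lifts
  to a semilinear chain map of a graded projective resolution of \<open>S\<close>, unique up to homotopy, and induces
  an injective degree-preserving semilinear map \<open>\<Psi>\<close> of \<open>Ext\<^sup>d(S, S\<^sup>e) \<cong> \<^sub>\<nu>S\<^sub>1(l)\<close>. As \<open>S\<close> is connected, \<open>\<Psi>\<close>
  sends the generator \<open>1\<close> to a nonzero scalar \<open>u\<close>. Applying \<open>\<Psi>\<close> to \<open>1 \<cdot> (1 \<otimes> a) = 1 \<cdot> (\<nu>(a) \<otimes> 1)\<close> yields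
  \<open>u \<nu>(\<sigma>(a)) = u \<sigma>(\<nu>(a))\<close>.

  The chosen resolution in the definition of \<open>Ext\<close> is an actual one only if some graded projective
  resolution has its terms in the prescribed type. A free one is built there by encoding the
  finitely supported functions by lists; this uses that \<open>S\<^sup>e\<close> is a graded ring, which follows from
  the universal property of the tensor product.
\<close>

section \<open>Graded abelian groups\<close>

text \<open>Ext is computed from one fixed resolution of \<open>S\<close>, on which an automorphism
  acts only through lifts chosen up to homotopy. Pulling a cochain back along a lift of the inverse
  of \<open>\<sigma>\<close> destroys linearity, because the lift is semilinear; applying
  \<open>\<sigma> \<otimes> \<sigma>\<close> to the values afterwards restores it, and this makes
  sense because the coefficient module is the ring \<open>S\<^sup>e\<close> itself. Injectivity is
  what keeps \<open>u\<close> from vanishing. It follows from one null homotopy, between the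
  identity and a lift of \<open>\<sigma>\<close> followed by a lift of its inverse. All lifts are
  taken of degree zero: cochains are finite sums of homogeneous maps and must remain so, and the
  degree of the generator must be preserved for \<open>u\<close> to land in degree zero of
  \<open>S\<close>, where connectedness applies. Semilinear maps, scalar multiplications and
  evaluations at a point are linear over no common ring, so the elementary facts are stated for
  additive maps.\<close>

definition add_hom :: "('a, 'x) ring_scheme \<Rightarrow> ('b, 'y) ring_scheme \<Rightarrow> ('a \<Rightarrow> 'b) set" where
  "add_hom M N = {f \<in> carrier M \<rightarrow> carrier N.
     \<forall>x \<in> carrier M. \<forall>y \<in> carrier M. f (x \<oplus>\<^bsub>M\<^esub> y) = f x \<oplus>\<^bsub>N\<^esub> f y}"

lemma mod_hom_add_hom: "f \<in> mod_hom R M N \<Longrightarrow> f \<in> add_hom M N"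
  by (auto simp: mod_hom_def add_hom_def)

lemma add_homD:
  assumes "f \<in> add_hom M N"
  shows add_hom_closed: "x \<in> carrier M \<Longrightarrow> f x \<in> carrier N"
    and add_hom_add: "\<lbrakk>x \<in> carrier M; y \<in> carrier M\<rbrakk> \<Longrightarrow> f (x \<oplus>\<^bsub>M\<^esub> y) = f x \<oplus>\<^bsub>N\<^esub> f y"
  using assms by (auto simp: add_hom_def)

lemma add_hom_abelian_group_hom:
  "\<lbrakk>abelian_group M; abelian_group N; f \<in> add_hom M N\<rbrakk> \<Longrightarrow> abelian_group_hom M N f"
  by (intro abelian_group_homI group_hom.intro group_hom_axioms.intro)
    (auto simp: add_hom_def hom_def intro: abelian_group.a_group)

lemma add_hom_zero:
  "\<lbrakk>abelian_group M; abelian_group N; f \<in> add_hom M N\<rbrakk> \<Longrightarrow> f \<zero>\<^bsub>M\<^esub> = \<zero>\<^bsub>N\<^esub>"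
  by (rule abelian_group_hom.hom_zero[OF add_hom_abelian_group_hom])

lemma add_hom_inv:
  "\<lbrakk>abelian_group M; abelian_group N; f \<in> add_hom M N; x \<in> carrier M\<rbrakk> \<Longrightarrow>
    f (\<ominus>\<^bsub>M\<^esub> x) = \<ominus>\<^bsub>N\<^esub> f x"
  by (rule abelian_group_hom.hom_a_inv[OF add_hom_abelian_group_hom])

lemma add_hom_minus:
  assumes "abelian_group M" "abelian_group N" "f \<in> add_hom M N" "x \<in> carrier M" "y \<in> carrier M"
  shows "f (x \<ominus>\<^bsub>M\<^esub> y) = f x \<ominus>\<^bsub>N\<^esub> f y"
  using assms by (simp add: a_minus_def add_hom_inv add_hom_add abelian_group.a_inv_closed)

lemma add_hom_finsum:
  assumes "abelian_group M" "abelian_group N" "f \<in> add_hom M N" "finite A"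
    and c: "\<And>i. i \<in> A \<Longrightarrow> c i \<in> carrier M"
  shows "f (\<Oplus>\<^bsub>M\<^esub>i\<in>A. c i) = (\<Oplus>\<^bsub>N\<^esub>i\<in>A. f (c i))"
proof -
  interpret M: abelian_group M by fact
  interpret N: abelian_group N by fact
  from \<open>finite A\<close> c show ?thesis
  proof (induction A rule: finite_induct)
    case empty
    then show ?case using add_hom_zero assms by simp
  next
    case (insert x F)
    then have 1: "c \<in> F \<rightarrow> carrier M" "c x \<in> carrier M" by auto
    have 2: "(\<lambda>i. f (c i)) \<in> F \<rightarrow> carrier N" "f (c x) \<in> carrier N"
      using insert.prems add_hom_closed[OF assms(3)] by auto
    have "(\<Oplus>\<^bsub>M\<^esub>i\<in>insert x F. c i) = c x \<oplus>\<^bsub>M\<^esub> (\<Oplus>\<^bsub>M\<^esub>i\<in>F. c i)"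
      using insert.hyps 1 by (rule M.finsum_insert)
    then have "f (\<Oplus>\<^bsub>M\<^esub>i\<in>insert x F. c i) = f (c x) \<oplus>\<^bsub>N\<^esub> f (\<Oplus>\<^bsub>M\<^esub>i\<in>F. c i)"
      using add_hom_add[OF assms(3)] 1 by simp
    also have "f (\<Oplus>\<^bsub>M\<^esub>i\<in>F. c i) = (\<Oplus>\<^bsub>N\<^esub>i\<in>F. f (c i))" using insert by simp
    also have "f (c x) \<oplus>\<^bsub>N\<^esub> (\<Oplus>\<^bsub>N\<^esub>i\<in>F. f (c i)) = (\<Oplus>\<^bsub>N\<^esub>i\<in>insert x F. f (c i))"
      using N.finsum_insert[OF insert.hyps 2] by simp
    finally show ?case .
  qed
qed

text \<open>Twists and opposites change only fields that \<open>finsum\<close> does not read, so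
  sums carry over between such records.\<close>

lemma finsum_record_cong:
  assumes "carrier M = carrier N" "add M = add N" "zero M = zero N"
  shows "finsum M f I = finsum N f I"
  using assms by (simp add: finsum_def finprod_def)

text \<open>Lets sums over different supports be compared over one common finite set.\<close>

lemma (in abelian_monoid) finsum_superset:
  assumes "finite B" "A \<subseteq> B" "\<And>i. i \<in> B - A \<Longrightarrow> f i = \<zero>" "f \<in> B \<rightarrow> carrier G"
  shows "(\<Oplus>i\<in>A. f i) = (\<Oplus>i\<in>B. f i)"
  using assms by (intro add.finprod_mono_neutral_cong_left) auto

lemma (in abelian_monoid) finsum_single:
  assumes "finite A" "j \<in> A" "f j \<in> carrier G" "\<And>i. i \<in> A \<Longrightarrow> i \<noteq> j \<Longrightarrow> f i = \<zero>"
  shows "(\<Oplus>i\<in>A. f i) = f j"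
proof -
  have "(\<Oplus>i\<in>{j}. f i) = (\<Oplus>i\<in>A. f i)"
    using assms by (intro finsum_superset) (auto, metis zero_closed)
  then show ?thesis using assms by (simp add: finsum_singleton)
qed

lemma (in abelian_group) minus_zero_eq: "\<ominus> \<zero> = \<zero>"
  by (rule trans[OF l_zero[OF a_inv_closed[OF zero_closed], symmetric] r_neg[OF zero_closed]])


text \<open>Directness is kept apart on purpose: in a full Hom module the maps of a given degree
  form a subgroup, yet an arbitrary map need not be a finite sum of homogeneous ones. Statements
  about given decompositions already hold here.\<close>

locale graded_group = abelian_group M for M (structure) +
  assumes hpart_subgroup: "additive_subgroup (hpart M i) M"
begin

lemma hpart_closed: "x \<in> hpart M i \<Longrightarrow> x \<in> carrier M"
  by (rule additive_subgroup.a_Hcarr[OF hpart_subgroup])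

lemma hpart_zero: "\<zero> \<in> hpart M i"
  by (rule additive_subgroup.zero_closed[OF hpart_subgroup])

lemma hpart_add: "\<lbrakk>x \<in> hpart M i; y \<in> hpart M i\<rbrakk> \<Longrightarrow> x \<oplus> y \<in> hpart M i"
  by (rule additive_subgroup.a_closed[OF hpart_subgroup])

lemma hpart_inv: "x \<in> hpart M i \<Longrightarrow> \<ominus> x \<in> hpart M i"
  by (rule additive_subgroup.a_inv_closed[OF hpart_subgroup])

lemma hpart_finsum: "\<lbrakk>\<And>i. i \<in> I \<Longrightarrow> c i \<in> hpart M n\<rbrakk> \<Longrightarrow> (\<Oplus>i\<in>I. c i) \<in> hpart M n"
proof (induction I rule: infinite_finite_induct)
  case (insert x F)
  then have "c \<in> F \<rightarrow> carrier M" "c x \<in> carrier M" by (auto intro: hpart_closed)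
  with insert show ?case by (simp add: hpart_add)
qed (auto simp: hpart_zero finsum_infinite)

lemma decompD:
  assumes "homog_decomp M c x"
  shows "c i \<in> hpart M i" "c i \<in> carrier M" "finite {i. c i \<noteq> \<zero>}"
    "x = (\<Oplus>i\<in>{i. c i \<noteq> \<zero>}. c i)"
  using assms hpart_closed by (auto simp: homog_decomp_def)

lemma decomp_superset:
  assumes "homog_decomp M c x" "finite A" "{i. c i \<noteq> \<zero>} \<subseteq> A"
  shows "x = (\<Oplus>i\<in>A. c i)"
proof -
  have "(\<Oplus>i\<in>{i. c i \<noteq> \<zero>}. c i) = (\<Oplus>i\<in>A. c i)"
    using assms decompD[OF assms(1)] by (intro finsum_superset) auto
  then show ?thesis using decompD(4)[OF assms(1)] by simp
qed

lemma decompI: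
  assumes "\<And>i. c i \<in> hpart M i" "finite A" "\<And>i. i \<notin> A \<Longrightarrow> c i = \<zero>" "x = (\<Oplus>i\<in>A. c i)"
  shows "homog_decomp M c x"
proof -
  have sub: "{i. c i \<noteq> \<zero>} \<subseteq> A" using assms(3) by auto
  have "(\<Oplus>i\<in>{i. c i \<noteq> \<zero>}. c i) = (\<Oplus>i\<in>A. c i)"
    using assms(2-3) sub hpart_closed[OF assms(1)] by (intro finsum_superset) auto
  then show ?thesis using assms sub finite_subset by (auto simp: homog_decomp_def)
qed

lemma decomp_carrier: "homog_decomp M c x \<Longrightarrow> x \<in> carrier M"
  using decompD(4)[of c x] finsum_closed[of c "{i. c i \<noteq> \<zero>}"] decompD(2)[of c x] by auto

lemma decomp_homog: "x \<in> hpart M n \<Longrightarrow> homog_decomp M (\<lambda>i. if i = n then x else \<zero>) x"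
  by (rule decompI[where A = "{n}"]) (auto simp: hpart_zero hpart_closed finsum_singleton)

lemma decomp_zero: "homog_decomp M (\<lambda>i. \<zero>) \<zero>"
  by (rule decompI[where A = "{}"]) (auto simp: hpart_zero)

lemma decomp_add:
  assumes "homog_decomp M c x" "homog_decomp M c' y"
  shows "homog_decomp M (\<lambda>i. c i \<oplus> c' i) (x \<oplus> y)"
proof (rule decompI)
  let ?A = "{i. c i \<noteq> \<zero>} \<union> {i. c' i \<noteq> \<zero>}"
  show fin: "finite ?A" using decompD(3)[OF assms(1)] decompD(3)[OF assms(2)] by simp
  show "c i \<oplus> c' i \<in> hpart M i" for i
    by (intro hpart_add decompD(1)[OF assms(1)] decompD(1)[OF assms(2)])
  show "i \<notin> ?A \<Longrightarrow> c i \<oplus> c' i = \<zero>" for i by simp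
  have "x = (\<Oplus>i\<in>?A. c i)" "y = (\<Oplus>i\<in>?A. c' i)"
    using decomp_superset[OF assms(1) fin] decomp_superset[OF assms(2) fin] by auto
  then show "x \<oplus> y = (\<Oplus>i\<in>?A. c i \<oplus> c' i)"
    using decompD(2)[OF assms(1)] decompD(2)[OF assms(2)] by (simp add: finsum_addf Pi_def)
qed

lemma decomp_induct [consumes 1, case_names zero add]:
  assumes "homog_decomp M c x" "P \<zero>"
    "\<And>i y z. \<lbrakk>y \<in> carrier M; P y; z \<in> hpart M i\<rbrakk> \<Longrightarrow> P (z \<oplus> y)"
  shows "P x"
proof -
  have "P (\<Oplus>i\<in>I. c i)" if "finite I" for I
    using that
  proof (induction I rule: finite_induct)
    case (insert j F)
    have "(\<Oplus>i\<in>insert j F. c i) = c j \<oplus> (\<Oplus>i\<in>F. c i)"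
      using insert decompD(2)[OF assms(1)] by (intro finsum_insert) auto
    then show ?case
      using insert assms(3)[of "\<Oplus>i\<in>F. c i" "c j" j] decompD(1,2)[OF assms(1)] by (auto intro: finsum_closed)
  qed (use assms in auto)
  then show ?thesis using decompD(3,4)[OF assms(1)] by metis
qed

end

text \<open>A map of degree \<open>j\<close> carries the component in degree \<open>i - j\<close> to
  the one in degree \<open>i\<close>, whence the reindexing.\<close>

lemma decomp_map:
  assumes "graded_group M" "graded_group N" "f \<in> add_hom M N"
    and f: "\<And>i x. x \<in> hpart M i \<Longrightarrow> f x \<in> hpart N (i + j)"
    and c: "homog_decomp M c x"
  shows "homog_decomp N (\<lambda>i. f (c (i - j))) (f x)"
proof -
  interpret M: graded_group M by fact
  interpret N: graded_group N by fact
  let ?A = "{i. c i \<noteq> \<zero>\<^bsub>M\<^esub>}"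
  have f0: "f \<zero>\<^bsub>M\<^esub> = \<zero>\<^bsub>N\<^esub>" using add_hom_zero assms(3) M.abelian_group_axioms N.abelian_group_axioms by blast
  show ?thesis
  proof (rule N.decompI)
    show "f (c (i - j)) \<in> hpart N i" for i using f[OF M.decompD(1)[OF c, of "i - j"]] by simp
    show "finite ((\<lambda>i. i + j) ` ?A)" using M.decompD[OF c] by simp
    show "f (c (i - j)) = \<zero>\<^bsub>N\<^esub>" if "i \<notin> (\<lambda>i. i + j) ` ?A" for i
    proof -
      have "i - j \<notin> ?A"
        using that by (metis (no_types, lifting) diff_add_cancel image_eqI)
      then show ?thesis using f0 by simp
    qed
    have "f x = f (\<Oplus>\<^bsub>M\<^esub>i\<in>?A. c i)" using M.decompD(4)[OF c] by simp
    also have "\<dots> = (\<Oplus>\<^bsub>N\<^esub>i\<in>?A. f (c i))"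
      using M.decompD[OF c] by (intro add_hom_finsum assms M.abelian_group_axioms N.abelian_group_axioms) auto
    also have "\<dots> = (\<Oplus>\<^bsub>N\<^esub>i\<in>(\<lambda>i. i + j) ` ?A. f (c (i - j)))"
      using M.decompD(2)[OF c] add_hom_closed[OF assms(3)]
      by (subst N.finsum_reindex) (auto simp: inj_on_def)
    finally show "f x = (\<Oplus>\<^bsub>N\<^esub>i\<in>(\<lambda>i. i + j) ` ?A. f (c (i - j)))" .
  qed
qed

section \<open>Homogeneous components in a direct grading\<close>

definition hcomp :: "('r, 'm, 'x) graded_scheme \<Rightarrow> 'm \<Rightarrow> int \<Rightarrow> 'm" where
  "hcomp M x = (THE c. homog_decomp M c x)"

locale direct_graded_group = abelian_group M + direct_grading M for M (structure)

sublocale direct_graded_group \<subseteq> graded_group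
  by (intro graded_group.intro graded_group_axioms.intro abelian_group_axioms hpart_subgroup)

context direct_graded_group
begin

lemma hcomp_eqI: "homog_decomp M c x \<Longrightarrow> hcomp M x = c"
  unfolding hcomp_def by (rule the1_equality[OF unique_decomp[OF decomp_carrier]])

lemma hcomp_decomp: "x \<in> carrier M \<Longrightarrow> homog_decomp M (hcomp M x) x"
  using unique_decomp hcomp_eqI by metis

lemma hcomp_hpart: "x \<in> carrier M \<Longrightarrow> hcomp M x i \<in> hpart M i"
  by (rule decompD(1)[OF hcomp_decomp])

lemma hcomp_closed: "x \<in> carrier M \<Longrightarrow> hcomp M x i \<in> carrier M"
  by (rule decompD(2)[OF hcomp_decomp])

lemma hcomp_finite: "x \<in> carrier M \<Longrightarrow> finite {i. hcomp M x i \<noteq> \<zero>}"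
  by (rule decompD(3)[OF hcomp_decomp])

lemma hcomp_sum:
  "\<lbrakk>x \<in> carrier M; finite A; {i. hcomp M x i \<noteq> \<zero>} \<subseteq> A\<rbrakk> \<Longrightarrow> (\<Oplus>i\<in>A. hcomp M x i) = x"
  using decomp_superset[OF hcomp_decomp] by simp

lemma hcomp_homog: "x \<in> hpart M n \<Longrightarrow> hcomp M x i = (if i = n then x else \<zero>)"
  using hcomp_eqI[OF decomp_homog] by simp

lemma hcomp_zero: "hcomp M \<zero> i = \<zero>"
  using hcomp_eqI[OF decomp_zero] by simp

lemma hcomp_add:
  "\<lbrakk>x \<in> carrier M; y \<in> carrier M\<rbrakk> \<Longrightarrow> hcomp M (x \<oplus> y) i = hcomp M x i \<oplus> hcomp M y i"
  using hcomp_eqI[OF decomp_add[OF hcomp_decomp hcomp_decomp]] by simp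

lemma homog_induct [consumes 1, case_names zero add]:
  assumes "x \<in> carrier M" "P \<zero>"
    "\<And>i y z. \<lbrakk>y \<in> carrier M; P y; z \<in> hpart M i\<rbrakk> \<Longrightarrow> P (z \<oplus> y)"
  shows "P x"
  using decomp_induct[OF hcomp_decomp] assms by metis

end

text \<open>\<open>decomp_map\<close> yields a decomposition of \<open>f x\<close>, and
  decompositions in \<open>N\<close> are unique.\<close>

lemma hcomp_map:
  assumes "direct_graded_group M" "direct_graded_group N" "f \<in> add_hom M N"
    and f: "\<And>i x. x \<in> hpart M i \<Longrightarrow> f x \<in> hpart N (i + j)"
    and "x \<in> carrier M"
  shows "hcomp N (f x) i = f (hcomp M x (i - j))"
proof -
  interpret M: direct_graded_group M by fact
  interpret N: direct_graded_group N by fact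
  show ?thesis
    using N.hcomp_eqI[OF decomp_map[OF M.graded_group_axioms N.graded_group_axioms assms(3) f M.hcomp_decomp[OF assms(5)]]]
    by simp
qed

text \<open>Additive projections that are right on homogeneous elements force uniqueness: applied to
  a finite homogeneous sum, \<open>p i\<close> returns the summand of degree \<open>i\<close>. For
  free modules the projections come from coordinates, for tensor products from the universal
  property.\<close>

lemma direct_gradingI:
  assumes "graded_group M"
    and ex: "\<And>x. x \<in> carrier M \<Longrightarrow> \<exists>c. homog_decomp M c x"
    and p: "\<And>i. p i \<in> add_hom M M"
    and p_hpart: "\<And>i j x. x \<in> hpart M j \<Longrightarrow> p i x = (if i = j then x else \<zero>\<^bsub>M\<^esub>)"
  shows "direct_grading M"
proof -
  interpret M: graded_group M by fact
  have eq: "c i = p i x" if c: "homog_decomp M c x" for c x i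
  proof -
    \<comment> \<open>Adding \<open>i\<close> keeps the index of interest in the range even when
      \<open>c i\<close> is zero.\<close>
    let ?A = "insert i {i. c i \<noteq> \<zero>\<^bsub>M\<^esub>}"
    have fin: "finite ?A" using M.decompD[OF c] by simp
    have "x = (\<Oplus>\<^bsub>M\<^esub>j\<in>?A. c j)" using M.decomp_superset[OF c fin] by blast
    then have "p i x = p i (\<Oplus>\<^bsub>M\<^esub>j\<in>?A. c j)" by simp
    also have "\<dots> = (\<Oplus>\<^bsub>M\<^esub>j\<in>?A. p i (c j))"
      using fin M.decompD(2)[OF c] by (intro add_hom_finsum p M.abelian_group_axioms) auto
    also have "\<dots> = p i (c i)"
      using fin p_hpart[OF M.decompD(1)[OF c]] M.decompD(2)[OF c] by (intro M.finsum_single) auto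
    also have "\<dots> = c i" using p_hpart[OF M.decompD(1)[OF c]] by simp
    finally show ?thesis by simp
  qed
  show ?thesis
  proof (rule direct_grading.intro)
    show "additive_subgroup (hpart M i) M" for i by (rule M.hpart_subgroup)
    show "\<exists>!c. homog_decomp M c x" if "x \<in> carrier M" for x
      using ex[OF that] eq by (metis ext)
  qed
qed

section \<open>Free modules\<close>

definition fin_supp :: "('r, 'z) ring_scheme \<Rightarrow> 'x set \<Rightarrow> ('x \<Rightarrow> 'r) set" where
  "fin_supp R X = {f. (\<forall>x. f x \<in> carrier R) \<and> {x. f x \<noteq> \<zero>\<^bsub>R\<^esub>} \<subseteq> X \<and> finite {x. f x \<noteq> \<zero>\<^bsub>R\<^esub>}}"

text \<open>The linear map out of a free module with prescribed values \<open>n\<close> on the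
  basis. No basis set is named, so one formula serves all of them.\<close>

definition lin_ext ::
  "('r, 'z) ring_scheme \<Rightarrow> ('r, 'm, 'y) module_scheme \<Rightarrow> ('x \<Rightarrow> 'm) \<Rightarrow> ('x \<Rightarrow> 'r) \<Rightarrow> 'm" where
  "lin_ext R N n p = (\<Oplus>\<^bsub>N\<^esub>x\<in>{x. p x \<noteq> \<zero>\<^bsub>R\<^esub>}. p x \<odot>\<^bsub>N\<^esub> n x)"

lemma mod_homI:
  assumes "\<And>x. x \<in> carrier M \<Longrightarrow> f x \<in> carrier N"
    "\<And>x y. \<lbrakk>x \<in> carrier M; y \<in> carrier M\<rbrakk> \<Longrightarrow> f (x \<oplus>\<^bsub>M\<^esub> y) = f x \<oplus>\<^bsub>N\<^esub> f y"
    "\<And>r x. \<lbrakk>r \<in> carrier R; x \<in> carrier M\<rbrakk> \<Longrightarrow> f (r \<odot>\<^bsub>M\<^esub> x) = r \<odot>\<^bsub>N\<^esub> f x"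
  shows "f \<in> mod_hom R M N"
  using assms by (auto simp: mod_hom_def)

lemma mod_homD:
  assumes "f \<in> mod_hom R M N"
  shows mod_hom_closed: "x \<in> carrier M \<Longrightarrow> f x \<in> carrier N"
    and mod_hom_add: "\<lbrakk>x \<in> carrier M; y \<in> carrier M\<rbrakk> \<Longrightarrow> f (x \<oplus>\<^bsub>M\<^esub> y) = f x \<oplus>\<^bsub>N\<^esub> f y"
    and mod_hom_smult: "\<lbrakk>r \<in> carrier R; x \<in> carrier M\<rbrakk> \<Longrightarrow> f (r \<odot>\<^bsub>M\<^esub> x) = r \<odot>\<^bsub>N\<^esub> f x"
  using assms by (auto simp: mod_hom_def)

context left_module
begin

lemma smult_add_hom: "a \<in> carrier R \<Longrightarrow> (\<lambda>x. a \<odot>\<^bsub>M\<^esub> x) \<in> add_hom M M"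
  by (auto simp: add_hom_def smult_closed smult_r_distr)

lemma scalar_add_hom: "x \<in> carrier M \<Longrightarrow> (\<lambda>a. a \<odot>\<^bsub>M\<^esub> x) \<in> add_hom R M"
  by (auto simp: add_hom_def smult_closed smult_l_distr)

lemma smult_zero: "a \<in> carrier R \<Longrightarrow> a \<odot>\<^bsub>M\<^esub> \<zero>\<^bsub>M\<^esub> = \<zero>\<^bsub>M\<^esub>"
  by (rule add_hom_zero[OF M.abelian_group_axioms M.abelian_group_axioms smult_add_hom])

lemma zero_smult: "x \<in> carrier M \<Longrightarrow> \<zero>\<^bsub>R\<^esub> \<odot>\<^bsub>M\<^esub> x = \<zero>\<^bsub>M\<^esub>"
  by (rule add_hom_zero[OF R.abelian_group_axioms M.abelian_group_axioms scalar_add_hom])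

lemma smult_minus:
  "\<lbrakk>a \<in> carrier R; x \<in> carrier M; y \<in> carrier M\<rbrakk> \<Longrightarrow> a \<odot>\<^bsub>M\<^esub> (x \<ominus>\<^bsub>M\<^esub> y) = a \<odot>\<^bsub>M\<^esub> x \<ominus>\<^bsub>M\<^esub> a \<odot>\<^bsub>M\<^esub> y"
  by (rule add_hom_minus[OF M.abelian_group_axioms M.abelian_group_axioms smult_add_hom])

end

text \<open>Axioms pass along any surjection compatible with the operations. Here and in
  \<open>left_module_image\<close>, the identity changes the record, the coset map gives quotients,
  and a map onto chosen representatives models an image inside another type.\<close>

lemma abelian_group_image:
  assumes M: "abelian_group M" and N: "carrier N = f ` carrier M" "\<zero>\<^bsub>N\<^esub> = f \<zero>\<^bsub>M\<^esub>"
    and add: "\<And>x y. \<lbrakk>x \<in> carrier M; y \<in> carrier M\<rbrakk> \<Longrightarrow> f x \<oplus>\<^bsub>N\<^esub> f y = f (x \<oplus>\<^bsub>M\<^esub> y)"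
  shows "abelian_group N"
proof -
  interpret M: abelian_group M by fact
  show ?thesis
  proof (rule abelian_groupI)
    show "\<exists>y\<in>carrier N. y \<oplus>\<^bsub>N\<^esub> x = \<zero>\<^bsub>N\<^esub>" if "x \<in> carrier N" for x
    proof -
      obtain z where z: "z \<in> carrier M" "x = f z" using \<open>x \<in> carrier N\<close> N(1) by auto
      then have "f (\<ominus>\<^bsub>M\<^esub> z) \<oplus>\<^bsub>N\<^esub> x = \<zero>\<^bsub>N\<^esub>" by (simp add: add N(2) M.l_neg)
      then show ?thesis using z N(1) by auto
    qed
  qed (auto simp: N add M.add.m_ac)
qed

lemma left_module_image:
  assumes M: "left_module R M" and N: "carrier N = f ` carrier M" "\<zero>\<^bsub>N\<^esub> = f \<zero>\<^bsub>M\<^esub>"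
    and add: "\<And>x y. \<lbrakk>x \<in> carrier M; y \<in> carrier M\<rbrakk> \<Longrightarrow> f x \<oplus>\<^bsub>N\<^esub> f y = f (x \<oplus>\<^bsub>M\<^esub> y)"
    and smult: "\<And>r x. \<lbrakk>r \<in> carrier R; x \<in> carrier M\<rbrakk> \<Longrightarrow> r \<odot>\<^bsub>N\<^esub> f x = f (r \<odot>\<^bsub>M\<^esub> x)"
  shows "left_module R N"
proof -
  interpret M: left_module R M by fact
  show ?thesis
    by (intro left_module.intro left_module_axioms.intro M.R.ring_axioms
        abelian_group_image[OF M.M.abelian_group_axioms N add])
      (auto simp: N add smult M.smult_closed M.smult_l_distr M.smult_r_distr M.smult_assoc M.smult_one)
qed

text \<open>Only the four fields are prescribed, so that graded free modules, monoid algebras and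
  the homogeneous parts of the latter are all instances.\<close>

locale free_left_module = R?: ring R for R (structure)
  and F :: "('r, 'x \<Rightarrow> 'r, 'y) module_scheme" and X :: "'x set" +
  assumes carrier_F: "carrier F = fin_supp R X"
    and zero_F: "\<zero>\<^bsub>F\<^esub> = (\<lambda>_. \<zero>)"
    and add_F: "p \<oplus>\<^bsub>F\<^esub> q = (\<lambda>x. p x \<oplus> q x)"
    and smult_F: "r \<odot>\<^bsub>F\<^esub> p = (\<lambda>x. r \<otimes> p x)"
begin

lemma F_closed: "p \<in> carrier F \<Longrightarrow> p x \<in> carrier R"
  by (auto simp: carrier_F fin_supp_def)

lemma F_finite: "p \<in> carrier F \<Longrightarrow> finite {x. p x \<noteq> \<zero>}"
  by (auto simp: carrier_F fin_supp_def)

lemma F_supp: "p \<in> carrier F \<Longrightarrow> p x \<noteq> \<zero> \<Longrightarrow> x \<in> X"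
  by (auto simp: carrier_F fin_supp_def)

lemma F_I:
  assumes "\<And>x. p x \<in> carrier R" "finite A" "A \<subseteq> X" "\<And>x. x \<notin> A \<Longrightarrow> p x = \<zero>"
  shows "p \<in> carrier F"
proof -
  have "{x. p x \<noteq> \<zero>} \<subseteq> A" using assms(4) by auto
  then show ?thesis using assms finite_subset by (auto simp: carrier_F fin_supp_def)
qed

lemma F_zero_closed: "\<zero>\<^bsub>F\<^esub> \<in> carrier F"
  by (rule F_I[where A = "{}"]) (auto simp: zero_F)

lemma F_add_closed: "\<lbrakk>p \<in> carrier F; q \<in> carrier F\<rbrakk> \<Longrightarrow> p \<oplus>\<^bsub>F\<^esub> q \<in> carrier F"
  by (rule F_I[where A = "{x. p x \<noteq> \<zero>} \<union> {x. q x \<noteq> \<zero>}"]) (auto simp: add_F F_closed F_finite dest: F_supp)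

lemma F_smult_closed: "\<lbrakk>r \<in> carrier R; p \<in> carrier F\<rbrakk> \<Longrightarrow> r \<odot>\<^bsub>F\<^esub> p \<in> carrier F"
  by (rule F_I[where A = "{x. p x \<noteq> \<zero>}"]) (auto simp: smult_F F_closed F_finite dest: F_supp)

lemma F_left_module: "left_module R F"
proof (intro left_module.intro left_module_axioms.intro)
  show "ring R" by (rule R.ring_axioms)
  show "abelian_group F"
  proof (rule abelian_groupI)
    show "\<exists>q\<in>carrier F. q \<oplus>\<^bsub>F\<^esub> p = \<zero>\<^bsub>F\<^esub>" if "p \<in> carrier F" for p
    proof
      show "(\<lambda>x. \<ominus> p x) \<in> carrier F"
        using that
        by (intro F_I[where A = "{x. p x \<noteq> \<zero>}"]) (auto simp: F_closed F_finite dest: F_supp)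
      show "(\<lambda>x. \<ominus> p x) \<oplus>\<^bsub>F\<^esub> p = \<zero>\<^bsub>F\<^esub>"
        using that by (simp add: add_F zero_F F_closed R.l_neg)
    qed
  qed (simp_all only: F_zero_closed F_add_closed, simp_all add: add_F zero_F F_closed R.add.m_ac)
qed (simp_all only: F_add_closed F_smult_closed,
    simp_all add: add_F smult_F F_closed R.l_distr R.r_distr R.m_assoc)

lemma basis_closed: "x \<in> X \<Longrightarrow> basis_elem R x \<in> carrier F"
  by (rule F_I[where A = "{x}"]) (auto simp: basis_elem_def)

text \<open>Induction on a finite set containing the support: clearing the coefficient at one point
  shrinks it.\<close>

lemma free_induct [consumes 1, case_names zero step]:
  assumes p: "p \<in> carrier F" and zero: "P \<zero>\<^bsub>F\<^esub>"
    and step: "\<And>p x r. \<lbrakk>p \<in> carrier F; P p; x \<in> X; r \<in> carrier R\<rbrakk> \<Longrightarrow>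
      P (p \<oplus>\<^bsub>F\<^esub> r \<odot>\<^bsub>F\<^esub> basis_elem R x)"
  shows "P p"
proof -
  have "\<forall>p\<in>carrier F. {x. p x \<noteq> \<zero>} \<subseteq> A \<longrightarrow> P p" if "finite A" for A
    using that
  proof (induction A rule: finite_induct)
    case empty
    have "p = \<zero>\<^bsub>F\<^esub>" if "{x. p x \<noteq> \<zero>} \<subseteq> {}" for p
      using that by (auto simp: zero_F)
    then show ?case using zero by metis
  next
    case (insert a A)
    show ?case
    proof (intro ballI impI)
      fix p assume p: "p \<in> carrier F" and sub: "{x. p x \<noteq> \<zero>} \<subseteq> insert a A"
      show "P p"
      proof (cases "p a = \<zero>")
        case True
        then have "{x. p x \<noteq> \<zero>} \<subseteq> A" using sub by auto
        then show ?thesis using insert p by auto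
      next
        case False
        let ?q = "p(a := \<zero>)"
        have q: "?q \<in> carrier F"
          using p by (intro F_I[where A = "{x. p x \<noteq> \<zero>}"]) (auto simp: F_closed F_finite dest: F_supp)
        have "{x. ?q x \<noteq> \<zero>} \<subseteq> A" using sub by auto
        then have "P ?q" using insert.IH q by blast
        then have "P (?q \<oplus>\<^bsub>F\<^esub> p a \<odot>\<^bsub>F\<^esub> basis_elem R a)"
          using step[OF q] p False by (simp add: F_supp F_closed)
        also have "?q \<oplus>\<^bsub>F\<^esub> p a \<odot>\<^bsub>F\<^esub> basis_elem R a = p"
          using p by (auto simp: add_F smult_F basis_elem_def F_closed)
        finally show ?thesis .
      qed
    qed
  qed
  then show ?thesis using p F_finite by blast
qed

lemma lin_ext_superset:
  assumes "left_module R N" "n \<in> X \<rightarrow> carrier N" "p \<in> carrier F"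
    "finite A" "A \<subseteq> X" "{x. p x \<noteq> \<zero>} \<subseteq> A"
  shows "lin_ext R N n p = (\<Oplus>\<^bsub>N\<^esub>x\<in>A. p x \<odot>\<^bsub>N\<^esub> n x)"
proof -
  interpret N: left_module R N by fact
  show ?thesis
    unfolding lin_ext_def using assms
    by (intro N.M.finsum_superset) (auto simp: F_closed N.smult_closed N.zero_smult Pi_iff subset_iff)
qed

lemma lin_ext_mod_hom:
  assumes N: "left_module R N" and n: "n \<in> X \<rightarrow> carrier N"
  shows "lin_ext R N n \<in> mod_hom R F N"
proof -
  interpret N: left_module R N by fact
  have t: "p x \<odot>\<^bsub>N\<^esub> n x \<in> carrier N" if "p \<in> carrier F" "x \<in> X" for p x
    using that n by (auto simp: F_closed intro!: N.smult_closed)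
  show ?thesis
  proof (rule mod_homI)
    show "lin_ext R N n p \<in> carrier N" if "p \<in> carrier F" for p
      unfolding lin_ext_def using that t F_supp by (intro N.M.finsum_closed) auto
    show "lin_ext R N n (p \<oplus>\<^bsub>F\<^esub> q) = lin_ext R N n p \<oplus>\<^bsub>N\<^esub> lin_ext R N n q"
      if p: "p \<in> carrier F" and q: "q \<in> carrier F" for p q
    proof -
      let ?A = "{x. p x \<noteq> \<zero>} \<union> {x. q x \<noteq> \<zero>}"
      have A: "finite ?A" "?A \<subseteq> X" using p q by (auto simp: F_finite dest: F_supp)
      have "lin_ext R N n (p \<oplus>\<^bsub>F\<^esub> q) = (\<Oplus>\<^bsub>N\<^esub>x\<in>?A. (p \<oplus>\<^bsub>F\<^esub> q) x \<odot>\<^bsub>N\<^esub> n x)"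
        by (rule lin_ext_superset[OF N n F_add_closed[OF p q] A]) (auto simp: add_F)
      also have "\<dots> = (\<Oplus>\<^bsub>N\<^esub>x\<in>?A. p x \<odot>\<^bsub>N\<^esub> n x \<oplus>\<^bsub>N\<^esub> q x \<odot>\<^bsub>N\<^esub> n x)"
        using A n p q t
        by (intro N.M.finsum_cong' refl) (auto simp: add_F F_closed intro!: N.smult_l_distr)
      also have "\<dots> = (\<Oplus>\<^bsub>N\<^esub>x\<in>?A. p x \<odot>\<^bsub>N\<^esub> n x) \<oplus>\<^bsub>N\<^esub> (\<Oplus>\<^bsub>N\<^esub>x\<in>?A. q x \<odot>\<^bsub>N\<^esub> n x)"
        using A t p q by (intro N.M.finsum_addf) auto
      also have "(\<Oplus>\<^bsub>N\<^esub>x\<in>?A. p x \<odot>\<^bsub>N\<^esub> n x) = lin_ext R N n p"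
        by (rule lin_ext_superset[OF N n p A, symmetric]) auto
      also have "(\<Oplus>\<^bsub>N\<^esub>x\<in>?A. q x \<odot>\<^bsub>N\<^esub> n x) = lin_ext R N n q"
        by (rule lin_ext_superset[OF N n q A, symmetric]) auto
      finally show ?thesis .
    qed
    show "lin_ext R N n (r \<odot>\<^bsub>F\<^esub> p) = r \<odot>\<^bsub>N\<^esub> lin_ext R N n p" if r: "r \<in> carrier R" and p: "p \<in> carrier F" for r p
    proof -
      let ?A = "{x. p x \<noteq> \<zero>}"
      have A: "finite ?A" "?A \<subseteq> X" using p by (auto simp: F_finite dest: F_supp)
      have "lin_ext R N n (r \<odot>\<^bsub>F\<^esub> p) = (\<Oplus>\<^bsub>N\<^esub>x\<in>?A. (r \<odot>\<^bsub>F\<^esub> p) x \<odot>\<^bsub>N\<^esub> n x)"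
        by (rule lin_ext_superset[OF N n F_smult_closed[OF r p] A]) (auto simp: smult_F r)
      also have "\<dots> = (\<Oplus>\<^bsub>N\<^esub>x\<in>?A. r \<odot>\<^bsub>N\<^esub> (p x \<odot>\<^bsub>N\<^esub> n x))"
        using A n p r t
        by (intro N.M.finsum_cong' refl) (auto simp: smult_F F_closed N.smult_closed intro!: N.smult_assoc)
      also have "\<dots> = r \<odot>\<^bsub>N\<^esub> (\<Oplus>\<^bsub>N\<^esub>x\<in>?A. p x \<odot>\<^bsub>N\<^esub> n x)"
        using A t p by (intro add_hom_finsum[symmetric] N.M.abelian_group_axioms N.smult_add_hom r) auto
      finally show ?thesis by (simp add: lin_ext_def)
    qed
  qed
qed

lemma lin_ext_basis:
  assumes "left_module R N" "n \<in> X \<rightarrow> carrier N" "x \<in> X"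
  shows "lin_ext R N n (basis_elem R x) = n x"
proof -
  interpret N: left_module R N by fact
  have nx: "n x \<in> carrier N" using assms by auto
  have "lin_ext R N n (basis_elem R x) = (\<Oplus>\<^bsub>N\<^esub>y\<in>{x}. basis_elem R x y \<odot>\<^bsub>N\<^esub> n y)"
    using assms by (intro lin_ext_superset basis_closed) (auto simp: basis_elem_def)
  also have "\<dots> = basis_elem R x x \<odot>\<^bsub>N\<^esub> n x"
    using nx by (intro N.M.finsum_single) (auto simp: basis_elem_def N.smult_one)
  finally show ?thesis using nx by (simp add: basis_elem_def N.smult_one)
qed

lemma free_hom_ext:
  assumes N: "left_module R N" and f: "f \<in> mod_hom R F N" and g: "g \<in> mod_hom R F N"
    and eq: "\<And>x. x \<in> X \<Longrightarrow> f (basis_elem R x) = g (basis_elem R x)" and p: "p \<in> carrier F"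
  shows "f p = g p"
  using p
proof (induction rule: free_induct)
  case zero
  interpret F: left_module R F by (rule F_left_module)
  interpret N: left_module R N by fact
  show ?case
    using add_hom_zero[OF F.M.abelian_group_axioms N.M.abelian_group_axioms mod_hom_add_hom] f g by metis
next
  case (step p x r)
  then show ?case
    using mod_homD[OF f] mod_homD[OF g] eq by (simp add: F_smult_closed basis_closed)
qed

lemma F_projective: "projective R F"
  unfolding projective_def
proof (intro conjI allI impI F_left_module)
  fix N N' :: "('r, 'x \<Rightarrow> 'r) module" and g f
  assume a: "left_module R N \<and> left_module R N' \<and> g \<in> mod_hom R N N' \<and>
    g ` carrier N = carrier N' \<and> f \<in> mod_hom R F N'"
  \<comment> \<open>A preimage of each basis value is chosen; freeness extends the choice to a
    linear map.\<close>
  define n where "n x = inv_into (carrier N) g (f (basis_elem R x))" for x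
  have fb: "f (basis_elem R x) \<in> g ` carrier N" if "x \<in> X" for x
    using a that mod_hom_closed[of f R F N'] basis_closed by auto
  then have n: "n \<in> X \<rightarrow> carrier N" unfolding n_def by (intro Pi_I inv_into_into)
  have gn: "g (n x) = f (basis_elem R x)" if "x \<in> X" for x
    unfolding n_def by (rule f_inv_into_f[OF fb[OF that]])
  have L: "lin_ext R N n \<in> mod_hom R F N" using a by (intro lin_ext_mod_hom n) simp
  show "\<exists>h\<in>mod_hom R F N. \<forall>x\<in>carrier F. g (h x) = f x"
  proof (intro bexI[OF _ L] ballI)
    fix p assume p: "p \<in> carrier F"
    have N: "left_module R N" "left_module R N'" and g: "g \<in> mod_hom R N N'" and f: "f \<in> mod_hom R F N'"
      using a by auto
    have c: "(\<lambda>p. g (lin_ext R N n p)) \<in> mod_hom R F N'"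
      using mod_homD[OF g] mod_homD[OF L] by (intro mod_homI) auto
    show "g (lin_ext R N n p) = f p"
      using lin_ext_basis[OF N(1) n] gn by (intro free_hom_ext[OF N(2) c f _ p]) simp
  qed
qed

end

section \<open>Graded free resolutions\<close>

locale graded_ring = R?: ring R + direct_grading R for R (structure) +
  assumes graded_mult: "\<lbrakk>x \<in> hpart R i; y \<in> hpart R j\<rbrakk> \<Longrightarrow> x \<otimes> y \<in> hpart R (i + j)"

sublocale graded_ring \<subseteq> direct_graded_group R
  by (intro direct_graded_group.intro R.abelian_group_axioms direct_grading_axioms)

lemma graded_moduleD:
  assumes "graded_module R M"
  shows graded_module_left: "left_module R M"
    and graded_module_direct: "direct_graded_group M"
    and graded_module_smult: "\<lbrakk>r \<in> hpart R i; x \<in> hpart M j\<rbrakk> \<Longrightarrow> r \<odot>\<^bsub>M\<^esub> x \<in> hpart M (i + j)"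
  using assms by (auto simp: graded_module_def left_module_def intro: direct_graded_group.intro)

lemma degree_homD:
  assumes "f \<in> degree_hom R j M N"
  shows degree_hom_mod_hom: "f \<in> mod_hom R M N"
    and degree_hom_hpart: "x \<in> hpart M i \<Longrightarrow> f x \<in> hpart N (i + j)"
  using assms by (auto simp: degree_hom_def)

text \<open>The generator \<open>x\<close> sits in degree \<open>deg x\<close>, so an element of
  degree \<open>n\<close> has its coefficient at \<open>x\<close> in degree
  \<open>n - deg x\<close>.\<close>

definition free_graded ::
  "('k, 'r, 'z) graded_scheme \<Rightarrow> 'x set \<Rightarrow> ('x \<Rightarrow> int) \<Rightarrow> ('r, 'x \<Rightarrow> 'r) graded" where
  "free_graded R X deg =
     \<lparr>carrier = fin_supp R X, mult = undefined, one = undefined,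
      zero = (\<lambda>_. \<zero>\<^bsub>R\<^esub>), add = (\<lambda>p q x. p x \<oplus>\<^bsub>R\<^esub> q x), smult = (\<lambda>r p x. r \<otimes>\<^bsub>R\<^esub> p x),
      hpart = (\<lambda>n. {p \<in> fin_supp R X. \<forall>x. p x \<in> hpart R (n - deg x)})\<rparr>"

lemma free_graded_free: "ring R \<Longrightarrow> free_left_module R (free_graded R X deg) X"
  by (simp add: free_left_module_def free_left_module_axioms_def free_graded_def)

lemma free_graded_hpart:
  "p \<in> hpart (free_graded R X deg) n \<longleftrightarrow>
    p \<in> carrier (free_graded R X deg) \<and> (\<forall>x. p x \<in> hpart R (n - deg x))"
  by (simp add: free_graded_def)

context graded_ring
begin

lemma free_graded_module: "graded_module R (free_graded R X deg)"
proof -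
  let ?F = "free_graded R X deg"
  interpret F: free_left_module R ?F X by (rule free_graded_free[OF R.ring_axioms])
  interpret FM: left_module R ?F by (rule F.F_left_module)
  have inv: "(\<ominus>\<^bsub>?F\<^esub> p) x = \<ominus> p x" if "p \<in> carrier ?F" for p x
  proof -
    have ev: "(\<lambda>p. p x) \<in> add_hom ?F R"
      by (auto simp: add_hom_def F.add_F F.F_closed)
    show ?thesis
      by (rule add_hom_inv[OF FM.M.abelian_group_axioms R.abelian_group_axioms ev that])
  qed
  have G: "graded_group ?F"
  proof (intro graded_group.intro graded_group_axioms.intro FM.M.abelian_group_axioms)
    show "additive_subgroup (hpart ?F i) ?F" for i
    proof (intro additive_subgroupI FM.M.add.subgroupI)
      have "\<zero>\<^bsub>?F\<^esub> \<in> hpart ?F i"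
        using FM.M.zero_closed by (simp add: free_graded_hpart) (simp add: F.zero_F hpart_zero)
      then show "hpart ?F i \<noteq> {}" by auto
    qed (auto simp: free_graded_hpart inv hpart_inv, simp add: F.add_F hpart_add)
  qed
  interpret G: graded_group ?F by fact
  have D: "direct_grading ?F"
  \<comment> \<open>The projection to degree \<open>n\<close> acts coordinatewise, the shift by
    \<open>deg x\<close> accounting for the degree of the generator.\<close>
  proof (rule direct_gradingI[OF G, where p = "\<lambda>n p x. hcomp R (p x) (n - deg x)"])
    show "\<exists>c. homog_decomp ?F c p" if "p \<in> carrier ?F" for p
      using that
    proof (induction rule: F.free_induct)
      case zero
      show ?case using G.decomp_zero by blast
    next
      case (step p x r)
      then obtain c where c: "homog_decomp ?F c p" by blast
      \<comment> \<open>A scalar splits into homogeneous pieces and \<open>?f\<close> has degree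
        \<open>deg x\<close>, so multiples of a generator split as well.\<close>
      let ?f = "\<lambda>r. r \<odot>\<^bsub>?F\<^esub> basis_elem R x"
      have b: "basis_elem R x \<in> carrier ?F" using step by (simp add: F.basis_closed)
      have f: "?f \<in> add_hom R ?F" by (rule FM.scalar_add_hom[OF b])
      have "?f s \<in> hpart ?F (i + deg x)" if "s \<in> hpart R i" for s i
        using that add_hom_closed[OF f] hpart_closed hpart_zero
        by (simp add: free_graded_hpart) (auto simp: F.smult_F basis_elem_def)
      from decomp_map[OF graded_group_axioms G f this hcomp_decomp[OF \<open>r \<in> carrier R\<close>]]
      have "\<exists>c. homog_decomp ?F c (?f r)" by blast
      then show ?case using G.decomp_add[OF c] by blast
    qed
    show "(\<lambda>p x. hcomp R (p x) (n - deg x)) \<in> add_hom ?F ?F" for n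
      unfolding add_hom_def
    proof (intro CollectI conjI ballI Pi_I)
      show "(\<lambda>x. hcomp R (p x) (n - deg x)) \<in> carrier ?F" if "p \<in> carrier ?F" for p
        using that
        by (intro F.F_I[where A = "{x. p x \<noteq> \<zero>}"])
          (auto simp: F.F_closed hcomp_closed F.F_finite hcomp_zero dest: F.F_supp)
    qed (auto simp: F.add_F hcomp_add F.F_closed)
    show "(\<lambda>x. hcomp R (p x) (n - deg x)) = (if n = j then p else \<zero>\<^bsub>?F\<^esub>)" if "p \<in> hpart ?F j" for n j p
    proof -
      have "hcomp R (p x) (n - deg x) = (if n = j then p x else \<zero>)" for x
        using that hcomp_homog[of "p x" "j - deg x" "n - deg x"] by (auto simp: free_graded_hpart)
      then show ?thesis by (auto simp: F.zero_F)
    qed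
  qed
  have "r \<odot>\<^bsub>?F\<^esub> p \<in> hpart ?F (i + j)" if "r \<in> hpart R i" "p \<in> hpart ?F j" for r p i j
  proof -
    have "r \<otimes> p x \<in> hpart R (i + j - deg x)" for x
      using graded_mult[OF that(1), of "p x" "j - deg x"] that by (simp add: free_graded_hpart algebra_simps)
    moreover have "r \<odot>\<^bsub>?F\<^esub> p \<in> carrier ?F"
      using that by (simp add: free_graded_hpart hpart_closed F.F_smult_closed)
    ultimately show ?thesis by (simp add: free_graded_hpart F.smult_F)
  qed
  then show ?thesis using D FM.left_module_axioms by (auto simp: graded_module_def)
qed

end

definition decode :: "(int \<times> 'm \<Rightarrow> 'x) \<Rightarrow> (int \<Rightarrow> 'm set) \<Rightarrow> 'x \<Rightarrow> int \<times> 'm" where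
  "decode enc Y = inv_into (SIGMA i:UNIV. Y i) enc"

text \<open>The elements of \<open>Y i\<close> become generators of degree \<open>i\<close>; the injection \<open>enc\<close> makes room for them
  in the type \<open>'x\<close>.\<close>

definition cover ::
  "('k, 'r, 'z) graded_scheme \<Rightarrow> (int \<times> 'm \<Rightarrow> 'x) \<Rightarrow> (int \<Rightarrow> 'm set) \<Rightarrow> ('r, 'x \<Rightarrow> 'r) graded" where
  "cover R enc Y = free_graded R (enc ` (SIGMA i:UNIV. Y i)) (\<lambda>x. fst (decode enc Y x))"

definition cover_map ::
  "('k, 'r, 'z) graded_scheme \<Rightarrow> ('r, 'm, 'y) graded_scheme \<Rightarrow> (int \<times> 'm \<Rightarrow> 'x) \<Rightarrow> (int \<Rightarrow> 'm set) \<Rightarrow>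
   ('x \<Rightarrow> 'r) \<Rightarrow> 'm" where
  "cover_map R M enc Y = lin_ext R M (\<lambda>x. snd (decode enc Y x))"

text \<open>One step of a resolution. The kernel of a degree-preserving map is generated by
  homogeneous elements, since the components of a cycle are cycles; taking all homogeneous cycles as
  generators avoids any choice. With the zero map for \<open>f\<close>, the same statement covers
  \<open>M\<close> itself.\<close>

lemma (in graded_ring) cover:
  assumes M: "graded_module R M" and N: "graded_module R N" and f: "f \<in> degree_hom R 0 M N"
    and Y: "Y = (\<lambda>i. {y \<in> hpart M i. f y = \<zero>\<^bsub>N\<^esub>})" and enc: "inj_on enc (SIGMA i:UNIV. Y i)"
  shows "projective R (cover R enc Y)" "graded_module R (cover R enc Y)"
    "cover_map R M enc Y \<in> degree_hom R 0 (cover R enc Y) M"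
    "cover_map R M enc Y ` carrier (cover R enc Y) = {x \<in> carrier M. f x = \<zero>\<^bsub>N\<^esub>}"
proof -
  let ?X = "enc ` (SIGMA i:UNIV. Y i)"
  let ?deg = "\<lambda>x. fst (decode enc Y x)" and ?n = "\<lambda>x. snd (decode enc Y x)"
  let ?F = "free_graded R ?X ?deg" and ?e = "cover_map R M enc Y"
  interpret F: free_left_module R ?F ?X by (rule free_graded_free[OF R.ring_axioms])
  interpret FM: left_module R ?F by (rule F.F_left_module)
  interpret M: left_module R M by (rule graded_module_left[OF M])
  interpret MG: direct_graded_group M by (rule graded_module_direct[OF M])
  interpret N: left_module R N by (rule graded_module_left[OF N])
  interpret NG: direct_graded_group N by (rule graded_module_direct[OF N])
  note fm = degree_hom_mod_hom[OF f]
  have cov: "cover R enc Y = ?F" by (simp add: cover_def)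
  show "projective R (cover R enc Y)" unfolding cov by (rule F.F_projective)
  show "graded_module R (cover R enc Y)" unfolding cov by (rule free_graded_module)
  have dec: "?n x \<in> hpart M (?deg x)" "f (?n x) = \<zero>\<^bsub>N\<^esub>" if "x \<in> ?X" for x
  proof -
    have "decode enc Y x \<in> (SIGMA i:UNIV. Y i)"
      unfolding decode_def by (rule inv_into_into[OF that])
    then show "?n x \<in> hpart M (?deg x)" "f (?n x) = \<zero>\<^bsub>N\<^esub>" by (auto simp: Y mem_Times_iff)
  qed
  have n: "?n \<in> ?X \<rightarrow> carrier M" by (rule Pi_I) (rule MG.hpart_closed[OF dec(1)])
  have L: "?e \<in> mod_hom R ?F M"
    unfolding cover_map_def by (rule F.lin_ext_mod_hom[OF M.left_module_axioms n])
  have Lb: "?e (basis_elem R x) = ?n x" if "x \<in> ?X" for x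
    unfolding cover_map_def by (rule F.lin_ext_basis[OF M.left_module_axioms n that])
  have "?e p \<in> hpart M i" if p: "p \<in> hpart ?F i" for p i
    unfolding cover_map_def lin_ext_def
  proof (rule MG.hpart_finsum)
    fix x assume "x \<in> {x. p x \<noteq> \<zero>}"
    then have "x \<in> ?X" using p F.F_supp by (auto simp: free_graded_hpart)
    from graded_module_smult[OF M _ dec(1)[OF this], of "p x" "i - ?deg x"] p
    show "p x \<odot>\<^bsub>M\<^esub> ?n x \<in> hpart M i" by (simp add: free_graded_hpart)
  qed
  then show "?e \<in> degree_hom R 0 (cover R enc Y) M"
    using L by (auto simp: degree_hom_def cov)
  have "f (?e p) = \<zero>\<^bsub>N\<^esub>" if "p \<in> carrier ?F" for p
    by (rule F.free_hom_ext[OF N.left_module_axioms _ _ _ that])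
      (auto simp: mod_hom_def mod_homD[OF fm] mod_homD[OF L] N.smult_zero Lb dec(2))
  moreover have "x \<in> ?e ` carrier ?F" if x: "x \<in> carrier M" "f x = \<zero>\<^bsub>N\<^esub>" for x
  proof -
    let ?A = "{i. hcomp M x i \<noteq> \<zero>\<^bsub>M\<^esub>}" and ?x = "\<lambda>i. enc (i, hcomp M x i)"
    have "f (hcomp M x i) = \<zero>\<^bsub>N\<^esub>" for i
      using hcomp_map[OF MG.direct_graded_group_axioms NG.direct_graded_group_axioms
          mod_hom_add_hom[OF fm] degree_hom_hpart[OF f] x(1), of i]
      by (simp add: x(2) NG.hcomp_zero)
    then have Yi: "(i, hcomp M x i) \<in> (SIGMA i:UNIV. Y i)" for i
      by (simp add: Y MG.hcomp_hpart[OF x(1)])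
    have b: "basis_elem R (?x i) \<in> carrier ?F" for i by (rule F.basis_closed[OF imageI[OF Yi]])
    have "?e (basis_elem R (?x i)) = hcomp M x i" for i
      unfolding Lb[OF imageI[OF Yi]] decode_def inv_into_f_f[OF enc Yi] by simp
    \<comment> \<open>The preimage of \<open>x\<close> adds up the generators belonging to its
      nonzero components.\<close>
    then have "?e (\<Oplus>\<^bsub>?F\<^esub>i\<in>?A. basis_elem R (?x i)) = (\<Oplus>\<^bsub>M\<^esub>i\<in>?A. hcomp M x i)"
      using add_hom_finsum[OF FM.M.abelian_group_axioms M.M.abelian_group_axioms mod_hom_add_hom[OF L]
          MG.hcomp_finite[OF x(1)] b] by simp
    also have "\<dots> = x" by (rule MG.hcomp_sum[OF x(1) MG.hcomp_finite[OF x(1)] subset_refl])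
    finally show ?thesis using b by (intro image_eqI[OF sym] FM.M.finsum_closed) auto
  qed
  ultimately show "?e ` carrier (cover R enc Y) = {x \<in> carrier M. f x = \<zero>\<^bsub>N\<^esub>}"
    unfolding cov using mod_hom_closed[OF L] by auto
qed

text \<open>The second component is the family of the homogeneous cycles, to be covered in the next step.\<close>

primrec resolution_step ::
  "('k, 'r, 'z) graded_scheme \<Rightarrow> ('r, 'm, 'y) graded_scheme \<Rightarrow> (int \<times> 'm \<Rightarrow> 'x) \<Rightarrow>
    (int \<times> ('x \<Rightarrow> 'r) \<Rightarrow> 'x) \<Rightarrow> nat \<Rightarrow> ('r, 'x \<Rightarrow> 'r) graded \<times> (int \<Rightarrow> ('x \<Rightarrow> 'r) set)" where
  "resolution_step R M enc0 enc 0 =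
     (let P = cover R enc0 (hpart M)
      in (P, \<lambda>i. {y \<in> hpart P i. cover_map R M enc0 (hpart M) y = \<zero>\<^bsub>M\<^esub>}))"
| "resolution_step R M enc0 enc (Suc n) =
     (let (P, Y) = resolution_step R M enc0 enc n; P' = cover R enc Y
      in (P', \<lambda>i. {y \<in> hpart P' i. cover_map R P enc Y y = \<zero>\<^bsub>P\<^esub>}))"

text \<open>Keeps every term of the resolution inside the set on which the encoding of functions is
  injective.\<close>

lemma cover_carrier: "carrier (cover R enc Y) \<subseteq> fin_supp R UNIV"
  by (auto simp: cover_def free_graded_def fin_supp_def)

text \<open>Two encodings occur because the first cover has elements of \<open>M\<close> as
  generators, while each later one has elements of the preceding term. The second is asked to be
  injective on finitely supported functions only: in general the whole function type is too large to
  embed into \<open>'x\<close>.\<close>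

lemma graded_projective_resolution_ex:
  fixes R :: "('k, 'r, 'z) graded_scheme" and M :: "('r, 'm, 'y) graded_scheme"
    and enc0 :: "int \<times> 'm \<Rightarrow> 'x" and enc :: "int \<times> ('x \<Rightarrow> 'r) \<Rightarrow> 'x"
  assumes R: "graded_ring R" and M: "graded_module R M"
    and enc0: "inj enc0" and enc: "inj_on enc (UNIV \<times> fin_supp R UNIV)"
  shows "\<exists>(P :: nat \<Rightarrow> ('r, 'x \<Rightarrow> 'r) graded) d e. graded_projective_resolution R M P d e"
proof -
  interpret R: graded_ring R by fact
  interpret M: left_module R M by (rule graded_module_left[OF M])
  interpret MG: direct_graded_group M by (rule graded_module_direct[OF M])
  define P where "P n = fst (resolution_step R M enc0 enc n)" for n
  define Y where "Y n = snd (resolution_step R M enc0 enc n)" for n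
  define d where "d n = cover_map R (P n) enc (Y n)" for n
  define e where "e = cover_map R M enc0 (hpart M)"
  have P: "P 0 = cover R enc0 (hpart M)" "P (Suc n) = cover R enc (Y n)" for n
    by (simp_all add: P_def Y_def Let_def split: prod.split)
  have Y: "Y 0 = (\<lambda>i. {y \<in> hpart (P 0) i. e y = \<zero>\<^bsub>M\<^esub>})"
    "Y (Suc n) = (\<lambda>i. {y \<in> hpart (P (Suc n)) i. d n y = \<zero>\<^bsub>P n\<^esub>})" for n
    by (simp_all add: P_def Y_def d_def e_def Let_def split: prod.split)
  \<comment> \<open>The zero map has all of \<open>M\<close> as its kernel, so the covering lemma
    produces the augmentation \<open>e\<close>.\<close>
  have "(\<lambda>_. \<zero>\<^bsub>M\<^esub>) \<in> degree_hom R 0 M M"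
    by (auto simp: degree_hom_def mod_hom_def M.smult_zero MG.hpart_zero)
  note c0 = R.cover[OF M M this, of "hpart M" enc0, folded P e_def,
      OF _ inj_on_subset[OF enc0 subset_UNIV], simplified]
  have enc_Y: "inj_on enc (SIGMA i:UNIV. Y n i)" if "graded_module R (P n)" for n
  proof (rule inj_on_subset[OF enc])
    interpret PG: direct_graded_group "P n" by (rule graded_module_direct[OF that])
    have "carrier (P n) \<subseteq> fin_supp R UNIV"
      using cover_carrier[of R enc0] cover_carrier[of R enc] by (cases n) (simp_all add: P)
    then show "(SIGMA i:UNIV. Y n i) \<subseteq> UNIV \<times> fin_supp R UNIV"
      using PG.hpart_closed by (cases n) (auto simp: Y)
  qed
  note c1 = R.cover[OF c0(2) M c0(3) Y(1) enc_Y[OF c0(2)], folded P d_def]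
  have c: "graded_module R (P n) \<and> graded_module R (P (Suc n)) \<and> projective R (P (Suc n)) \<and>
      d n \<in> degree_hom R 0 (P (Suc n)) (P n)" for n
  proof (induction n)
    case 0
    show ?case using c0(2) c1 by simp
  next
    case (Suc n)
    then show ?case
      using R.cover[OF _ _ _ Y(2)[of n] enc_Y, folded P d_def] by blast
  qed
  have "d (Suc n) ` carrier (P (Suc (Suc n))) = a_kernel (P (Suc n)) (P n) (d n)" for n
    using R.cover(4)[OF _ _ _ Y(2)[of n] enc_Y, folded P d_def] c[of n] by (simp add: a_kernel_def')
  moreover have "d 0 ` carrier (P 1) = a_kernel (P 0) M e" using c1(4) by (simp add: a_kernel_def')
  moreover have "projective R (P n)" for n using c0(1) c by (cases n) auto
  moreover have "d n \<in> mod_hom R (P (Suc n)) (P n)" for n using c degree_hom_mod_hom by blast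
  ultimately have "graded_projective_resolution R M P d e"
    using c c0(3,4) degree_hom_mod_hom[OF c0(3)]
    unfolding graded_projective_resolution_def projective_resolution_def by auto
  then show ?thesis by blast
qed

section \<open>Encoding integers and finitely supported functions by lists\<close>

text \<open>The letter \<open>a\<close> announces an entry and \<open>b\<close> ends a list, so the code can be read back.\<close>

fun flatten :: "'x \<Rightarrow> 'x \<Rightarrow> 'x list list \<Rightarrow> 'x list" where
  "flatten a b [] = []"
| "flatten a b ([] # ls) = b # flatten a b ls"
| "flatten a b ((x # l) # ls) = a # x # flatten a b (l # ls)"

lemma flatten_inj: "a \<noteq> b \<Longrightarrow> flatten a b ls = flatten a b ls' \<Longrightarrow> ls = ls'"
proof (induction a b ls arbitrary: ls' rule: flatten.induct)
  case (1 a b)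
  then show ?case by (cases "(a, b, ls')" rule: flatten.cases) auto
next
  case (2 a b ls)
  then show ?case by (cases "(a, b, ls')" rule: flatten.cases) auto
next
  case (3 a b x l ls)
  show ?case
  proof (cases "(a, b, ls')" rule: flatten.cases)
    case (3 a' b' y l' ls'')
    with "3.prems" have "flatten a b (l # ls) = flatten a b (l' # ls'')" "x = y" by auto
    with "3.IH" "3.prems" 3 show ?thesis by blast
  qed (use "3.prems" in auto)
qed

text \<open>The integer is stored as the length of a constant list; \<open>Suc\<close> keeps the
  list nonempty, so that \<open>m\<close> can be read off.\<close>

lemma int_pair_list_encoding:
  "\<exists>enc0 :: int \<times> 'm \<Rightarrow> ('r + 'm) list. inj enc0"
proof -
  obtain t :: "int \<Rightarrow> nat" where t: "inj t" using ex_inj by blast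
  have "inj (\<lambda>(i, m). replicate (Suc (t i)) (Inr m :: 'r + 'm))"
    using t by (auto simp: inj_def)
  then show ?thesis by blast
qed

text \<open>Listing the nonzero values with their arguments determines the function, failed lookups
  standing for zero.\<close>

lemma fin_supp_list:
  assumes "f \<in> fin_supp R X"
  shows "\<exists>l. f = (\<lambda>x. case map_of l x of Some v \<Rightarrow> v | None \<Rightarrow> \<zero>\<^bsub>R\<^esub>)"
proof -
  have "finite {x. f x \<noteq> \<zero>\<^bsub>R\<^esub>}" using assms by (simp add: fin_supp_def)
  then obtain xs where xs: "set xs = {x. f x \<noteq> \<zero>\<^bsub>R\<^esub>}" using finite_list by blast
  have "map_of (map (\<lambda>x. (x, f x)) xs) x = (if x \<in> set xs then Some (f x) else None)" for x
    by (induction xs) auto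
  then show ?thesis using xs by (intro exI[of _ "map (\<lambda>x. (x, f x)) xs"]) auto
qed

lemma fin_supp_list_encoding:
  fixes R :: "('r, 'z) ring_scheme"
  shows "\<exists>enc :: int \<times> (('r + 'm) list \<Rightarrow> 'r) \<Rightarrow> ('r + 'm) list. inj_on enc (UNIV \<times> fin_supp R UNIV)"
proof -
  obtain t :: "int \<Rightarrow> nat" where t: "inj t" using ex_inj by blast
  define dec where "dec l = (\<lambda>x. case map_of l x of Some v \<Rightarrow> v | None \<Rightarrow> \<zero>\<^bsub>R\<^esub>)"
    for l :: "(('r + 'm) list \<times> 'r) list"
  define un where "un f = (SOME l. f = dec l)" for f
  \<comment> \<open>Letters from different summands are distinct even if both types are
    singletons.\<close>
  define a b :: "'r + 'm" where "a = Inl undefined" and "b = Inr undefined"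
  \<comment> \<open>The length of the first inner list records the integer. Each further list holds
    one entry of the association list, with the value as its head and the key, itself a list, as its
    tail.\<close>
  define enc where "enc = (\<lambda>(i, f). flatten a b (replicate (t i) a # map (\<lambda>(k, v). Inl v # k) (un f)))"
  have un: "dec (un f) = f" if "f \<in> fin_supp R UNIV" for f
    unfolding un_def using someI_ex[OF fin_supp_list[OF that, folded dec_def]] by simp
  have ab: "a \<noteq> b" by (simp add: a_def b_def)
  have m: "inj (map (\<lambda>(k, v). (Inl v :: 'r + 'm) # k))" by (auto simp: inj_def)
  have "inj_on enc (UNIV \<times> fin_supp R UNIV)"
  proof (intro inj_onI, clarify)
    fix i j f g assume f: "f \<in> fin_supp R UNIV" and g: "g \<in> fin_supp R UNIV" and "enc (i, f) = enc (j, g)"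
    then have "flatten a b (replicate (t i) a # map (\<lambda>(k, v). Inl v # k) (un f)) =
        flatten a b (replicate (t j) a # map (\<lambda>(k, v). Inl v # k) (un g))"
      unfolding enc_def by simp
    from flatten_inj[OF ab this] have "replicate (t i) a # map (\<lambda>(k, v). Inl v # k) (un f) =
        replicate (t j) a # map (\<lambda>(k, v). Inl v # k) (un g)"
      .
    then have "t i = t j" and "un f = un g" using injD[OF m] by (auto simp: replicate_eq_replicate)
    then show "i = j \<and> f = g" using t un[OF f] un[OF g] by (metis injD)
  qed
  then show ?thesis by blast
qed

section \<open>The comparison theorem\<close>

text \<open>\<open>projective\<close> tests only modules whose elements have the type of
  \<open>P\<close>, while \<open>C\<close> may live elsewhere. But the image of \<open>g\<close> is
  a quotient of \<open>Q\<close>, so it has a copy carried by representatives in \<open>Q\<close>.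
  Asking that \<open>f\<close> map into this image, rather than that \<open>g\<close> be onto, fits
  the use with exact sequences.\<close>

lemma projective_lift:
  fixes P :: "('r, 'p, 'x) module_scheme" and Q :: "('r, 'p, 'y) module_scheme"
    and C :: "('r, 'c, 'w) module_scheme"
  assumes P: "projective R P" and Q: "left_module R Q" and C: "left_module R C"
    and g: "g \<in> mod_hom R Q C" and f: "f \<in> mod_hom R P C"
    and sub: "f ` carrier P \<subseteq> g ` carrier Q"
  shows "\<exists>h\<in>mod_hom R P Q. \<forall>x\<in>carrier P. g (h x) = f x"
proof -
  interpret Q: left_module R Q by fact
  interpret C: left_module R C by fact
  define s where "s = inv_into (carrier Q) g"
  define N :: "('r, 'p) module" where
    "N = \<lparr>carrier = carrier Q, mult = undefined, one = undefined, zero = zero Q, add = add Q, smult = smult Q\<rparr>"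
  \<comment> \<open>The copy of the image of \<open>g\<close>: each element is replaced by its
    preimage under the section \<open>s\<close>, and the operations of \<open>C\<close> are carried
    over along \<open>s\<close> and \<open>g\<close>.\<close>
  define N' :: "('r, 'p) module" where
    "N' = \<lparr>carrier = s ` g ` carrier Q, mult = undefined, one = undefined, zero = s \<zero>\<^bsub>C\<^esub>,
      add = (\<lambda>x y. s (g x \<oplus>\<^bsub>C\<^esub> g y)), smult = (\<lambda>r x. s (r \<odot>\<^bsub>C\<^esub> g x))\<rparr>"
  have gs: "g (s c) = c" if "c \<in> g ` carrier Q" for c
    unfolding s_def using that by (rule f_inv_into_f)
  note gD = mod_homD[OF g]
  have g0: "g \<zero>\<^bsub>Q\<^esub> = \<zero>\<^bsub>C\<^esub>"
    by (rule add_hom_zero[OF Q.M.abelian_group_axioms C.M.abelian_group_axioms mod_hom_add_hom[OF g]])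
  have N: "left_module R N"
    by (rule left_module_image[OF Q, where f = "\<lambda>x. x"]) (simp_all add: N_def)
  have N'ops: "s (g x) \<oplus>\<^bsub>N'\<^esub> s (g y) = s (g (x \<oplus>\<^bsub>Q\<^esub> y))" "r \<in> carrier R \<Longrightarrow> r \<odot>\<^bsub>N'\<^esub> s (g x) = s (g (r \<odot>\<^bsub>Q\<^esub> x))"
    if "x \<in> carrier Q" "y \<in> carrier Q" for x y r
    using that by (auto simp: N'_def gs gD)
  have N': "left_module R N'"
    by (rule left_module_image[OF Q, where f = "\<lambda>x. s (g x)"])
      (auto simp: N'ops, auto simp: N'_def g0)
  have sg: "(\<lambda>x. s (g x)) \<in> mod_hom R N N'"
    by (intro mod_homI) (auto simp: N'ops N_def, auto simp: N'_def)
  have onto: "(\<lambda>x. s (g x)) ` carrier N = carrier N'"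
    by (auto simp: N_def N'_def)
  have sf: "(\<lambda>x. s (f x)) \<in> mod_hom R P N'"
  proof (rule mod_homI)
    show "s (f x) \<in> carrier N'" if "x \<in> carrier P" for x
      using sub that by (auto simp: N'_def)
    show "s (f (x \<oplus>\<^bsub>P\<^esub> y)) = s (f x) \<oplus>\<^bsub>N'\<^esub> s (f y)" if "x \<in> carrier P" "y \<in> carrier P" for x y
    proof -
      have "f x \<in> g ` carrier Q" "f y \<in> g ` carrier Q" using sub that by auto
      then show ?thesis using that mod_hom_add[OF f] by (simp add: N'_def gs)
    qed
    show "s (f (r \<odot>\<^bsub>P\<^esub> x)) = r \<odot>\<^bsub>N'\<^esub> s (f x)" if "r \<in> carrier R" "x \<in> carrier P" for r x
    proof -
      have "f x \<in> g ` carrier Q" using sub that by auto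
      then show ?thesis using that mod_hom_smult[OF f] by (simp add: N'_def gs)
    qed
  qed
  have "\<exists>h\<in>mod_hom R P N. \<forall>x\<in>carrier P. s (g (h x)) = s (f x)"
    using P N N' sg onto sf unfolding projective_def by blast
  then obtain h where h: "h \<in> mod_hom R P N" and eqs: "\<forall>x\<in>carrier P. s (g (h x)) = s (f x)" by blast
  have hQ: "h \<in> mod_hom R P Q" using h by (simp add: mod_hom_def N_def)
  have "g (h x) = f x" if "x \<in> carrier P" for x
  proof -
    \<comment> \<open>Applying \<open>g\<close> undoes \<open>s\<close> on both sides.\<close>
    have "g (s (g (h x))) = g (s (f x))" using eqs that by simp
    then show ?thesis using gs sub that mod_hom_closed[OF hQ that] by auto
  qed
  with hQ show ?thesis by blast
qed

text \<open>Maps given separately on each degree assemble to an additive map. The range of summation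
  depends on the argument, so additivity is checked over the union of two supports.\<close>

lemma (in direct_graded_group) finsum_hcomp_hom:
  assumes "abelian_group N" "\<And>i. k i \<in> add_hom M N"
  shows "(\<lambda>x. \<Oplus>\<^bsub>N\<^esub>i\<in>{i. hcomp M x i \<noteq> \<zero>}. k i (hcomp M x i)) \<in> add_hom M N"
proof -
  interpret N: abelian_group N by fact
  have k0: "k i \<zero> = \<zero>\<^bsub>N\<^esub>" for i by (rule add_hom_zero[OF abelian_group_axioms assms])
  have kc: "k i (hcomp M x j) \<in> carrier N" if "x \<in> carrier M" for i j x
    using add_hom_closed[OF assms(2)] hcomp_closed[OF that] by blast
  have sup: "(\<Oplus>\<^bsub>N\<^esub>i\<in>{i. hcomp M x i \<noteq> \<zero>}. k i (hcomp M x i)) = (\<Oplus>\<^bsub>N\<^esub>i\<in>A. k i (hcomp M x i))"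
    if "x \<in> carrier M" "finite A" "{i. hcomp M x i \<noteq> \<zero>} \<subseteq> A" for x A
    using that k0 kc by (intro N.finsum_superset) auto
  show ?thesis
    unfolding add_hom_def
  proof (intro CollectI conjI ballI Pi_I)
    show "(\<Oplus>\<^bsub>N\<^esub>i\<in>{i. hcomp M x i \<noteq> \<zero>}. k i (hcomp M x i)) \<in> carrier N" if "x \<in> carrier M" for x
      using kc[OF that] by (intro N.finsum_closed) auto
    fix x y assume x: "x \<in> carrier M" and y: "y \<in> carrier M"
    let ?A = "{i. hcomp M x i \<noteq> \<zero>} \<union> {i. hcomp M y i \<noteq> \<zero>}"
    have fin: "finite ?A" using x y hcomp_finite by simp
    have xy: "x \<oplus> y \<in> carrier M" using x y by simp
    have "{i. hcomp M (x \<oplus> y) i \<noteq> \<zero>} \<subseteq> ?A" using x y by (auto simp: hcomp_add)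
    then have "(\<Oplus>\<^bsub>N\<^esub>i\<in>{i. hcomp M (x \<oplus> y) i \<noteq> \<zero>}. k i (hcomp M (x \<oplus> y) i)) =
        (\<Oplus>\<^bsub>N\<^esub>i\<in>?A. k i (hcomp M (x \<oplus> y) i))"
      by (rule sup[OF xy fin])
    also have "\<dots> = (\<Oplus>\<^bsub>N\<^esub>i\<in>?A. k i (hcomp M x i) \<oplus>\<^bsub>N\<^esub> k i (hcomp M y i))"
      using kc[OF x] kc[OF y]
      by (intro N.finsum_cong' refl) (auto simp: hcomp_add x y add_hom_add[OF assms(2)] hcomp_closed)
    also have "\<dots> = (\<Oplus>\<^bsub>N\<^esub>i\<in>?A. k i (hcomp M x i)) \<oplus>\<^bsub>N\<^esub> (\<Oplus>\<^bsub>N\<^esub>i\<in>?A. k i (hcomp M y i))"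
      using kc[OF x] kc[OF y] by (intro N.finsum_addf) auto
    finally show "(\<Oplus>\<^bsub>N\<^esub>i\<in>{i. hcomp M (x \<oplus> y) i \<noteq> \<zero>}. k i (hcomp M (x \<oplus> y) i)) =
        (\<Oplus>\<^bsub>N\<^esub>i\<in>{i. hcomp M x i \<noteq> \<zero>}. k i (hcomp M x i)) \<oplus>\<^bsub>N\<^esub>
        (\<Oplus>\<^bsub>N\<^esub>i\<in>{i. hcomp M y i \<noteq> \<zero>}. k i (hcomp M y i))"
      using sup[OF x fin] sup[OF y fin] by simp
  qed
qed

lemma degree_hom_comp:
  assumes "f \<in> degree_hom R i M N" "g \<in> degree_hom R j N L"
  shows "(\<lambda>x. g (f x)) \<in> degree_hom R (i + j) M L"
  using assms degree_hom_hpart[OF assms(2), of "f _" "_ + i"]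
  by (auto simp: degree_hom_def mod_hom_def Pi_iff image_subset_iff add.assoc)

lemma degree_hom_diff:
  assumes N: "graded_module R N" and M: "graded_module R M"
    and f: "f \<in> degree_hom R j M N" and g: "g \<in> degree_hom R j M N"
  shows "(\<lambda>x. f x \<ominus>\<^bsub>N\<^esub> g x) \<in> degree_hom R j M N"
proof -
  interpret N: left_module R N by (rule graded_module_left[OF N])
  interpret NG: direct_graded_group N by (rule graded_module_direct[OF N])
  interpret M: direct_graded_group M by (rule graded_module_direct[OF M])
  note fD = mod_homD[OF degree_hom_mod_hom[OF f]] and gD = mod_homD[OF degree_hom_mod_hom[OF g]]
  have "(\<lambda>x. f x \<ominus>\<^bsub>N\<^esub> g x) \<in> mod_hom R M N"
  proof (rule mod_homI)
    fix x y assume "x \<in> carrier M" "y \<in> carrier M"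
    then show "f (x \<oplus>\<^bsub>M\<^esub> y) \<ominus>\<^bsub>N\<^esub> g (x \<oplus>\<^bsub>M\<^esub> y) = (f x \<ominus>\<^bsub>N\<^esub> g x) \<oplus>\<^bsub>N\<^esub> (f y \<ominus>\<^bsub>N\<^esub> g y)"
      by (simp add: fD gD a_minus_def N.M.minus_add N.M.add.m_ac)
  qed (auto simp: fD gD N.smult_minus)
  moreover have "f x \<ominus>\<^bsub>N\<^esub> g x \<in> hpart N (i + j)" if "x \<in> hpart M i" for x i
    using degree_hom_hpart[OF f that] degree_hom_hpart[OF g that]
    by (simp add: a_minus_def NG.hpart_add NG.hpart_inv)
  ultimately show ?thesis by (auto simp: degree_hom_def)
qed

lemma degree_hom_id: "(\<lambda>x. x) \<in> degree_hom R 0 M M"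
  by (auto simp: degree_hom_def mod_hom_def)

text \<open>The components of degree zero of an arbitrary lift again form a lift.\<close>

lemma graded_projective_lift:
  fixes P :: "('r, 'p, 'x) graded_scheme" and Q :: "('r, 'p, 'y) graded_scheme"
    and C :: "('r, 'c, 'w) graded_scheme"
  assumes R: "graded_ring R" and proj: "projective R P"
    and P: "graded_module R P" and Q: "graded_module R Q" and C: "graded_module R C"
    and g: "g \<in> degree_hom R 0 Q C" and f: "f \<in> degree_hom R 0 P C"
    and sub: "f ` carrier P \<subseteq> g ` carrier Q"
  shows "\<exists>h\<in>degree_hom R 0 P Q. \<forall>x\<in>carrier P. g (h x) = f x"
proof -
  interpret R: graded_ring R by fact
  interpret P: left_module R P by (rule graded_module_left[OF P])
  interpret PG: direct_graded_group P by (rule graded_module_direct[OF P])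
  interpret Q: left_module R Q by (rule graded_module_left[OF Q])
  interpret QG: direct_graded_group Q by (rule graded_module_direct[OF Q])
  interpret C: left_module R C by (rule graded_module_left[OF C])
  interpret CG: direct_graded_group C by (rule graded_module_direct[OF C])
  note gm = degree_hom_mod_hom[OF g] and fm = degree_hom_mod_hom[OF f]
  obtain h where h: "h \<in> mod_hom R P Q" and gh: "\<forall>x\<in>carrier P. g (h x) = f x"
    using projective_lift[OF proj Q.left_module_axioms C.left_module_axioms gm fm sub] by blast
  \<comment> \<open>\<open>k i\<close> is the part of the lift that lands in degree
    \<open>i\<close>; applying it to the component of degree \<open>i\<close> only keeps the part of
    \<open>h\<close> of degree zero.\<close>
  define k where "k i y = hcomp Q (h y) i" for i y
  define h0 where "h0 x = (\<Oplus>\<^bsub>Q\<^esub>i\<in>{i. hcomp P x i \<noteq> \<zero>\<^bsub>P\<^esub>}. k i (hcomp P x i))" for x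
  have k: "k i \<in> add_hom P Q" for i
    unfolding k_def by (auto simp: add_hom_def mod_homD[OF h] QG.hcomp_closed QG.hcomp_add)
  have h0: "h0 \<in> add_hom P Q"
    unfolding h0_def by (rule PG.finsum_hcomp_hom[OF Q.M.abelian_group_axioms k])
  have h0_hom: "h0 x = k i x" if x: "x \<in> hpart P i" for x i
  proof -
    have xP: "x \<in> carrier P" by (rule PG.hpart_closed[OF x])
    have z: "k j \<zero>\<^bsub>P\<^esub> = \<zero>\<^bsub>Q\<^esub>" for j
      by (rule add_hom_zero[OF P.M.abelian_group_axioms Q.M.abelian_group_axioms k])
    have "h0 x = (\<Oplus>\<^bsub>Q\<^esub>i\<in>{i}. k i (hcomp P x i))"
      unfolding h0_def using z add_hom_closed[OF k xP]
      by (intro Q.M.finsum_superset) (auto simp: PG.hcomp_homog[OF x] split: if_splits)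
    also have "\<dots> = k i (hcomp P x i)"
      using add_hom_closed[OF k PG.hcomp_closed[OF xP]] by (intro Q.M.finsum_single) auto
    finally show ?thesis by (simp add: PG.hcomp_homog[OF x])
  qed
  have h0_deg: "h0 x \<in> hpart Q i" if "x \<in> hpart P i" for x i
    unfolding h0_hom[OF that] k_def
    by (rule QG.hcomp_hpart[OF mod_hom_closed[OF h PG.hpart_closed[OF that]]])
  \<comment> \<open>Linearity is reduced to homogeneous vectors and then to homogeneous scalars,
    where it says that taking components commutes, up to a shift, with multiplication by a
    homogeneous scalar.\<close>
  have sm: "h0 (r \<odot>\<^bsub>P\<^esub> x) = r \<odot>\<^bsub>Q\<^esub> h0 x" if r: "r \<in> carrier R" and x: "x \<in> carrier P" for r x
    using x
  proof (induction rule: PG.homog_induct)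
    case zero
    show ?case
      using r add_hom_zero[OF P.M.abelian_group_axioms Q.M.abelian_group_axioms h0]
      by (simp add: P.smult_zero Q.smult_zero)
  next
    case (add j y z)
    have z: "z \<in> carrier P" by (rule PG.hpart_closed[OF add(2)])
    from r have "h0 (r \<odot>\<^bsub>P\<^esub> z) = r \<odot>\<^bsub>Q\<^esub> h0 z"
    proof (induction rule: R.homog_induct)
      case zero
      show ?case
        using z add_hom_zero[OF P.M.abelian_group_axioms Q.M.abelian_group_axioms h0] add_hom_closed[OF h0]
        by (simp add: P.zero_smult Q.zero_smult)
    next
      case (add i s t)
      have t: "t \<in> carrier R" by (rule R.hpart_closed[OF add(2)])
      have "h0 (t \<odot>\<^bsub>P\<^esub> z) = hcomp Q (t \<odot>\<^bsub>Q\<^esub> h z) (i + j)"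
        using h0_hom[OF graded_module_smult[OF P add(2) \<open>z \<in> hpart P j\<close>]] mod_hom_smult[OF h t z]
        by (simp add: k_def)
      also have "\<dots> = t \<odot>\<^bsub>Q\<^esub> hcomp Q (h z) (i + j - i)"
        using graded_module_smult[OF Q add(2)] mod_hom_closed[OF h z]
        by (intro hcomp_map Q.smult_add_hom t QG.direct_graded_group_axioms) (auto simp: add.commute)
      also have "\<dots> = t \<odot>\<^bsub>Q\<^esub> h0 z"
        using h0_hom[OF \<open>z \<in> hpart P j\<close>] by (simp add: k_def)
      finally show ?case
        using add t z add_hom_closed[OF h0]
        by (simp add: P.smult_l_distr Q.smult_l_distr add_hom_add[OF h0] P.smult_closed)
    qed
    then show ?case
      using add z r add_hom_closed[OF h0]
      by (simp add: P.smult_r_distr Q.smult_r_distr add_hom_add[OF h0] P.smult_closed)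
  qed
  have "h0 \<in> degree_hom R 0 P Q"
    using h0 sm h0_deg by (auto simp: degree_hom_def mod_hom_def add_hom_def)
  moreover have "g (h0 x) = f x" if "x \<in> carrier P" for x
    using that
  proof (induction rule: PG.homog_induct)
    case zero
    show ?case
      using add_hom_zero[OF P.M.abelian_group_axioms Q.M.abelian_group_axioms h0]
        add_hom_zero[OF Q.M.abelian_group_axioms C.M.abelian_group_axioms mod_hom_add_hom[OF gm]]
        add_hom_zero[OF P.M.abelian_group_axioms C.M.abelian_group_axioms mod_hom_add_hom[OF fm]] by simp
  next
    case (add j y z)
    have z: "z \<in> carrier P" by (rule PG.hpart_closed[OF add(2)])
    \<comment> \<open>As \<open>g\<close> has degree zero and \<open>f z\<close> is homogeneous,
      discarding the other components of \<open>h z\<close> does not change its image under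
      \<open>g\<close>.\<close>
    have "g (hcomp Q (h z) j) = hcomp C (g (h z)) j"
      using hcomp_map[OF QG.direct_graded_group_axioms CG.direct_graded_group_axioms
          mod_hom_add_hom[OF gm] degree_hom_hpart[OF g] mod_hom_closed[OF h z], of j] by simp
    also have "\<dots> = f z"
      using gh z CG.hcomp_homog[OF degree_hom_hpart[OF f add(2)], of j] by simp
    finally have "g (h0 z) = f z" using h0_hom[OF add(2)] by (simp add: k_def)
    then show ?case
      using add z add_hom_closed[OF h0] by (simp add: add_hom_add[OF h0] mod_hom_add[OF gm] mod_hom_add[OF fm])
  qed
  ultimately show ?thesis by blast
qed


text \<open>Exactness is kept apart from projectivity because a twisted resolution will be the
  target of a chain map, where exactness is what makes lifts exist.\<close>

definition graded_resolution ::
  "('k, 'r, 'z) graded_scheme \<Rightarrow> ('r, 'm, 'x) graded_scheme \<Rightarrow>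
   (nat \<Rightarrow> ('r, 'p, 'y) graded_scheme) \<Rightarrow> (nat \<Rightarrow> 'p \<Rightarrow> 'p) \<Rightarrow> ('p \<Rightarrow> 'm) \<Rightarrow> bool" where
  "graded_resolution R M P d e \<longleftrightarrow> graded_module R M \<and>
     (\<forall>i. graded_module R (P i)) \<and>
     e \<in> degree_hom R 0 (P 0) M \<and> e ` carrier (P 0) = carrier M \<and>
     (\<forall>i. d i \<in> degree_hom R 0 (P (Suc i)) (P i)) \<and>
     d 0 ` carrier (P 1) = a_kernel (P 0) M e \<and>
     (\<forall>i. d (Suc i) ` carrier (P (Suc (Suc i))) = a_kernel (P (Suc i)) (P i) (d i))"

lemma graded_projective_resolutionD:
  assumes "graded_projective_resolution R M P d e" "graded_module R M"
  shows "graded_resolution R M P d e" "projective R (P i)"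
  using assms
  by (auto simp: graded_projective_resolution_def projective_resolution_def graded_resolution_def)

lemma graded_resolutionD:
  assumes "graded_resolution R M P d e"
  shows "graded_module R M" "graded_module R (P i)"
    "e \<in> degree_hom R 0 (P 0) M" "e ` carrier (P 0) = carrier M"
    "d i \<in> degree_hom R 0 (P (Suc i)) (P i)"
    "d 0 ` carrier (P (Suc 0)) = {x \<in> carrier (P 0). e x = \<zero>\<^bsub>M\<^esub>}"
    "d (Suc i) ` carrier (P (Suc (Suc i))) = {x \<in> carrier (P (Suc i)). d i x = \<zero>\<^bsub>P i\<^esub>}"
  using assms by (auto simp: graded_resolution_def a_kernel_def')

lemma graded_resolution_complex:
  assumes "graded_resolution R M P d e"
  shows "x \<in> carrier (P (Suc 0)) \<Longrightarrow> e (d 0 x) = \<zero>\<^bsub>M\<^esub>"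
    "x \<in> carrier (P (Suc (Suc i))) \<Longrightarrow> d i (d (Suc i) x) = \<zero>\<^bsub>P i\<^esub>"
  using graded_resolutionD(6,7)[OF assms] by blast+

lemma degree_hom_closed: "f \<in> degree_hom R j M N \<Longrightarrow> x \<in> carrier M \<Longrightarrow> f x \<in> carrier N"
  by (rule mod_hom_closed[OF degree_hom_mod_hom])

lemma degree_hom_zero:
  assumes "graded_module R M" "graded_module R N" "f \<in> degree_hom R j M N"
  shows "f \<zero>\<^bsub>M\<^esub> = \<zero>\<^bsub>N\<^esub>"
proof -
  interpret M: left_module R M by (rule graded_module_left[OF assms(1)])
  interpret N: left_module R N by (rule graded_module_left[OF assms(2)])
  show ?thesis
    by (rule add_hom_zero[OF M.M.abelian_group_axioms N.M.abelian_group_axioms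
          mod_hom_add_hom[OF degree_hom_mod_hom[OF assms(3)]]])
qed

lemma chain_map_ex:
  fixes P :: "nat \<Rightarrow> ('r, 'p, 'x) graded_scheme" and Q :: "nat \<Rightarrow> ('r, 'p, 'y) graded_scheme"
  assumes R: "graded_ring R"
    and P: "graded_resolution R M P d e" and proj: "\<And>i. projective R (P i)"
    and Q: "graded_resolution R M' Q d' e'"
    and f: "f \<in> degree_hom R 0 M M'"
  shows "\<exists>F. (\<forall>i. F i \<in> degree_hom R 0 (P i) (Q i)) \<and>
    (\<forall>x\<in>carrier (P 0). e' (F 0 x) = f (e x)) \<and>
    (\<forall>i. \<forall>x\<in>carrier (P (Suc i)). d' i (F (Suc i) x) = F i (d i x))"
proof -
  note PD = graded_resolutionD[OF P] and QD = graded_resolutionD[OF Q]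
  \<comment> \<open>The last clause, that \<open>F\<close> after \<open>d n\<close> lands in the
    image of \<open>d' n\<close>, is the invariant that lets the next lift exist. By exactness it
    amounts to being killed by the map that follows in \<open>Q\<close>.\<close>
  define A where "A n F \<longleftrightarrow> F \<in> degree_hom R 0 (P n) (Q n) \<and>
    (n = 0 \<longrightarrow> (\<forall>x\<in>carrier (P 0). e' (F x) = f (e x))) \<and>
    (\<forall>x\<in>carrier (P (Suc n)). F (d n x) \<in> d' n ` carrier (Q (Suc n)))" for n F
  define B where "B n F F' \<longleftrightarrow> (\<forall>x\<in>carrier (P (Suc n)). d' n (F' x) = F (d n x))" for n F F'
  have "\<exists>F. \<forall>n. A n (F n) \<and> B n (F n) (F (Suc n))"
  proof (rule dependent_nat_choice)
    have fe: "(\<lambda>x. f (e x)) \<in> degree_hom R 0 (P 0) M'"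
      using degree_hom_comp[OF PD(3) f] by simp
    have "(\<lambda>x. f (e x)) ` carrier (P 0) \<subseteq> e' ` carrier (Q 0)"
      using degree_hom_closed[OF fe] by (auto simp: QD(4))
    from graded_projective_lift[OF R proj PD(2) QD(2) QD(1) QD(3) fe this]
    obtain F where F: "F \<in> degree_hom R 0 (P 0) (Q 0)" "\<forall>x\<in>carrier (P 0). e' (F x) = f (e x)" by blast
    have "F (d 0 x) \<in> d' 0 ` carrier (Q (Suc 0))" if x: "x \<in> carrier (P (Suc 0))" for x
      using F x degree_hom_closed[OF PD(5) x] degree_hom_closed[OF F(1)] graded_resolution_complex(1)[OF P x]
        degree_hom_zero[OF PD(1) QD(1) f] by (simp add: QD(6))
    then show "\<exists>F. A 0 F" using F by (auto simp: A_def)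
  next
    fix F n assume "A n F"
    then have F: "F \<in> degree_hom R 0 (P n) (Q n)"
      and im: "\<And>x. x \<in> carrier (P (Suc n)) \<Longrightarrow> F (d n x) \<in> d' n ` carrier (Q (Suc n))"
      by (auto simp: A_def)
    have Fd: "(\<lambda>x. F (d n x)) \<in> degree_hom R 0 (P (Suc n)) (Q n)"
      using degree_hom_comp[OF PD(5) F] by simp
    have "(\<lambda>x. F (d n x)) ` carrier (P (Suc n)) \<subseteq> d' n ` carrier (Q (Suc n))" using im by auto
    from graded_projective_lift[OF R proj PD(2) QD(2) QD(2) QD(5) Fd this]
    obtain F' where F': "F' \<in> degree_hom R 0 (P (Suc n)) (Q (Suc n))"
      "\<forall>x\<in>carrier (P (Suc n)). d' n (F' x) = F (d n x)" by blast
    have "F' (d (Suc n) x) \<in> d' (Suc n) ` carrier (Q (Suc (Suc n)))" if x: "x \<in> carrier (P (Suc (Suc n)))" for x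
      using F' x degree_hom_closed[OF PD(5) x] degree_hom_closed[OF F'(1)] graded_resolution_complex(2)[OF P x]
        degree_hom_zero[OF PD(2) QD(2) F] by (simp add: QD(7))
    then show "\<exists>F'. A (Suc n) F' \<and> B n F F'" using F' by (auto simp: A_def B_def)
  qed
  then show ?thesis unfolding A_def B_def by metis
qed

text \<open>\<open>E\<close> is a chain map lifting zero. In use it is the difference between a lift
  of the identity and the identity.\<close>

lemma null_homotopy_ex:
  fixes P :: "nat \<Rightarrow> ('r, 'p, 'x) graded_scheme"
  assumes R: "graded_ring R"
    and P: "graded_resolution R M P d e" and proj: "\<And>i. projective R (P i)"
    and E: "\<And>i. E i \<in> degree_hom R 0 (P i) (P i)"
    and E0: "\<And>x. x \<in> carrier (P 0) \<Longrightarrow> e (E 0 x) = \<zero>\<^bsub>M\<^esub>"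
    and Ed: "\<And>i x. x \<in> carrier (P (Suc i)) \<Longrightarrow> d i (E (Suc i) x) = E i (d i x)"
  shows "\<exists>s. (\<forall>i. s i \<in> degree_hom R 0 (P i) (P (Suc i))) \<and>
    (\<forall>x\<in>carrier (P 0). d 0 (s 0 x) = E 0 x) \<and>
    (\<forall>i. \<forall>x\<in>carrier (P (Suc i)). d (Suc i) (s (Suc i) x) = E (Suc i) x \<ominus>\<^bsub>P (Suc i)\<^esub> s i (d i x))"
proof -
  note PD = graded_resolutionD[OF P]
  interpret Pn: left_module R "P n" for n by (rule graded_module_left[OF PD(2)])
  \<comment> \<open>The clause \<open>d n (s (d n x)) = E n (d n x)\<close> puts the next map to be
    lifted, \<open>E (Suc n) x\<close> minus \<open>s (d n x)\<close>, into the kernel of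
    \<open>d n\<close>, hence into the image of \<open>d (Suc n)\<close>.\<close>
  define A where "A n s \<longleftrightarrow> s \<in> degree_hom R 0 (P n) (P (Suc n)) \<and>
    (n = 0 \<longrightarrow> (\<forall>x\<in>carrier (P 0). d 0 (s x) = E 0 x)) \<and>
    (\<forall>x\<in>carrier (P (Suc n)). d n (s (d n x)) = E n (d n x))" for n s
  define B where "B n s s' \<longleftrightarrow>
    (\<forall>x\<in>carrier (P (Suc n)). d (Suc n) (s' x) = E (Suc n) x \<ominus>\<^bsub>P (Suc n)\<^esub> s (d n x))" for n s s'
  have "\<exists>s. \<forall>n. A n (s n) \<and> B n (s n) (s (Suc n))"
  proof (rule dependent_nat_choice)
    have "E 0 ` carrier (P 0) \<subseteq> d 0 ` carrier (P (Suc 0))"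
      using degree_hom_closed[OF E] E0 by (auto simp: PD(6))
    from graded_projective_lift[OF R proj PD(2) PD(2) PD(2) PD(5) E this]
    obtain s where s: "s \<in> degree_hom R 0 (P 0) (P (Suc 0))" "\<forall>x\<in>carrier (P 0). d 0 (s x) = E 0 x" by blast
    then show "\<exists>s. A 0 s" using degree_hom_closed[OF PD(5)] by (auto simp: A_def)
  next
    fix s n assume "A n s"
    then have s: "s \<in> degree_hom R 0 (P n) (P (Suc n))"
      and sE: "\<And>x. x \<in> carrier (P (Suc n)) \<Longrightarrow> d n (s (d n x)) = E n (d n x)"
      by (auto simp: A_def)
    define f where "f x = E (Suc n) x \<ominus>\<^bsub>P (Suc n)\<^esub> s (d n x)" for x
    have sd: "(\<lambda>x. s (d n x)) \<in> degree_hom R 0 (P (Suc n)) (P (Suc n))"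
      using degree_hom_comp[OF PD(5) s] by simp
    have f: "f \<in> degree_hom R 0 (P (Suc n)) (P (Suc n))"
      unfolding f_def by (rule degree_hom_diff[OF PD(2) PD(2) E sd])
    have "d n (f x) = \<zero>\<^bsub>P n\<^esub>" if x: "x \<in> carrier (P (Suc n))" for x
    proof -
      have "d n (f x) = d n (E (Suc n) x) \<ominus>\<^bsub>P n\<^esub> d n (s (d n x))"
        unfolding f_def
        by (rule add_hom_minus[OF Pn.M.abelian_group_axioms Pn.M.abelian_group_axioms
              mod_hom_add_hom[OF degree_hom_mod_hom[OF PD(5)]] degree_hom_closed[OF E x] degree_hom_closed[OF sd x]])
      also have "\<dots> = \<zero>\<^bsub>P n\<^esub>"
        using degree_hom_closed[OF E degree_hom_closed[OF PD(5) x]] by (simp add: sE[OF x] Ed[OF x] a_minus_def Pn.M.r_neg)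
      finally show ?thesis .
    qed
    then have "f ` carrier (P (Suc n)) \<subseteq> d (Suc n) ` carrier (P (Suc (Suc n)))"
      using degree_hom_closed[OF f] by (auto simp: PD(7))
    from graded_projective_lift[OF R proj PD(2) PD(2) PD(2) PD(5) f this]
    obtain s' where s': "s' \<in> degree_hom R 0 (P (Suc n)) (P (Suc (Suc n)))"
      "\<forall>x\<in>carrier (P (Suc n)). d (Suc n) (s' x) = f x" by blast
    \<comment> \<open>On boundaries the correction term of \<open>f\<close> vanishes, because two
      consecutive differentials compose to zero; this restores the invariant.\<close>
    have "d (Suc n) (s' (d (Suc n) x)) = E (Suc n) (d (Suc n) x)" if x: "x \<in> carrier (P (Suc (Suc n)))" for x
    proof -
      have y: "d (Suc n) x \<in> carrier (P (Suc n))" by (rule degree_hom_closed[OF PD(5) x])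
      show ?thesis
        using s'(2) y degree_hom_zero[OF PD(2) PD(2) s] degree_hom_closed[OF E y]
        by (simp add: f_def graded_resolution_complex(2)[OF P x] a_minus_def)
    qed
    then show "\<exists>s'. A (Suc n) s' \<and> B n s s'" using s' by (auto simp: A_def B_def f_def)
  qed
  then show ?thesis unfolding A_def B_def by metis
qed

section \<open>Quotients and twisted modules\<close>

lemma quot_carrier: "carrier (quot M I) = (\<lambda>x. I +>\<^bsub>M\<^esub> x) ` carrier M"
  by (auto simp: quot_def FactRing_def A_RCOSETS_def')

lemma quot_hpart: "hpart (quot M I) n = (\<lambda>x. I +>\<^bsub>M\<^esub> x) ` hpart M n"
  by (simp add: quot_def)

text \<open>Stated for an arbitrary additive subgroup, since it serves both the coboundaries inside
  the cocycles and the ideal of bilinear relations.\<close>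

locale quotient_group = abelian_group M for M :: "('r, 'm, 'x) graded_scheme" (structure) +
  fixes I
  assumes I_subgroup: "additive_subgroup I M"
begin

lemma I_abelian_subgroup: "abelian_subgroup I M"
  by (rule abelian_subgroupI3[OF I_subgroup abelian_group_axioms])

lemma I_subset: "x \<in> I \<Longrightarrow> x \<in> carrier M"
  by (rule additive_subgroup.a_Hcarr[OF I_subgroup])

lemma coset_eq: "\<lbrakk>x \<in> carrier M; y \<in> carrier M\<rbrakk> \<Longrightarrow> I +> x = I +> y \<longleftrightarrow> x \<ominus> y \<in> I"
proof -
  interpret I: abelian_subgroup I M by (rule I_abelian_subgroup)
  assume xy: "x \<in> carrier M" "y \<in> carrier M"
  have "x \<ominus> y \<in> I \<longleftrightarrow> x \<in> I +> y"
    using I.a_rcos_module[OF xy(2) xy(1)] by (simp add: a_minus_def)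
  also have "\<dots> \<longleftrightarrow> I +> x = I +> y"
    using I.a_repr_independence'[of x y] I.a_rcos_self[OF xy(1)] xy by metis
  finally show ?thesis by simp
qed

lemma coset_zero: "I +> \<zero> = I"
proof -
  interpret I: abelian_subgroup I M by (rule I_abelian_subgroup)
  show ?thesis using a_coset_add_zero[of I] I.a_subset by simp
qed

lemma quot_zero: "\<zero>\<^bsub>quot M I\<^esub> = I +> \<zero>"
  by (simp add: coset_zero quot_def FactRing_def)

lemma quot_add: "\<lbrakk>x \<in> carrier M; y \<in> carrier M\<rbrakk> \<Longrightarrow> (I +> x) \<oplus>\<^bsub>quot M I\<^esub> (I +> y) = I +> (x \<oplus> y)"
proof -
  interpret I: abelian_subgroup I M by (rule I_abelian_subgroup)
  show "\<lbrakk>x \<in> carrier M; y \<in> carrier M\<rbrakk> \<Longrightarrow> ?thesis"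
    using I.a_rcos_sum by (simp add: quot_def FactRing_def)
qed

lemma coset_zero_iff: "x \<in> carrier M \<Longrightarrow> I +> x = \<zero>\<^bsub>quot M I\<^esub> \<longleftrightarrow> x \<in> I"
  using coset_eq[of x \<zero>] by (simp add: quot_zero a_minus_def minus_zero_eq)

lemma quot_abelian_group: "abelian_group (quot M I)"
  by (rule abelian_group_image[OF abelian_group_axioms quot_carrier quot_zero quot_add])

text \<open>The action on a coset is defined as a union over its members; if \<open>r\<close>
  preserves \<open>I\<close>, all members contribute the same coset.\<close>

lemma quot_smult:
  assumes r: "(\<lambda>x. r \<odot>\<^bsub>M\<^esub> x) \<in> add_hom M M" "\<And>x. x \<in> I \<Longrightarrow> r \<odot>\<^bsub>M\<^esub> x \<in> I" and x: "x \<in> carrier M"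
  shows "r \<odot>\<^bsub>quot M I\<^esub> (I +> x) = I +> (r \<odot>\<^bsub>M\<^esub> x)"
proof -
  have "I +> (r \<odot>\<^bsub>M\<^esub> y) = I +> (r \<odot>\<^bsub>M\<^esub> x)" if "y \<in> I +> x" for y
  proof -
    obtain z where z: "z \<in> I" "y = z \<oplus> x" using \<open>y \<in> I +> x\<close> by (auto simp: a_r_coset_def')
    have c: "r \<odot>\<^bsub>M\<^esub> z \<in> carrier M" "r \<odot>\<^bsub>M\<^esub> x \<in> carrier M" "z \<in> carrier M"
      using add_hom_closed[OF r(1)] I_subset z x by auto
    have "r \<odot>\<^bsub>M\<^esub> y \<ominus> r \<odot>\<^bsub>M\<^esub> x = r \<odot>\<^bsub>M\<^esub> z"
      using c by (simp add: z(2) add_hom_add[OF r(1) c(3) x] a_minus_def a_assoc r_neg)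
    then show ?thesis using r(2)[OF z(1)] c z x by (subst coset_eq) (auto simp: add_hom_add[OF r(1)])
  qed
  moreover have "x \<in> I +> x"
    using additive_subgroup.zero_closed[OF I_subgroup] x by (force simp: a_r_coset_def')
  ultimately have "(\<Union>y\<in>I +> x. I +> (r \<odot>\<^bsub>M\<^esub> y)) = I +> (r \<odot>\<^bsub>M\<^esub> x)" by blast
  then show ?thesis by (simp add: quot_def)
qed

end

section \<open>Restriction of scalars along a graded endomorphism\<close>

definition twist :: "('r \<Rightarrow> 'r) \<Rightarrow> ('r, 'm, 'x) graded_scheme \<Rightarrow> ('r, 'm, 'x) graded_scheme" where
  "twist \<tau> M = M\<lparr>smult := \<lambda>r x. \<tau> r \<odot>\<^bsub>M\<^esub> x\<rparr>"

lemma twist_simps [simp]: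
  "carrier (twist \<tau> M) = carrier M" "zero (twist \<tau> M) = zero M" "add (twist \<tau> M) = add M"
  "smult (twist \<tau> M) r x = \<tau> r \<odot>\<^bsub>M\<^esub> x" "hpart (twist \<tau> M) = hpart M"
  by (auto simp: twist_def)

definition graded_endo :: "('k, 'r, 'z) graded_scheme \<Rightarrow> ('r \<Rightarrow> 'r) \<Rightarrow> bool" where
  "graded_endo R \<tau> \<longleftrightarrow> \<tau> \<in> ring_hom R R \<and> (\<forall>i. \<tau> ` hpart R i \<subseteq> hpart R i)"

lemma graded_endoD:
  assumes "graded_endo R \<tau>"
  shows "x \<in> carrier R \<Longrightarrow> \<tau> x \<in> carrier R"
    "\<lbrakk>x \<in> carrier R; y \<in> carrier R\<rbrakk> \<Longrightarrow> \<tau> (x \<otimes>\<^bsub>R\<^esub> y) = \<tau> x \<otimes>\<^bsub>R\<^esub> \<tau> y"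
    "\<lbrakk>x \<in> carrier R; y \<in> carrier R\<rbrakk> \<Longrightarrow> \<tau> (x \<oplus>\<^bsub>R\<^esub> y) = \<tau> x \<oplus>\<^bsub>R\<^esub> \<tau> y"
    "\<tau> \<one>\<^bsub>R\<^esub> = \<one>\<^bsub>R\<^esub>" "x \<in> hpart R i \<Longrightarrow> \<tau> x \<in> hpart R i"
  using assms by (auto simp: graded_endo_def ring_hom_def image_subset_iff)

lemma homog_decomp_cong:
  assumes "carrier M = carrier N" "add M = add N" "zero M = zero N" "hpart M = hpart N"
  shows "homog_decomp M c x \<longleftrightarrow> homog_decomp N c x"
  using assms(3,4) by (simp add: homog_decomp_def finsum_record_cong[OF assms(1-3)])

lemma abelian_group_cong:
  assumes "carrier M = carrier N" "add M = add N" "zero M = zero N" "abelian_group M"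
  shows "abelian_group N"
  by (rule abelian_group_image[OF assms(4), where f = "\<lambda>x. x"]) (simp_all add: assms)

lemma additive_subgroup_cong:
  assumes "carrier M = carrier N" "add M = add N" "zero M = zero N" "additive_subgroup H M"
  shows "additive_subgroup H N"
proof -
  have "a_inv M = a_inv N" using assms(1-3) by (simp add: a_inv_def m_inv_def fun_eq_iff)
  then have "m_inv (add_monoid M) = m_inv (add_monoid N)" by (simp add: a_inv_def)
  with assms show ?thesis by (simp add: additive_subgroup_def subgroup_def)
qed

lemma direct_grading_cong:
  assumes "carrier M = carrier N" "add M = add N" "zero M = zero N" "hpart M = hpart N" "direct_grading M"
  shows "direct_grading N"
  using assms(5) homog_decomp_cong[OF assms(1-4)] additive_subgroup_cong[OF assms(1-3)] assms(1,4)
  by (simp add: direct_grading_def)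

lemma twist_graded_module:
  assumes \<tau>: "graded_endo R \<tau>" and M: "graded_module R M"
  shows "graded_module R (twist \<tau> M)"
proof -
  interpret M: left_module R M by (rule graded_module_left[OF M])
  interpret MG: direct_graded_group M by (rule graded_module_direct[OF M])
  have "direct_grading (twist \<tau> M)"
    by (rule direct_grading_cong[OF _ _ _ _ MG.direct_grading_axioms]) simp_all
  moreover have "left_module R (twist \<tau> M)"
    using graded_endoD(1-4)[OF \<tau>] abelian_group_cong[OF _ _ _ M.M.abelian_group_axioms, of "twist \<tau> M"]
    by (intro left_module.intro left_module_axioms.intro M.R.ring_axioms)
      (auto simp: M.smult_closed M.smult_l_distr M.smult_r_distr M.smult_assoc M.smult_one)
  ultimately show ?thesis
    using graded_module_smult[OF M] graded_endoD(5)[OF \<tau>] by (auto simp: graded_module_def)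
qed

lemma twist_mod_hom:
  assumes "graded_endo R \<tau>" "f \<in> mod_hom R M N"
  shows "f \<in> mod_hom R (twist \<tau> M) (twist \<tau> N)"
  using mod_homD[OF assms(2)] graded_endoD(1)[OF assms(1)] by (intro mod_homI) auto

lemma twist_degree_hom:
  assumes "graded_endo R \<tau>" "f \<in> degree_hom R j M N"
  shows "f \<in> degree_hom R j (twist \<tau> M) (twist \<tau> N)"
  using twist_mod_hom[OF assms(1) degree_hom_mod_hom[OF assms(2)]] degree_hom_hpart[OF assms(2)]
  by (auto simp: degree_hom_def)

text \<open>Twisting leaves elements, degrees and maps alone, so kernels and images are the same
  sets.\<close>

lemma twist_resolution:
  assumes \<tau>: "graded_endo R \<tau>" and P: "graded_resolution R M P d e"
  shows "graded_resolution R (twist \<tau> M) (\<lambda>i. twist \<tau> (P i)) d e"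
  using graded_resolutionD[OF P]
  by (auto simp: graded_resolution_def a_kernel_def' intro: twist_graded_module[OF \<tau>] twist_degree_hom[OF \<tau>])

text \<open>A degree-preserving semilinear map lifts to resolutions because it is a linear map into the
  twisted module.\<close>

lemma semilinear_chain_map_ex:
  fixes P :: "nat \<Rightarrow> ('r, 'p, 'x) graded_scheme"
  assumes R: "graded_ring R" and \<tau>: "graded_endo R \<tau>"
    and P: "graded_resolution R M P d e" and proj: "\<And>i. projective R (P i)"
    and \<sigma>: "\<sigma> \<in> degree_hom R 0 M (twist \<tau> M)"
  obtains F where "\<And>i. F i \<in> degree_hom R 0 (P i) (twist \<tau> (P i))"
    "\<And>x. x \<in> carrier (P 0) \<Longrightarrow> e (F 0 x) = \<sigma> (e x)"
    "\<And>i x. x \<in> carrier (P (Suc i)) \<Longrightarrow> d i (F (Suc i) x) = F i (d i x)"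
  using chain_map_ex[OF R P proj twist_resolution[OF \<tau> P] \<sigma>] by blast

section \<open>Graded cohomology and semilinear maps\<close>

lemma regular_bimod_simps [simp]:
  "carrier (regular_bimod A) = carrier A" "zero (regular_bimod A) = zero A" "add (regular_bimod A) = add A"
  "smult (regular_bimod A) r x = r \<otimes>\<^bsub>A\<^esub> x" "hpart (regular_bimod A) = hpart A"
  "rsmult (regular_bimod A) t x = x \<otimes>\<^bsub>A\<^esub> t"
  by (auto simp: regular_bimod_def)

text \<open>All linear maps into \<open>R\<close>, with \<open>R\<close> acting from the right on
  values. The graded Hom is the subgroup of finite sums of homogeneous maps.\<close>

abbreviation dual :: "('k, 'r, 'z) graded_scheme \<Rightarrow> ('r, 'm, 'x) graded_scheme \<Rightarrow> ('r, 'm \<Rightarrow> 'r) graded" where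
  "dual R M \<equiv> hom_bimod R M (regular_bimod R)"

lemma dual_simps [simp]:
  "zero (dual R M) = (\<lambda>x \<in> carrier M. \<zero>\<^bsub>R\<^esub>)"
  "f \<oplus>\<^bsub>dual R M\<^esub> g = (\<lambda>x \<in> carrier M. f x \<oplus>\<^bsub>R\<^esub> g x)"
  "t \<odot>\<^bsub>dual R M\<^esub> f = (\<lambda>x \<in> carrier M. f x \<otimes>\<^bsub>R\<^esub> t)"
  by (auto simp: hom_bimod_def)

lemma dual_carrier:
  "f \<in> carrier (dual R M) \<longleftrightarrow> f \<in> extensional (carrier M) \<and> (\<forall>x\<in>carrier M. f x \<in> carrier R) \<and>
     (\<forall>x\<in>carrier M. \<forall>y\<in>carrier M. f (x \<oplus>\<^bsub>M\<^esub> y) = f x \<oplus>\<^bsub>R\<^esub> f y) \<and>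
     (\<forall>r\<in>carrier R. \<forall>x\<in>carrier M. f (r \<odot>\<^bsub>M\<^esub> x) = r \<otimes>\<^bsub>R\<^esub> f x)"
  by (auto simp: hom_bimod_def mod_hom_def)

lemma dual_carrierD:
  assumes "f \<in> carrier (dual R M)"
  shows "f \<in> extensional (carrier M)" "x \<in> carrier M \<Longrightarrow> f x \<in> carrier R"
    "\<lbrakk>x \<in> carrier M; y \<in> carrier M\<rbrakk> \<Longrightarrow> f (x \<oplus>\<^bsub>M\<^esub> y) = f x \<oplus>\<^bsub>R\<^esub> f y"
    "\<lbrakk>r \<in> carrier R; x \<in> carrier M\<rbrakk> \<Longrightarrow> f (r \<odot>\<^bsub>M\<^esub> x) = r \<otimes>\<^bsub>R\<^esub> f x"
  using assms by (auto simp: dual_carrier)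

lemma dual_hpart:
  "f \<in> hpart (dual R M) j \<longleftrightarrow> f \<in> carrier (dual R M) \<and> (\<forall>i. \<forall>x\<in>hpart M i. f x \<in> hpart R (i + j))"
  by (auto simp: hom_bimod_def degree_hom_def)

lemma dual_eqI:
  "\<lbrakk>f \<in> carrier (dual R M); g \<in> carrier (dual R M); \<And>x. x \<in> carrier M \<Longrightarrow> f x = g x\<rbrakk> \<Longrightarrow> f = g"
  by (rule extensionalityI[where A = "carrier M"]) (auto simp: dual_carrier)

lemma graded_Hom_simps [simp]:
  "zero (graded_Hom R M N) = zero (hom_bimod R M N)" "add (graded_Hom R M N) = add (hom_bimod R M N)"
  "smult (graded_Hom R M N) = smult (hom_bimod R M N)" "hpart (graded_Hom R M N) = hpart (hom_bimod R M N)"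
  "carrier (graded_Hom R M N) = {f. \<exists>c. homog_decomp (hom_bimod R M N) c f}"
  by (auto simp: graded_Hom_def)

context graded_ring
begin

lemma dual_graded_group:
  assumes M: "graded_module R M"
  shows "graded_group (dual R M)"
proof -
  interpret M: left_module R M by (rule graded_module_left[OF M])
  interpret MG: direct_graded_group M by (rule graded_module_direct[OF M])
  have inv: "(\<lambda>x\<in>carrier M. \<ominus> f x) \<in> carrier (dual R M)" if "f \<in> carrier (dual R M)" for f
    using that by (auto simp: dual_carrier M.smult_closed R.minus_add R.r_minus)
  have ab: "abelian_group (dual R M)"
  proof (rule abelian_groupI)
    show "\<zero>\<^bsub>dual R M\<^esub> \<in> carrier (dual R M)" by (auto simp: dual_carrier M.smult_closed)
    show add: "f \<oplus>\<^bsub>dual R M\<^esub> g \<in> carrier (dual R M)"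
      if "f \<in> carrier (dual R M)" "g \<in> carrier (dual R M)" for f g
      using that by (auto simp: dual_carrier M.smult_closed R.add.m_ac R.r_distr)
    show "f \<oplus>\<^bsub>dual R M\<^esub> g = g \<oplus>\<^bsub>dual R M\<^esub> f"
      if "f \<in> carrier (dual R M)" "g \<in> carrier (dual R M)" for f g
      using that by (auto simp: dual_carrier R.add.m_ac intro!: restrict_ext)
    show "(f \<oplus>\<^bsub>dual R M\<^esub> g) \<oplus>\<^bsub>dual R M\<^esub> h = f \<oplus>\<^bsub>dual R M\<^esub> (g \<oplus>\<^bsub>dual R M\<^esub> h)"
      if "f \<in> carrier (dual R M)" "g \<in> carrier (dual R M)" "h \<in> carrier (dual R M)" for f g h
      using that by (auto simp: dual_carrier R.add.m_ac intro!: restrict_ext)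
    show "\<zero>\<^bsub>dual R M\<^esub> \<oplus>\<^bsub>dual R M\<^esub> f = f" if "f \<in> carrier (dual R M)" for f
      using that by (auto simp: dual_carrier fun_eq_iff extensional_def)
    show "\<exists>g\<in>carrier (dual R M). g \<oplus>\<^bsub>dual R M\<^esub> f = \<zero>\<^bsub>dual R M\<^esub>" if "f \<in> carrier (dual R M)" for f
      using that by (intro bexI[OF _ inv[OF that]]) (auto simp: dual_carrierD R.l_neg intro!: restrict_ext)
  qed
  interpret D: abelian_group "dual R M" by fact
  have neg: "\<ominus>\<^bsub>dual R M\<^esub> f = (\<lambda>x\<in>carrier M. \<ominus> f x)" if f: "f \<in> carrier (dual R M)" for f
  proof (rule D.minus_equality[OF _ f inv[OF f]])
    show "(\<lambda>x\<in>carrier M. \<ominus> f x) \<oplus>\<^bsub>dual R M\<^esub> f = \<zero>\<^bsub>dual R M\<^esub>"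
      using f by (auto simp: dual_carrierD R.l_neg intro!: restrict_ext)
  qed
  show ?thesis
  proof (intro graded_group.intro graded_group_axioms.intro ab additive_subgroupI D.add.subgroupI)
    fix j
    have "\<zero>\<^bsub>dual R M\<^esub> \<in> hpart (dual R M) j"
      using D.zero_closed by (auto simp: dual_hpart hpart_zero MG.hpart_closed)
    then show "hpart (dual R M) j \<noteq> {}" by auto
    show "hpart (dual R M) j \<subseteq> carrier (dual R M)" by (auto simp: dual_hpart)
    fix f assume f: "f \<in> hpart (dual R M) j"
    then show "\<ominus>\<^bsub>dual R M\<^esub> f \<in> hpart (dual R M) j"
      using D.a_inv_closed[of f] by (auto simp: dual_hpart neg MG.hpart_closed hpart_inv)
    fix g assume g: "g \<in> hpart (dual R M) j"
    show "f \<oplus>\<^bsub>dual R M\<^esub> g \<in> hpart (dual R M) j"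
      using f g D.a_closed[of f g] by (auto simp: dual_hpart MG.hpart_closed hpart_add)
  qed
qed

lemma dual_minus:
  assumes M: "graded_module R M" and f: "f \<in> carrier (dual R M)" "g \<in> carrier (dual R M)" and x: "x \<in> carrier M"
  shows "(f \<ominus>\<^bsub>dual R M\<^esub> g) x = f x \<ominus> g x"
proof -
  interpret D: graded_group "dual R M" by (rule dual_graded_group[OF M])
  have "(\<lambda>f. f x) \<in> add_hom (dual R M) R" using x by (auto simp: add_hom_def dual_carrierD)
  from add_hom_minus[OF D.abelian_group_axioms R.abelian_group_axioms this f] show ?thesis .
qed

lemma dual_smult_add_hom:
  assumes M: "graded_module R M" and t: "t \<in> carrier R"
  shows "(\<lambda>f. t \<odot>\<^bsub>dual R M\<^esub> f) \<in> add_hom (dual R M) (dual R M)"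
proof -
  interpret M: left_module R M by (rule graded_module_left[OF M])
  show ?thesis
    using t by (auto simp: add_hom_def dual_carrier M.smult_closed R.l_distr R.m_assoc intro!: restrict_ext)
qed

lemma dual_smult_hpart:
  assumes M: "graded_module R M" and t: "t \<in> hpart R i" and f: "f \<in> hpart (dual R M) j"
  shows "t \<odot>\<^bsub>dual R M\<^esub> f \<in> hpart (dual R M) (j + i)"
proof -
  interpret MG: direct_graded_group M by (rule graded_module_direct[OF M])
  have "t \<odot>\<^bsub>dual R M\<^esub> f \<in> carrier (dual R M)"
    using add_hom_closed[OF dual_smult_add_hom[OF M hpart_closed[OF t]]] f by (simp add: dual_hpart)
  then show ?thesis
    using f graded_mult[OF _ t] by (auto simp: dual_hpart MG.hpart_closed add.assoc[symmetric])
qed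

text \<open>Splitting the scalar reduces to homogeneous \<open>t\<close>, which moves each component
  of \<open>f\<close> by the degree of \<open>t\<close> and creates no new ones.\<close>

lemma graded_Hom_smult:
  assumes M: "graded_module R M" and t: "t \<in> carrier R" and f: "f \<in> carrier (graded_Hom R M (regular_bimod R))"
  shows "t \<odot>\<^bsub>dual R M\<^esub> f \<in> carrier (graded_Hom R M (regular_bimod R))"
proof -
  interpret D: graded_group "dual R M" by (rule dual_graded_group[OF M])
  from f obtain c where c: "homog_decomp (dual R M) c f" by auto
  have fD: "f \<in> carrier (dual R M)" by (rule D.decomp_carrier[OF c])
  from t show ?thesis
  proof (induction rule: homog_induct)
    case zero
    have "\<zero> \<odot>\<^bsub>dual R M\<^esub> f = \<zero>\<^bsub>dual R M\<^esub>" using fD by (auto simp: dual_carrierD intro!: restrict_ext)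
    then show ?case unfolding graded_Hom_simps mem_Collect_eq using D.decomp_zero by metis
  next
    case (add i s t)
    have eq: "(t \<oplus> s) \<odot>\<^bsub>dual R M\<^esub> f = t \<odot>\<^bsub>dual R M\<^esub> f \<oplus>\<^bsub>dual R M\<^esub> s \<odot>\<^bsub>dual R M\<^esub> f"
      using add hpart_closed[OF \<open>t \<in> hpart R i\<close>] fD by (auto simp: dual_carrierD R.r_distr intro!: restrict_ext)
    have c1: "homog_decomp (dual R M) (\<lambda>j. t \<odot>\<^bsub>dual R M\<^esub> c (j - i)) (t \<odot>\<^bsub>dual R M\<^esub> f)"
      by (rule decomp_map[OF D.graded_group_axioms D.graded_group_axioms
            dual_smult_add_hom[OF M hpart_closed[OF \<open>t \<in> hpart R i\<close>]]
            dual_smult_hpart[OF M \<open>t \<in> hpart R i\<close>] c])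
    obtain c' where c2: "homog_decomp (dual R M) c' (s \<odot>\<^bsub>dual R M\<^esub> f)"
      using add.IH unfolding graded_Hom_simps mem_Collect_eq by blast
    show ?case
      unfolding eq graded_Hom_simps mem_Collect_eq by (rule exI, rule D.decomp_add[OF c1 c2])
  qed
qed

text \<open>The graded Hom may be smaller than the full one, so each map on cochains has to be shown
  to respect it.\<close>

lemma graded_Hom_map:
  assumes "graded_module R M" "graded_module R N" "\<phi> \<in> add_hom (dual R M) (dual R N)"
    and "\<And>j f. f \<in> hpart (dual R M) j \<Longrightarrow> \<phi> f \<in> hpart (dual R N) j"
    and "f \<in> carrier (graded_Hom R M (regular_bimod R))"
  shows "\<phi> f \<in> carrier (graded_Hom R N (regular_bimod R))"
  using assms(5) decomp_map[OF dual_graded_group[OF assms(1)] dual_graded_group[OF assms(2)] assms(3), of 0] assms(4)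
  by auto

end

section \<open>Subgroups, restriction to them, and their images\<close>

lemma (in graded_group) decomp_subgroup: "additive_subgroup {x. \<exists>c. homog_decomp M c x} M"
proof (intro additive_subgroupI add.subgroupI)
  show "{x. \<exists>c. homog_decomp M c x} \<subseteq> carrier M" using decomp_carrier by auto
  show "{x. \<exists>c. homog_decomp M c x} \<noteq> {}" using decomp_zero by auto
  fix x assume "x \<in> {x. \<exists>c. homog_decomp M c x}"
  then obtain c where c: "homog_decomp M c x" by auto
  have "(\<lambda>x. \<ominus> x) \<in> add_hom M M" by (auto simp: add_hom_def minus_add)
  from decomp_map[OF graded_group_axioms graded_group_axioms this _ c, of 0]
  show "\<ominus> x \<in> {x. \<exists>c. homog_decomp M c x}" using hpart_inv by auto
next
  fix x y assume "x \<in> {x. \<exists>c. homog_decomp M c x}" "y \<in> {x. \<exists>c. homog_decomp M c x}"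
  then show "x \<oplus> y \<in> {x. \<exists>c. homog_decomp M c x}" using decomp_add by fastforce
qed

text \<open>The inclusion of \<open>Z\<close> into \<open>G\<close> is additive, so inverses and
  differences agree in both groups.\<close>

lemma restrict_additive_subgroup:
  assumes G: "abelian_group G" and Z: "additive_subgroup Z G"
    and M: "carrier M = Z" "add M = add G" "zero M = zero G"
  shows "abelian_group M" "x \<in> Z \<Longrightarrow> y \<in> Z \<Longrightarrow> x \<ominus>\<^bsub>M\<^esub> y = x \<ominus>\<^bsub>G\<^esub> y"
    "additive_subgroup H G \<Longrightarrow> H \<subseteq> Z \<Longrightarrow> additive_subgroup H M"
proof -
  interpret G: abelian_group G by fact
  interpret Z: additive_subgroup Z G by fact
  have inv: "\<ominus>\<^bsub>G\<^esub> x \<in> Z" if "x \<in> Z" for x using that by (rule Z.a_inv_closed)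
  have sub: "x \<in> carrier G" if "x \<in> Z" for x using that by (rule Z.a_Hcarr)
  show ab: "abelian_group M"
  proof (rule abelian_groupI)
    show "\<exists>y\<in>carrier M. y \<oplus>\<^bsub>M\<^esub> x = \<zero>\<^bsub>M\<^esub>" if "x \<in> carrier M" for x
      using that inv sub by (intro bexI[of _ "\<ominus>\<^bsub>G\<^esub> x"]) (auto simp: M G.l_neg)
  qed (auto simp: M sub G.add.m_ac)
  have incl: "(\<lambda>x. x) \<in> add_hom M G" by (auto simp: add_hom_def M sub)
  have invM: "\<ominus>\<^bsub>M\<^esub> x = \<ominus>\<^bsub>G\<^esub> x" if "x \<in> Z" for x
    using add_hom_inv[OF ab G incl, of x] that by (simp add: M)
  then show "x \<ominus>\<^bsub>M\<^esub> y = x \<ominus>\<^bsub>G\<^esub> y" if "x \<in> Z" "y \<in> Z"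
    using that by (simp add: a_minus_def M)
  interpret M: abelian_group M by fact
  show "additive_subgroup H M" if H: "additive_subgroup H G" "H \<subseteq> Z"
  proof -
    interpret H: additive_subgroup H G by fact
    show ?thesis
    proof (intro additive_subgroupI M.add.subgroupI)
      show "H \<noteq> {}" using H.zero_closed by blast
      show "\<ominus>\<^bsub>M\<^esub> x \<in> H" if "x \<in> H" for x
        using that H(2) H.a_inv_closed[OF that] by (simp add: invM subset_iff)
    qed (use H(2) in \<open>auto simp: M\<close>)
  qed
qed

lemma additive_subgroup_image:
  assumes G: "abelian_group G" and M: "abelian_group M" and S: "additive_subgroup S G" and \<phi>: "\<phi> \<in> add_hom G M"
  shows "additive_subgroup (\<phi> ` S) M"
proof -
  interpret M: abelian_group M by fact
  interpret S: additive_subgroup S G by fact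
  show ?thesis
  proof (intro additive_subgroupI M.add.subgroupI)
    show "\<phi> ` S \<noteq> {}" using S.zero_closed by blast
    show "\<phi> ` S \<subseteq> carrier M" using add_hom_closed[OF \<phi> S.a_Hcarr] by auto
    show "\<ominus>\<^bsub>M\<^esub> x \<in> \<phi> ` S" if "x \<in> \<phi> ` S" for x
      using that S.a_inv_closed add_hom_inv[OF G M \<phi> S.a_Hcarr] by (metis (no_types, lifting) imageE image_eqI)
    show "x \<oplus>\<^bsub>M\<^esub> y \<in> \<phi> ` S" if "x \<in> \<phi> ` S" "y \<in> \<phi> ` S" for x y
      using that S.a_closed add_hom_add[OF \<phi> S.a_Hcarr S.a_Hcarr] by (metis (no_types, lifting) imageE image_eqI)
  qed
qed

section \<open>Precomposition with semilinear maps\<close>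

context graded_ring
begin

text \<open>Precomposing with \<open>k\<close> makes \<open>f\<close> semilinear for
  \<open>\<tau>'\<close>, and \<open>\<tau>\<close> on the values cancels this, as
  \<open>\<tau> (\<tau>' r) = r\<close>. The right action does not pass through \<open>k\<close>, so
  nothing cancels there and \<open>\<psi>\<close> is semilinear for \<open>\<tau>\<close>.\<close>

lemma dual_semilinear:
  assumes M: "graded_module R M" and N: "graded_module R N" and k: "k \<in> degree_hom R 0 M (twist \<tau>' N)"
    and \<tau>: "graded_endo R \<tau>" and \<tau>': "graded_endo R \<tau>'" and inv: "\<And>r. r \<in> carrier R \<Longrightarrow> \<tau> (\<tau>' r) = r"
  defines "\<psi> \<equiv> \<lambda>f. \<lambda>x\<in>carrier M. \<tau> (f (k x))"
  shows "\<psi> \<in> add_hom (dual R N) (dual R M)"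
    and "f \<in> hpart (dual R N) j \<Longrightarrow> \<psi> f \<in> hpart (dual R M) j"
    and "\<lbrakk>f \<in> carrier (dual R N); t \<in> carrier R\<rbrakk> \<Longrightarrow> \<psi> (t \<odot>\<^bsub>dual R N\<^esub> f) = \<tau> t \<odot>\<^bsub>dual R M\<^esub> \<psi> f"
proof -
  interpret M: left_module R M by (rule graded_module_left[OF M])
  interpret MG: direct_graded_group M by (rule graded_module_direct[OF M])
  note kD = mod_homD[OF degree_hom_mod_hom[OF k], simplified]
  note \<tau>D = graded_endoD[OF \<tau>] and \<tau>'D = graded_endoD[OF \<tau>']
  show 1: "\<psi> \<in> add_hom (dual R N) (dual R M)"
    unfolding \<psi>_def
    by (auto simp: add_hom_def dual_carrier kD \<tau>D \<tau>'D inv M.smult_closed intro!: restrict_ext)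
  show "\<psi> f \<in> hpart (dual R M) j" if "f \<in> hpart (dual R N) j"
    using that add_hom_closed[OF 1, of f] degree_hom_hpart[OF k] \<tau>D(5)
    by (auto simp: dual_hpart \<psi>_def MG.hpart_closed)
  show "\<psi> (t \<odot>\<^bsub>dual R N\<^esub> f) = \<tau> t \<odot>\<^bsub>dual R M\<^esub> \<psi> f" if "f \<in> carrier (dual R N)" "t \<in> carrier R"
    using that by (auto simp: \<psi>_def dual_carrierD kD \<tau>D intro!: restrict_ext)
qed

lemma dual_compose:
  assumes N: "graded_module R N" and k: "k \<in> degree_hom R 0 M N" and M: "graded_module R M"
  shows "(\<lambda>f. compose (carrier M) f k) \<in> add_hom (dual R N) (dual R M)"
    and "f \<in> hpart (dual R N) j \<Longrightarrow> compose (carrier M) f k \<in> hpart (dual R M) j"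
proof -
  have id: "graded_endo R (\<lambda>x. x)" by (auto simp: graded_endo_def ring_hom_def)
  \<comment> \<open>Twisting by the identity changes nothing, so ordinary precomposition is the case
    of a trivial twist.\<close>
  have "k \<in> degree_hom R 0 M (twist (\<lambda>r. r) N)" using k by (simp add: twist_def)
  note sl = dual_semilinear[OF M N this id id refl]
  show "(\<lambda>f. compose (carrier M) f k) \<in> add_hom (dual R N) (dual R M)"
    unfolding compose_def by (rule sl(1))
  show "f \<in> hpart (dual R N) j \<Longrightarrow> compose (carrier M) f k \<in> hpart (dual R M) j"
    unfolding compose_def by (rule sl(2))
qed

end

section \<open>The cochain complex of a graded resolution\<close>

locale graded_resolved = graded_ring R for R (structure) +
  fixes M :: "('b, 'm, 'y) graded_scheme" and P :: "nat \<Rightarrow> ('b, 'p, 'z) graded_scheme"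
    and d :: "nat \<Rightarrow> 'p \<Rightarrow> 'p" and e :: "'p \<Rightarrow> 'm"
  assumes resolution: "graded_resolution R M P d e"
begin

lemmas PM = graded_resolutionD(2)[OF resolution]
lemmas d_hom = graded_resolutionD(5)[OF resolution]

abbreviation "C i \<equiv> dual R (P i)"
abbreviation "cochains i \<equiv> carrier (graded_Hom R (P i) (regular_bimod R))"
abbreviation "Z i \<equiv> cocycles R P d (regular_bimod R) i"
abbreviation "B i \<equiv> coboundaries R P d (regular_bimod R) i"
abbreviation "H i \<equiv> cohomology R P d (regular_bimod R) i"
text \<open>The record divided by the coboundaries in the definition of \<open>cohomology\<close>,
  repeated literally so that the quotient lemmas fit after unfolding.\<close>

abbreviation "ZM i \<equiv> (graded_Hom R (P i) (regular_bimod R))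
  \<lparr>carrier := Z i, hpart := \<lambda>j. hpart (graded_Hom R (P i) (regular_bimod R)) j \<inter> Z i\<rparr>"
abbreviation "cls i f \<equiv> B i +>\<^bsub>ZM i\<^esub> f"

lemma cochains_dual: "f \<in> cochains i \<Longrightarrow> f \<in> carrier (C i)"
  using graded_group.decomp_carrier[OF dual_graded_group[OF PM]] by auto

lemma cochains_subgroup: "additive_subgroup (cochains i) (C i)"
  using graded_group.decomp_subgroup[OF dual_graded_group[OF PM]] by simp

lemma Z_iff: "f \<in> Z i \<longleftrightarrow> f \<in> cochains i \<and> (\<forall>x\<in>carrier (P (Suc i)). f (d i x) = \<zero>)"
  by (auto simp: cocycles_def)

lemma dual_abelian: "abelian_group (C i)"
  by (rule graded_group.axioms(1)[OF dual_graded_group[OF PM]])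

lemma d_closed: "x \<in> carrier (P (Suc i)) \<Longrightarrow> d i x \<in> carrier (P i)"
  by (rule degree_hom_closed[OF d_hom])

lemma Z_subgroup: "additive_subgroup (Z i) (C i)"
proof -
  interpret D: abelian_group "C i" by (rule dual_abelian)
  interpret C: additive_subgroup "cochains i" "C i" by (rule cochains_subgroup)
  have neg: "(\<ominus>\<^bsub>C i\<^esub> f) x = \<ominus> f x" if "f \<in> carrier (C i)" "x \<in> carrier (P i)" for f x
  proof -
    have "(\<lambda>f. f x) \<in> add_hom (C i) R" using that by (auto simp: add_hom_def dual_carrierD)
    from add_hom_inv[OF D.abelian_group_axioms R.abelian_group_axioms this that(1)] show ?thesis .
  qed
  show ?thesis
  proof (intro additive_subgroupI D.add.subgroupI)
    show "Z i \<subseteq> carrier (C i)" using cochains_dual by (auto simp: Z_iff)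
    have "\<zero>\<^bsub>C i\<^esub> \<in> Z i" unfolding Z_iff using C.zero_closed by (auto simp: d_closed)
    then show "Z i \<noteq> {}" by auto
    show "\<ominus>\<^bsub>C i\<^esub> f \<in> Z i" if "f \<in> Z i" for f
      using that C.a_inv_closed[of f] neg[OF cochains_dual] unfolding Z_iff by (auto simp: d_closed)
    show "f \<oplus>\<^bsub>C i\<^esub> g \<in> Z i" if "f \<in> Z i" "g \<in> Z i" for f g
      using that C.a_closed[of f g] unfolding Z_iff by (auto simp: d_closed)
  qed
qed

lemma B_Suc: "B (Suc j) = (\<lambda>f. compose (carrier (P (Suc j))) f (d j)) ` cochains j"
  by (simp add: coboundaries_def)

lemma B_zero: "B 0 = {\<zero>\<^bsub>C 0\<^esub>}"
  by (simp add: coboundaries_def)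

lemma zero_Z: "\<zero>\<^bsub>C i\<^esub> \<in> Z i"
  by (rule additive_subgroup.zero_closed[OF Z_subgroup])

lemma B_subset: "B i \<subseteq> Z i"
proof (cases i)
  case 0
  then show ?thesis using zero_Z by (simp only: B_zero) simp
next
  case (Suc j)
  show ?thesis
  proof
    fix g assume "g \<in> B i"
    then obtain f where f: "f \<in> cochains j" "g = compose (carrier (P (Suc j))) f (d j)" by (auto simp: Suc B_Suc)
    note fD = cochains_dual[OF f(1)]
    have "g \<in> cochains i"
      unfolding f(2) Suc by (rule graded_Hom_map[OF PM PM dual_compose(1)[OF PM d_hom PM] dual_compose(2)[OF PM d_hom PM] f(1)])
    moreover have "f \<zero>\<^bsub>P j\<^esub> = \<zero>"
    proof -
      interpret Pj: left_module R "P j" by (rule graded_module_left[OF PM])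
      have "f \<in> add_hom (P j) R" using fD by (auto simp: add_hom_def dual_carrierD)
      then show ?thesis by (rule add_hom_zero[OF Pj.M.abelian_group_axioms R.abelian_group_axioms])
    qed
    ultimately show "g \<in> Z i"
      unfolding Z_iff f(2) Suc by (auto simp: compose_def d_closed graded_resolution_complex(2)[OF resolution])
  qed
qed

lemma B_subgroup: "additive_subgroup (B i) (C i)"
proof (cases i)
  case 0
  interpret D: abelian_group "C 0" by (rule dual_abelian)
  show ?thesis
    unfolding 0 B_zero using D.add.triv_subgroup by (auto simp: additive_subgroup_def)
next
  case (Suc j)
  show ?thesis
    unfolding Suc B_Suc
    by (rule additive_subgroup_image[OF dual_abelian dual_abelian cochains_subgroup dual_compose(1)[OF PM d_hom PM]])
qed

lemma ZM_simps: "carrier (ZM i) = Z i" "add (ZM i) = add (C i)" "zero (ZM i) = zero (C i)"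
  "smult (ZM i) = smult (C i)" "hpart (ZM i) j = hpart (C i) j \<inter> Z i"
  by simp_all

lemma ZM_quotient: "quotient_group (ZM i) (B i)"
  using restrict_additive_subgroup[OF dual_abelian Z_subgroup, of "ZM i"] B_subgroup B_subset
  by (intro quotient_group.intro quotient_group_axioms.intro) auto

lemma ZM_minus: "\<lbrakk>f \<in> Z i; g \<in> Z i\<rbrakk> \<Longrightarrow> f \<ominus>\<^bsub>ZM i\<^esub> g = f \<ominus>\<^bsub>C i\<^esub> g"
  using restrict_additive_subgroup(2)[OF dual_abelian Z_subgroup, of "ZM i"] by auto

lemma Z_dual: "f \<in> Z i \<Longrightarrow> f \<in> carrier (C i)"
  using Z_iff cochains_dual by blast

lemma Z_smult: "\<lbrakk>t \<in> carrier R; f \<in> Z i\<rbrakk> \<Longrightarrow> t \<odot>\<^bsub>C i\<^esub> f \<in> Z i"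
  unfolding Z_iff using graded_Hom_smult[OF PM, of t f i] by (auto simp: d_closed)

text \<open>The right action changes values and a coboundary changes arguments, so the two
  commute.\<close>

lemma B_smult:
  assumes t: "t \<in> carrier R" and g: "g \<in> B i"
  shows "t \<odot>\<^bsub>C i\<^esub> g \<in> B i"
proof (cases i)
  case 0
  then show ?thesis using g t by (auto simp: B_zero intro!: restrict_ext)
next
  case (Suc j)
  then obtain f where f: "f \<in> cochains j" "g = compose (carrier (P (Suc j))) f (d j)" using g by (auto simp: B_Suc)
  have "t \<odot>\<^bsub>C i\<^esub> g = compose (carrier (P (Suc j))) (t \<odot>\<^bsub>C j\<^esub> f) (d j)"
    unfolding f(2) Suc by (auto simp: compose_def d_closed intro!: restrict_ext)
  then show ?thesis using graded_Hom_smult[OF PM t f(1)] unfolding Suc B_Suc by blast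
qed


text \<open>\<open>G\<close> commutes with the differentials, hence \<open>\<psi>\<close> commutes
  with precomposition by them.\<close>

lemma semilinear_cochains:
  assumes \<tau>: "graded_endo R \<tau>" and \<tau>': "graded_endo R \<tau>'" and inv: "\<And>r. r \<in> carrier R \<Longrightarrow> \<tau> (\<tau>' r) = r"
    and G: "\<And>i. G i \<in> degree_hom R 0 (P i) (twist \<tau>' (P i))"
    and Gd: "\<And>i x. x \<in> carrier (P (Suc i)) \<Longrightarrow> d i (G (Suc i) x) = G i (d i x)"
  defines "\<psi> \<equiv> \<lambda>i f. \<lambda>x\<in>carrier (P i). \<tau> (f (G i x))"
  shows "f \<in> Z i \<Longrightarrow> \<psi> i f \<in> Z i" "f \<in> B i \<Longrightarrow> \<psi> i f \<in> B i"
proof -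
  have sl: "\<psi> i \<in> add_hom (C i) (C i)"
    "f \<in> hpart (C i) j \<Longrightarrow> \<psi> i f \<in> hpart (C i) j" for i j f
    unfolding \<psi>_def by (rule dual_semilinear[OF PM PM G \<tau> \<tau>' inv], assumption+)+
  have Gc: "G i x \<in> carrier (P i)" if "x \<in> carrier (P i)" for i x
    using degree_hom_closed[OF G that] by simp
  have \<tau>0: "\<tau> \<zero> = \<zero>"
    by (rule add_hom_zero[OF R.abelian_group_axioms R.abelian_group_axioms])
      (auto simp: add_hom_def graded_endoD[OF \<tau>])
  have coch: "\<psi> i f \<in> cochains i" if "f \<in> cochains i" for i f
    by (rule graded_Hom_map[OF PM PM sl(1) sl(2) that])
  show "\<psi> i f \<in> Z i" if f: "f \<in> Z i"
  proof -
    have "\<psi> i f (d i x) = \<zero>" if x: "x \<in> carrier (P (Suc i))" for x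
    proof -
      have "\<psi> i f (d i x) = \<tau> (f (d i (G (Suc i) x)))"
        using d_closed[OF x] by (simp add: \<psi>_def Gd[OF x])
      also have "f (d i (G (Suc i) x)) = \<zero>" using f Gc[OF x] unfolding Z_iff by blast
      finally show ?thesis by (simp add: \<tau>0)
    qed
    then show ?thesis using f coch unfolding Z_iff by blast
  qed
  show "\<psi> i f \<in> B i" if f: "f \<in> B i"
  proof (cases i)
    case 0
    have "f = \<zero>\<^bsub>C 0\<^esub>" using f unfolding 0 B_zero by simp
    then have "\<psi> i f = \<zero>\<^bsub>C 0\<^esub>" using add_hom_zero[OF dual_abelian dual_abelian sl(1)[of 0]] 0 by simp
    then show ?thesis unfolding 0 B_zero by simp
  next
    case (Suc j)
    then obtain g where g: "g \<in> cochains j" "f = compose (carrier (P (Suc j))) g (d j)" using f by (auto simp: B_Suc)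
    have "\<psi> i f = compose (carrier (P (Suc j))) (\<psi> j g) (d j)"
      unfolding g(2) Suc \<psi>_def by (auto simp: compose_def d_closed Gc Gd intro!: restrict_ext)
    then show ?thesis using coch[OF g(1)] unfolding Suc B_Suc by blast
  qed
qed

text \<open>With \<open>E = d s + s d\<close>, a cocycle satisfies \<open>f E = (f s) d\<close>,
  because \<open>f d\<close> is zero.\<close>

lemma null_homotopic_cocycle:
  assumes s: "\<And>i. s i \<in> degree_hom R 0 (P i) (P (Suc i))"
    and s0: "\<And>x. x \<in> carrier (P 0) \<Longrightarrow> d 0 (s 0 x) = E 0 x"
    and sS: "\<And>i x. x \<in> carrier (P (Suc i)) \<Longrightarrow>
      d (Suc i) (s (Suc i) x) = E (Suc i) x \<ominus>\<^bsub>P (Suc i)\<^esub> s i (d i x)"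
    and E: "\<And>i x. x \<in> carrier (P i) \<Longrightarrow> E i x \<in> carrier (P i)"
    and f: "f \<in> Z i"
  shows "(\<lambda>x\<in>carrier (P i). f (E i x)) \<in> B i"
proof -
  have sc: "s i x \<in> carrier (P (Suc i))" if "x \<in> carrier (P i)" for i x
    by (rule degree_hom_closed[OF s that])
  have fd: "f (d i y) = \<zero>" if "y \<in> carrier (P (Suc i))" for y
    using f that unfolding Z_iff by blast
  show ?thesis
  proof (cases i)
    \<comment> \<open>In degree zero the only coboundary is zero; accordingly \<open>E 0\<close> is
      \<open>d 0\<close> after \<open>s 0\<close>, which \<open>f\<close> kills.\<close>
    case 0
    have "f (E 0 x) = \<zero>" if "x \<in> carrier (P 0)" for x
      using fd[of "s 0 x"] sc[OF that] s0[OF that] 0 by simp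
    then have "(\<lambda>x\<in>carrier (P i). f (E i x)) = \<zero>\<^bsub>C 0\<^esub>"
      unfolding 0 dual_simps by (intro restrict_ext)
    then show ?thesis unfolding 0 B_zero by simp
  next
    case (Suc j)
    interpret Pi: left_module R "P i" by (rule graded_module_left[OF PM])
    have fD: "f \<in> carrier (C i)" by (rule Z_dual[OF f])
    have fa: "f \<in> add_hom (P i) R" using fD by (auto simp: add_hom_def dual_carrierD)
    have "f (E i x) = f (s j (d j x))" if x: "x \<in> carrier (P i)" for x
    proof -
      have c: "E i x \<in> carrier (P i)" "s j (d j x) \<in> carrier (P i)"
        using E[OF x] x sc d_closed by (auto simp: Suc)
      have "f (d i (s i x)) = \<zero>" using fd[OF sc[OF x]] by simp
      moreover have "d i (s i x) = E i x \<ominus>\<^bsub>P i\<^esub> s j (d j x)" using sS x unfolding Suc by blast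
      moreover have "f (E i x \<ominus>\<^bsub>P i\<^esub> s j (d j x)) = f (E i x) \<ominus> f (s j (d j x))"
        by (rule add_hom_minus[OF Pi.M.abelian_group_axioms R.abelian_group_axioms fa c])
      ultimately have "f (E i x) \<oplus> \<ominus> f (s j (d j x)) = \<zero>" by (simp add: a_minus_def)
      from R.minus_equality[OF this] show ?thesis using c add_hom_closed[OF fa] by simp
    qed
    then have "(\<lambda>x\<in>carrier (P i). f (E i x)) = compose (carrier (P (Suc j))) (compose (carrier (P j)) f (s j)) (d j)"
      unfolding Suc by (auto simp: compose_def d_closed intro!: restrict_ext)
    \<comment> \<open>Since \<open>s j\<close> has degree zero, \<open>f\<close> after
      \<open>s j\<close> is still a finite sum of homogeneous maps.\<close>
    moreover have "compose (carrier (P j)) f (s j) \<in> cochains j"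
      using graded_Hom_map[OF PM PM dual_compose(1)[OF PM s PM] dual_compose(2)[OF PM s PM]] f
      unfolding Suc Z_iff by blast
    ultimately show ?thesis unfolding Suc B_Suc by blast
  qed
qed

section \<open>Cohomology classes and their representatives\<close>

lemma H_carrier: "X \<in> carrier (H i) \<longleftrightarrow> (\<exists>f\<in>Z i. X = cls i f)"
  by (auto simp: cohomology_def quot_carrier)

lemma H_hpart: "X \<in> hpart (H i) j \<longleftrightarrow> (\<exists>f\<in>Z i. f \<in> hpart (C i) j \<and> X = cls i f)"
  by (auto simp: cohomology_def quot_hpart)

lemma H_smult:
  assumes "t \<in> carrier R" "f \<in> Z i"
  shows "t \<odot>\<^bsub>H i\<^esub> (cls i f) = cls i (t \<odot>\<^bsub>C i\<^esub> f)"
proof -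
  interpret Q: quotient_group "ZM i" "B i" by (rule ZM_quotient)
  have "(\<lambda>f. t \<odot>\<^bsub>ZM i\<^esub> f) \<in> add_hom (ZM i) (ZM i)"
    using dual_smult_add_hom[OF PM assms(1), of i] Z_smult[OF assms(1), of _ i] Z_dual[of _ i]
    unfolding add_hom_def ZM_simps by blast
  from Q.quot_smult[OF this, of f] show ?thesis
    unfolding cohomology_def ZM_simps using B_smult[OF assms(1)] assms(2) by blast
qed

lemma H_eq:
  "\<lbrakk>f \<in> Z i; g \<in> Z i\<rbrakk> \<Longrightarrow> cls i f = cls i g \<longleftrightarrow> f \<ominus>\<^bsub>C i\<^esub> g \<in> B i"
  using quotient_group.coset_eq[OF ZM_quotient, of f i g] ZM_minus[of f i g] unfolding ZM_simps by simp

lemma H_zero_iff: "f \<in> Z i \<Longrightarrow> cls i f = \<zero>\<^bsub>H i\<^esub> \<longleftrightarrow> f \<in> B i"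
  using quotient_group.coset_zero_iff[OF ZM_quotient, of f i] unfolding ZM_simps cohomology_def by simp

lemma H_abelian_group: "abelian_group (H i)"
  unfolding cohomology_def by (rule quotient_group.quot_abelian_group[OF ZM_quotient])

lemma H_smult_closed: "\<lbrakk>t \<in> carrier R; X \<in> carrier (H i)\<rbrakk> \<Longrightarrow> t \<odot>\<^bsub>H i\<^esub> X \<in> carrier (H i)"
  unfolding H_carrier using H_smult Z_smult by blast

text \<open>\<open>\<Psi>\<close> is induced by a lift \<open>G\<close> of \<open>\<sigma>'\<close>,
  followed by \<open>\<tau>\<close> on values. Injectivity comes from the map \<open>\<phi>\<close>
  induced in the same way by a lift \<open>F\<close> of \<open>\<sigma>\<close>: applying first
  \<open>\<psi>\<close> and then \<open>\<phi>\<close> turns \<open>f\<close> into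
  \<open>f G F\<close>, and \<open>G F\<close> is homotopic to the identity.\<close>

theorem semilinear_cohomology:
  assumes proj: "\<And>i. projective R (P i)"
    and \<tau>: "graded_endo R \<tau>" and \<tau>': "graded_endo R \<tau>'"
    and inv: "\<And>r. r \<in> carrier R \<Longrightarrow> \<tau> (\<tau>' r) = r" "\<And>r. r \<in> carrier R \<Longrightarrow> \<tau>' (\<tau> r) = r"
    and \<sigma>: "\<sigma> \<in> degree_hom R 0 M (twist \<tau> M)" and \<sigma>': "\<sigma>' \<in> degree_hom R 0 M (twist \<tau>' M)"
    and inv_\<sigma>: "\<And>x. x \<in> carrier M \<Longrightarrow> \<sigma>' (\<sigma> x) = x"
  obtains \<Psi> where "\<And>X. X \<in> carrier (H i) \<Longrightarrow> \<Psi> X \<in> carrier (H i)"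
    "\<And>X t. \<lbrakk>X \<in> carrier (H i); t \<in> carrier R\<rbrakk> \<Longrightarrow> \<Psi> (t \<odot>\<^bsub>H i\<^esub> X) = \<tau> t \<odot>\<^bsub>H i\<^esub> \<Psi> X"
    "\<And>X j. X \<in> hpart (H i) j \<Longrightarrow> \<Psi> X \<in> hpart (H i) j"
    "\<And>X. \<lbrakk>X \<in> carrier (H i); \<Psi> X = \<zero>\<^bsub>H i\<^esub>\<rbrakk> \<Longrightarrow> X = \<zero>\<^bsub>H i\<^esub>"
proof -
  have R: "graded_ring R" by (rule graded_ring_axioms)
  interpret Pn: left_module R "P n" for n by (rule graded_module_left[OF PM])
  obtain F where F: "\<And>i. F i \<in> degree_hom R 0 (P i) (twist \<tau> (P i))"
    "\<And>x. x \<in> carrier (P 0) \<Longrightarrow> e (F 0 x) = \<sigma> (e x)"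
    "\<And>i x. x \<in> carrier (P (Suc i)) \<Longrightarrow> d i (F (Suc i) x) = F i (d i x)"
    using semilinear_chain_map_ex[OF R \<tau> resolution proj \<sigma>] by blast
  obtain G where G: "\<And>i. G i \<in> degree_hom R 0 (P i) (twist \<tau>' (P i))"
    "\<And>x. x \<in> carrier (P 0) \<Longrightarrow> e (G 0 x) = \<sigma>' (e x)"
    "\<And>i x. x \<in> carrier (P (Suc i)) \<Longrightarrow> d i (G (Suc i) x) = G i (d i x)"
    using semilinear_chain_map_ex[OF R \<tau>' resolution proj \<sigma>'] by blast
  note Fm = mod_homD[OF degree_hom_mod_hom[OF F(1)], simplified]
    and Gm = mod_homD[OF degree_hom_mod_hom[OF G(1)], simplified]
  \<comment> \<open>\<open>G F\<close> lifts the composite of \<open>\<sigma>\<close> and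
    \<open>\<sigma>'\<close>, which is the identity, so \<open>E\<close> lifts zero. The two twists
    cancel as well, which makes \<open>G F\<close> linear.\<close>
  define E where "E i x = G i (F i x) \<ominus>\<^bsub>P i\<^esub> x" for i x
  have GF: "(\<lambda>x. G i (F i x)) \<in> degree_hom R 0 (P i) (P i)" for i
    using degree_hom_hpart[OF F(1)] degree_hom_hpart[OF G(1)]
    by (auto simp: degree_hom_def mod_hom_def Fm Gm graded_endoD[OF \<tau>] inv)
  have E: "E i \<in> degree_hom R 0 (P i) (P i)" for i
    unfolding E_def by (rule degree_hom_diff[OF PM PM GF degree_hom_id])
  have Ec: "E i x \<in> carrier (P i)" if "x \<in> carrier (P i)" for i x by (rule degree_hom_closed[OF E that])
  interpret M: left_module R M by (rule graded_module_left[OF graded_resolutionD(1)[OF resolution]])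
  have E0: "e (E 0 x) = \<zero>\<^bsub>M\<^esub>" if x: "x \<in> carrier (P 0)" for x
  proof -
    have ex: "e x \<in> carrier M" by (rule degree_hom_closed[OF graded_resolutionD(3)[OF resolution] x])
    have "e (E 0 x) = e (G 0 (F 0 x)) \<ominus>\<^bsub>M\<^esub> e x"
      unfolding E_def
      by (rule add_hom_minus[OF Pn.M.abelian_group_axioms M.M.abelian_group_axioms
            mod_hom_add_hom[OF degree_hom_mod_hom[OF graded_resolutionD(3)[OF resolution]]] _ x])
        (simp add: Fm Gm x)
    then show ?thesis using ex by (simp add: F(2) G(2) Fm x inv_\<sigma> a_minus_def M.M.r_neg)
  qed
  have Ed: "d i (E (Suc i) x) = E i (d i x)" if x: "x \<in> carrier (P (Suc i))" for i x
  proof -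
    have "d i (E (Suc i) x) = d i (G (Suc i) (F (Suc i) x)) \<ominus>\<^bsub>P i\<^esub> d i x"
      unfolding E_def
      by (rule add_hom_minus[OF Pn.M.abelian_group_axioms Pn.M.abelian_group_axioms
            mod_hom_add_hom[OF degree_hom_mod_hom[OF d_hom]] _ x]) (simp add: Fm Gm x)
    then show ?thesis by (simp add: F(3) G(3) Fm x E_def)
  qed
  obtain s where s: "\<And>i. s i \<in> degree_hom R 0 (P i) (P (Suc i))"
    "\<And>x. x \<in> carrier (P 0) \<Longrightarrow> d 0 (s 0 x) = E 0 x"
    "\<And>i x. x \<in> carrier (P (Suc i)) \<Longrightarrow>
      d (Suc i) (s (Suc i) x) = E (Suc i) x \<ominus>\<^bsub>P (Suc i)\<^esub> s i (d i x)"
    using null_homotopy_ex[OF R resolution proj E E0 Ed] by blast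
  define \<psi> where "\<psi> f = (\<lambda>x\<in>carrier (P i). \<tau> (f (G i x)))" for f
  define \<phi> where "\<phi> f = (\<lambda>x\<in>carrier (P i). \<tau>' (f (F i x)))" for f
  have \<psi>D: "\<psi> \<in> add_hom (C i) (C i)"
    "f \<in> hpart (C i) j \<Longrightarrow> \<psi> f \<in> hpart (C i) j"
    "\<lbrakk>f \<in> carrier (C i); t \<in> carrier R\<rbrakk> \<Longrightarrow> \<psi> (t \<odot>\<^bsub>C i\<^esub> f) = \<tau> t \<odot>\<^bsub>C i\<^esub> \<psi> f"
    for f j t
    unfolding \<psi>_def by (rule dual_semilinear[OF PM PM G(1) \<tau> \<tau>' inv(1)], assumption+)+
  have \<psi>ZB: "f \<in> Z i \<Longrightarrow> \<psi> f \<in> Z i" "f \<in> B i \<Longrightarrow> \<psi> f \<in> B i" for f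
    unfolding \<psi>_def by (rule semilinear_cochains[OF \<tau> \<tau>' inv(1) G(1) G(3)], assumption+)+
  have \<phi>ZB: "f \<in> Z i \<Longrightarrow> \<phi> f \<in> Z i" "f \<in> B i \<Longrightarrow> \<phi> f \<in> B i" for f
    unfolding \<phi>_def by (rule semilinear_cochains[OF \<tau>' \<tau> inv(2) F(1) F(3)], assumption+)+
  \<comment> \<open>An arbitrary representative is transformed; the class obtained is independent of
    it because \<open>\<psi>\<close> preserves coboundaries.\<close>
  define \<Psi> where "\<Psi> X = cls i (\<psi> (SOME f. f \<in> Z i \<and> X = cls i f))" for X
  have \<Psi>: "\<Psi> (cls i f) = cls i (\<psi> f)" if f: "f \<in> Z i" for f
  proof -
    define g where "g = (SOME g. g \<in> Z i \<and> cls i f = cls i g)"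
    have g: "g \<in> Z i" "cls i f = cls i g"
      using someI[of "\<lambda>g. g \<in> Z i \<and> cls i f = cls i g" f] f unfolding g_def by blast+
    then have "g \<ominus>\<^bsub>C i\<^esub> f \<in> B i" using H_eq[OF g(1) f] by simp
    then have "\<psi> (g \<ominus>\<^bsub>C i\<^esub> f) \<in> B i" by (rule \<psi>ZB(2))
    then have "\<psi> g \<ominus>\<^bsub>C i\<^esub> \<psi> f \<in> B i"
      using add_hom_minus[OF dual_abelian dual_abelian \<psi>D(1) Z_dual[OF g(1)] Z_dual[OF f]] by simp
    then have "cls i (\<psi> g) = cls i (\<psi> f)" using H_eq[OF \<psi>ZB(1)[OF g(1)] \<psi>ZB(1)[OF f]] by simp
    then show ?thesis unfolding \<Psi>_def g_def .
  qed
  show thesis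
  proof (rule that[of \<Psi>])
    show "\<Psi> X \<in> carrier (H i)" if "X \<in> carrier (H i)" for X
      using that \<Psi> \<psi>ZB(1) unfolding H_carrier by blast
    show "\<Psi> (t \<odot>\<^bsub>H i\<^esub> X) = \<tau> t \<odot>\<^bsub>H i\<^esub> \<Psi> X" if X: "X \<in> carrier (H i)" and t: "t \<in> carrier R" for X t
    proof -
      obtain f where f: "f \<in> Z i" "X = cls i f" using X unfolding H_carrier by blast
      show ?thesis
        unfolding f(2) H_smult[OF t f(1)] \<Psi>[OF f(1)] \<Psi>[OF Z_smult[OF t f(1)]]
          H_smult[OF graded_endoD(1)[OF \<tau> t] \<psi>ZB(1)[OF f(1)]] \<psi>D(3)[OF Z_dual[OF f(1)] t] ..
    qed
    show "\<Psi> X \<in> hpart (H i) j" if "X \<in> hpart (H i) j" for X j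
      using that \<Psi> \<psi>ZB(1) \<psi>D(2) unfolding H_hpart by blast
    show "X = \<zero>\<^bsub>H i\<^esub>" if X: "X \<in> carrier (H i)" and "\<Psi> X = \<zero>\<^bsub>H i\<^esub>" for X
    proof -
      obtain f where f: "f \<in> Z i" "X = cls i f" using X unfolding H_carrier by blast
      have "\<psi> f \<in> B i" using that(2) unfolding f(2) \<Psi>[OF f(1)] H_zero_iff[OF \<psi>ZB(1)[OF f(1)]] .
      then have \<phi>\<psi>: "\<phi> (\<psi> f) \<in> B i" by (rule \<phi>ZB(2))
      have fE: "(\<lambda>x\<in>carrier (P i). f (E i x)) \<in> B i"
        by (rule null_homotopic_cocycle[OF s Ec f(1)])
      note fD = Z_dual[OF f(1)]
      have fa: "f \<in> add_hom (P i) R" using fD by (auto simp: add_hom_def dual_carrierD)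
      interpret Bi: additive_subgroup "B i" "C i" by (rule B_subgroup)
      interpret D: abelian_group "C i" by (rule dual_abelian)
      have diff: "\<phi> (\<psi> f) \<ominus>\<^bsub>C i\<^esub> (\<lambda>x\<in>carrier (P i). f (E i x)) \<in> B i"
        unfolding a_minus_def by (intro Bi.a_closed Bi.a_inv_closed \<phi>\<psi> fE)
      \<comment> \<open>This is \<open>f = f G F - f E\<close>, where both terms on the right are
        already known to be coboundaries.\<close>
      have "\<phi> (\<psi> f) \<ominus>\<^bsub>C i\<^esub> (\<lambda>x\<in>carrier (P i). f (E i x)) = f"
      proof (rule dual_eqI[OF Bi.a_Hcarr[OF diff] fD])
        fix x assume x: "x \<in> carrier (P i)"
        have GFx: "G i (F i x) \<in> carrier (P i)" by (simp add: Fm Gm x)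
        have "\<phi> (\<psi> f) x = f (G i (F i x))" using x GFx fD by (simp add: \<phi>_def \<psi>_def Fm dual_carrierD inv)
        moreover have "f (E i x) = f (G i (F i x)) \<ominus> f x"
          unfolding E_def by (rule add_hom_minus[OF Pn.M.abelian_group_axioms R.abelian_group_axioms fa GFx x])
        ultimately show "(\<phi> (\<psi> f) \<ominus>\<^bsub>C i\<^esub> (\<lambda>x\<in>carrier (P i). f (E i x))) x = f x"
          using x GFx fD dual_minus[OF PM Bi.a_Hcarr[OF \<phi>\<psi>] Bi.a_Hcarr[OF fE] x]
          by (simp add: dual_carrierD a_minus_def R.minus_add R.add.m_assoc[symmetric] R.r_neg R.l_neg)
      qed
      then have "f \<in> B i" using diff by simp
      then show ?thesis unfolding f(2) using H_zero_iff[OF f(1)] by simp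
    qed
  qed
qed

end

section \<open>Monoid algebras\<close>

lemma ring_cong:
  assumes "carrier M = carrier N" "mult M = mult N" "one M = one N" "add M = add N" "zero M = zero N" "ring M"
  shows "ring N"
proof -
  interpret ring M by fact
  show ?thesis
    using assms(1-5)[symmetric] abelian_group_cong[OF assms(1,4,5) abelian_group_axioms]
    by (intro ringI monoidI) (auto simp: m_assoc l_distr r_distr)
qed

lemma mod_hom_comp: "\<lbrakk>f \<in> mod_hom R M N; g \<in> mod_hom R N L\<rbrakk> \<Longrightarrow> (\<lambda>x. g (f x)) \<in> mod_hom R M L"
  by (auto simp: mod_hom_def Pi_iff)

locale monoid_alg = K?: cring K + G?: Group.monoid G
  for K :: "('k, 'z) ring_scheme" (structure) and G :: "('g, 'x) monoid_scheme" +
  fixes W :: "int \<Rightarrow> 'g set"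
begin

abbreviation F :: "('k, 'g \<Rightarrow> 'k) graded" where "F \<equiv> monoid_algebra K G W"

abbreviation \<delta> :: "'g \<Rightarrow> 'g \<Rightarrow> 'k" where "\<delta> \<equiv> basis_elem K"

abbreviation conv (infixl "\<star>" 70) where "f \<star> g \<equiv> f \<otimes>\<^bsub>F\<^esub> g"

sublocale Fr: free_left_module K F "carrier G"
  by (intro free_left_module.intro free_left_module_axioms.intro K.ring_axioms)
    (simp_all add: monoid_algebra_def fin_supp_def Let_def)

sublocale FM: left_module K F
  by (rule Fr.F_left_module)

text \<open>The convolution for an arbitrary binary operation \<open>m\<close> on the basis, so that exchanging the
  factors carries linearity over from one side to the other.\<close>

definition gconv :: "('g \<Rightarrow> 'g \<Rightarrow> 'g) \<Rightarrow> ('g \<Rightarrow> 'k) \<Rightarrow> ('g \<Rightarrow> 'k) \<Rightarrow> 'g \<Rightarrow> 'k" where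
  "gconv m f g z = (\<Oplus>p\<in>{(x, y). f x \<noteq> \<zero> \<and> g y \<noteq> \<zero> \<and> m x y = z}. f (fst p) \<otimes> g (snd p))"

lemma F_mult: "f \<star> g = gconv (mult G) f g"
  by (simp add: monoid_algebra_def Let_def gconv_def[abs_def])

lemma F_one: "\<one>\<^bsub>F\<^esub> = \<delta> \<one>\<^bsub>G\<^esub>"
  by (simp add: monoid_algebra_def basis_elem_def Let_def)

lemma F_hpart: "f \<in> hpart F n \<longleftrightarrow> f \<in> carrier F \<and> {x. f x \<noteq> \<zero>} \<subseteq> W n"
  by (simp add: monoid_algebra_def Let_def)

text \<open>The defining sum runs over exact supports, which may shrink by cancellation; rectangles
  \<open>A \<times> B\<close> containing them allow a common index set.\<close>

lemma gconv_superset: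
  assumes f: "f \<in> carrier F" and g: "g \<in> carrier F" and A: "finite A" "{x. f x \<noteq> \<zero>} \<subseteq> A"
    and B: "finite B" "{x. g x \<noteq> \<zero>} \<subseteq> B"
  shows "gconv m f g z = (\<Oplus>p\<in>{p \<in> A \<times> B. m (fst p) (snd p) = z}. f (fst p) \<otimes> g (snd p))"
  unfolding gconv_def using A B
  by (intro K.finsum_superset) (auto simp: Fr.F_closed[OF f] Fr.F_closed[OF g])

lemma gconv_swap:
  assumes f: "f \<in> carrier F" and g: "g \<in> carrier F"
  shows "gconv m f g = gconv (\<lambda>x y. m y x) g f"
proof
  fix z
  let ?S = "{(x, y). g x \<noteq> \<zero> \<and> f y \<noteq> \<zero> \<and> m y x = z}"
  have "gconv m f g z = (\<Oplus>p\<in>prod.swap ` ?S. f (fst p) \<otimes> g (snd p))"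
    unfolding gconv_def by (rule arg_cong[where f = "finsum K _"]) force
  also have "\<dots> = (\<Oplus>p\<in>?S. f (snd p) \<otimes> g (fst p))"
    by (subst K.finsum_reindex) (auto simp: Fr.F_closed[OF f] Fr.F_closed[OF g])
  also have "\<dots> = gconv (\<lambda>x y. m y x) g f z"
    unfolding gconv_def
    by (intro K.finsum_cong' refl) (auto simp: Fr.F_closed[OF f] Fr.F_closed[OF g] K.m_comm)
  finally show "gconv m f g z = gconv (\<lambda>x y. m y x) g f z" .
qed

lemma gconv_linear:
  assumes f: "f \<in> carrier F" and g: "g \<in> carrier F"
  shows "f' \<in> carrier F \<Longrightarrow> gconv m (f \<oplus>\<^bsub>F\<^esub> f') g = gconv m f g \<oplus>\<^bsub>F\<^esub> gconv m f' g"
    and "c \<in> carrier K \<Longrightarrow> gconv m (c \<odot>\<^bsub>F\<^esub> f) g = c \<odot>\<^bsub>F\<^esub> gconv m f g"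
proof -
  note fc = Fr.F_closed[OF f] and gc = Fr.F_closed[OF g]
  let ?A = "{x. f x \<noteq> \<zero>}" and ?B = "{x. g x \<noteq> \<zero>}"
  have A: "finite ?A" and B: "finite ?B" by (rule Fr.F_finite[OF f], rule Fr.F_finite[OF g])
  show "gconv m (f \<oplus>\<^bsub>F\<^esub> f') g = gconv m f g \<oplus>\<^bsub>F\<^esub> gconv m f' g" if f': "f' \<in> carrier F"
  proof
    fix z
    note f'c = Fr.F_closed[OF f']
    let ?A' = "?A \<union> {x. f' x \<noteq> \<zero>}"
    let ?S = "{p \<in> ?A' \<times> ?B. m (fst p) (snd p) = z}"
    have A': "finite ?A'" using A Fr.F_finite[OF f'] by simp
    have "gconv m (f \<oplus>\<^bsub>F\<^esub> f') g z = (\<Oplus>p\<in>?S. (f \<oplus>\<^bsub>F\<^esub> f') (fst p) \<otimes> g (snd p))"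
      using A' B by (intro gconv_superset FM.M.a_closed f f' g) (auto simp: Fr.add_F)
    also have "\<dots> = (\<Oplus>p\<in>?S. f (fst p) \<otimes> g (snd p) \<oplus> f' (fst p) \<otimes> g (snd p))"
      by (intro K.finsum_cong' refl) (auto simp: Fr.add_F fc f'c gc K.l_distr)
    also have "\<dots> = (\<Oplus>p\<in>?S. f (fst p) \<otimes> g (snd p)) \<oplus> (\<Oplus>p\<in>?S. f' (fst p) \<otimes> g (snd p))"
      by (intro K.finsum_addf) (auto simp: fc f'c gc)
    also have "(\<Oplus>p\<in>?S. f (fst p) \<otimes> g (snd p)) = gconv m f g z"
      using A' B by (intro gconv_superset[symmetric] f g) auto
    also have "(\<Oplus>p\<in>?S. f' (fst p) \<otimes> g (snd p)) = gconv m f' g z"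
      using A' B by (intro gconv_superset[symmetric] f' g) auto
    finally show "gconv m (f \<oplus>\<^bsub>F\<^esub> f') g z = (gconv m f g \<oplus>\<^bsub>F\<^esub> gconv m f' g) z" by (simp add: Fr.add_F)
  qed
  show "gconv m (c \<odot>\<^bsub>F\<^esub> f) g = c \<odot>\<^bsub>F\<^esub> gconv m f g" if c: "c \<in> carrier K"
  proof
    fix z
    let ?S = "{p \<in> ?A \<times> ?B. m (fst p) (snd p) = z}"
    have S: "finite ?S" using A B by simp
    have "gconv m (c \<odot>\<^bsub>F\<^esub> f) g z = (\<Oplus>p\<in>?S. (c \<odot>\<^bsub>F\<^esub> f) (fst p) \<otimes> g (snd p))"
      using A B c by (intro gconv_superset FM.smult_closed f g) (auto simp: Fr.smult_F)
    also have "\<dots> = (\<Oplus>p\<in>?S. c \<otimes> (f (fst p) \<otimes> g (snd p)))"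
      by (intro K.finsum_cong' refl) (auto simp: Fr.smult_F fc gc c K.m_assoc)
    also have "\<dots> = c \<otimes> (\<Oplus>p\<in>?S. f (fst p) \<otimes> g (snd p))"
      by (intro K.finsum_rdistr[symmetric] S c) (auto simp: fc gc)
    also have "(\<Oplus>p\<in>?S. f (fst p) \<otimes> g (snd p)) = gconv m f g z"
      using A B by (intro gconv_superset[symmetric] f g) auto
    finally show "gconv m (c \<odot>\<^bsub>F\<^esub> f) g z = (c \<odot>\<^bsub>F\<^esub> gconv m f g) z" by (simp add: Fr.smult_F)
  qed
qed

lemma F_mult_closed:
  assumes f: "f \<in> carrier F" and g: "g \<in> carrier F"
  shows "f \<star> g \<in> carrier F"
proof (rule Fr.F_I)
  let ?S = "{x. f x \<noteq> \<zero>} \<times> {x. g x \<noteq> \<zero>}"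
  show "finite ((\<lambda>(x, y). x \<otimes>\<^bsub>G\<^esub> y) ` ?S)" using Fr.F_finite f g by simp
  show "(\<lambda>(x, y). x \<otimes>\<^bsub>G\<^esub> y) ` ?S \<subseteq> carrier G" using Fr.F_supp f g by auto
  show "(f \<star> g) z \<in> carrier K" for z
    unfolding F_mult gconv_def
    by (intro K.finsum_closed) (auto simp: Fr.F_closed[OF f] Fr.F_closed[OF g])
  show "(f \<star> g) z = \<zero>" if "z \<notin> (\<lambda>(x, y). x \<otimes>\<^bsub>G\<^esub> y) ` ?S" for z
  proof -
    have "{(x, y). f x \<noteq> \<zero> \<and> g y \<noteq> \<zero> \<and> x \<otimes>\<^bsub>G\<^esub> y = z} = {}" using that by force
    then show ?thesis unfolding F_mult gconv_def by (simp only: K.finsum_empty)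
  qed
qed

lemma F_mult_left_hom: "g \<in> carrier F \<Longrightarrow> (\<lambda>f. f \<star> g) \<in> mod_hom K F F"
  by (intro mod_homI F_mult_closed) (auto simp: F_mult gconv_linear)

lemma F_mult_right_hom: "f \<in> carrier F \<Longrightarrow> (\<lambda>g. f \<star> g) \<in> mod_hom K F F"
  by (intro mod_homI F_mult_closed)
    (auto simp: F_mult gconv_swap[of f] gconv_linear FM.smult_closed)

lemma basis_mult:
  assumes "x \<in> carrier G" "y \<in> carrier G"
  shows "\<delta> x \<star> \<delta> y = \<delta> (x \<otimes>\<^bsub>G\<^esub> y)"
proof
  fix z
  have "(\<delta> x \<star> \<delta> y) z = (\<Oplus>p\<in>{p \<in> {x} \<times> {y}. fst p \<otimes>\<^bsub>G\<^esub> snd p = z}. \<delta> x (fst p) \<otimes> \<delta> y (snd p))"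
    using assms unfolding F_mult by (intro gconv_superset Fr.basis_closed) (auto simp: basis_elem_def)
  also have "\<dots> = \<delta> (x \<otimes>\<^bsub>G\<^esub> y) z"
  proof (cases "x \<otimes>\<^bsub>G\<^esub> y = z")
    case True
    then have "{p \<in> {x} \<times> {y}. fst p \<otimes>\<^bsub>G\<^esub> snd p = z} = {(x, y)}" by auto
    then show ?thesis using True by (simp add: basis_elem_def K.finsum_singleton)
  next
    case False
    then have eq: "{p \<in> {x} \<times> {y}. fst p \<otimes>\<^bsub>G\<^esub> snd p = z} = {}" by auto
    show ?thesis unfolding eq using False by (auto simp: basis_elem_def)
  qed
  finally show "(\<delta> x \<star> \<delta> y) z = \<delta> (x \<otimes>\<^bsub>G\<^esub> y) z" .
qed

text \<open>Both sides are linear in each factor. Replacing \<open>h\<close>, then \<open>g\<close>,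
  then \<open>f\<close> by basis elements reduces the claim to associativity in
  \<open>G\<close>.\<close>

lemma F_assoc:
  assumes f: "f \<in> carrier F" and g: "g \<in> carrier F" and h: "h \<in> carrier F"
  shows "(f \<star> g) \<star> h = f \<star> (g \<star> h)"
proof -
  note lh = F_mult_left_hom and rh = F_mult_right_hom and b = Fr.basis_closed and L = FM.left_module_axioms
  have 1: "(\<delta> x \<star> \<delta> y) \<star> h = \<delta> x \<star> (\<delta> y \<star> h)" if "x \<in> carrier G" "y \<in> carrier G" for x y
    using Fr.free_hom_ext[OF L rh[OF F_mult_closed[OF b b]] mod_hom_comp[OF rh[OF b] rh[OF b]] _ h] that
    by (simp add: basis_mult G.m_assoc)
  have 2: "(\<delta> x \<star> g) \<star> h = \<delta> x \<star> (g \<star> h)" if "x \<in> carrier G" for x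
    using Fr.free_hom_ext[OF L mod_hom_comp[OF rh[OF b] lh[OF h]] mod_hom_comp[OF lh[OF h] rh[OF b]] _ g] that 1
    by simp
  show ?thesis
    using Fr.free_hom_ext[OF L mod_hom_comp[OF lh[OF g] lh[OF h]] lh[OF F_mult_closed[OF g h]] _ f] 2
    by simp
qed

lemma F_ring: "ring F"
proof (rule ringI)
  note lh = F_mult_left_hom and rh = F_mult_right_hom and L = FM.left_module_axioms
  have id: "(\<lambda>f. f) \<in> mod_hom K F F" by (auto simp: mod_hom_def)
  have one: "\<one>\<^bsub>F\<^esub> \<in> carrier F" unfolding F_one by (rule Fr.basis_closed) simp
  show "abelian_group F" by (rule FM.M.abelian_group_axioms)
  show "Group.monoid F"
  proof (rule monoidI)
    show "\<one>\<^bsub>F\<^esub> \<star> f = f" if "f \<in> carrier F" for f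
      using Fr.free_hom_ext[OF L rh[OF one] id _ that] by (simp add: F_one basis_mult)
    show "f \<star> \<one>\<^bsub>F\<^esub> = f" if "f \<in> carrier F" for f
      using Fr.free_hom_ext[OF L lh[OF one] id _ that] by (simp add: F_one basis_mult)
  qed (simp_all only: F_mult_closed F_assoc one)
qed (simp_all only: mod_hom_add[OF F_mult_left_hom] mod_hom_add[OF F_mult_right_hom])

end

section \<open>Tensor products\<close>

definition bilin ::
  "('k, 'z) ring_scheme \<Rightarrow> ('k, 'a, 'x) module_scheme \<Rightarrow> ('k, 'b, 'y) module_scheme \<Rightarrow>
   ('k, 'm, 'w) module_scheme \<Rightarrow> ('a \<times> 'b \<Rightarrow> 'm) \<Rightarrow> bool" where
  "bilin K A B X g \<longleftrightarrow>
     (\<forall>a\<in>carrier A. (\<lambda>b. g (a, b)) \<in> mod_hom K B X) \<and> (\<forall>b\<in>carrier B. (\<lambda>a. g (a, b)) \<in> mod_hom K A X)"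

lemma bilinD:
  assumes "bilin K A B X g"
  shows "\<lbrakk>a \<in> carrier A; b \<in> carrier B\<rbrakk> \<Longrightarrow> g (a, b) \<in> carrier X"
    "\<lbrakk>a \<in> carrier A; a' \<in> carrier A; b \<in> carrier B\<rbrakk> \<Longrightarrow> g (a \<oplus>\<^bsub>A\<^esub> a', b) = g (a, b) \<oplus>\<^bsub>X\<^esub> g (a', b)"
    "\<lbrakk>a \<in> carrier A; b \<in> carrier B; b' \<in> carrier B\<rbrakk> \<Longrightarrow> g (a, b \<oplus>\<^bsub>B\<^esub> b') = g (a, b) \<oplus>\<^bsub>X\<^esub> g (a, b')"
    "\<lbrakk>c \<in> carrier K; a \<in> carrier A; b \<in> carrier B\<rbrakk> \<Longrightarrow> g (c \<odot>\<^bsub>A\<^esub> a, b) = c \<odot>\<^bsub>X\<^esub> g (a, b)"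
    "\<lbrakk>c \<in> carrier K; a \<in> carrier A; b \<in> carrier B\<rbrakk> \<Longrightarrow> g (a, c \<odot>\<^bsub>B\<^esub> b) = c \<odot>\<^bsub>X\<^esub> g (a, b)"
  using assms unfolding bilin_def mod_hom_def by blast+

lemma bilinI:
  assumes "\<And>a b. \<lbrakk>a \<in> carrier A; b \<in> carrier B\<rbrakk> \<Longrightarrow> g (a, b) \<in> carrier X"
    "\<And>a a' b. \<lbrakk>a \<in> carrier A; a' \<in> carrier A; b \<in> carrier B\<rbrakk> \<Longrightarrow> g (a \<oplus>\<^bsub>A\<^esub> a', b) = g (a, b) \<oplus>\<^bsub>X\<^esub> g (a', b)"
    "\<And>a b b'. \<lbrakk>a \<in> carrier A; b \<in> carrier B; b' \<in> carrier B\<rbrakk> \<Longrightarrow> g (a, b \<oplus>\<^bsub>B\<^esub> b') = g (a, b) \<oplus>\<^bsub>X\<^esub> g (a, b')"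
    "\<And>c a b. \<lbrakk>c \<in> carrier K; a \<in> carrier A; b \<in> carrier B\<rbrakk> \<Longrightarrow> g (c \<odot>\<^bsub>A\<^esub> a, b) = c \<odot>\<^bsub>X\<^esub> g (a, b)"
    "\<And>c a b. \<lbrakk>c \<in> carrier K; a \<in> carrier A; b \<in> carrier B\<rbrakk> \<Longrightarrow> g (a, c \<odot>\<^bsub>B\<^esub> b) = c \<odot>\<^bsub>X\<^esub> g (a, b)"
  shows "bilin K A B X g"
  using assms unfolding bilin_def mod_hom_def by blast

lemma assoc_algebra_left_module:
  assumes "assoc_algebra K A"
  shows "left_module K A"
proof -
  interpret assoc_algebra K A by fact
  show ?thesis
    by (intro left_module.intro left_module_axioms.intro)
      (auto simp: smult_l_distr smult_r_distr smult_assoc1 intro: R.ring_axioms M.abelian_group_axioms)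
qed

text \<open>The kernel of a single linear extension need not be an ideal. In a family closed under
  translation of the argument, multiplication by a basis element turns \<open>g\<close> into another
  member, so the common kernel absorbs products on both sides.\<close>

lemma (in monoid_alg) lin_ext_kernel_ideal:
  assumes X: "left_module K X" and S: "\<And>g. g \<in> S \<Longrightarrow> g \<in> carrier G \<rightarrow> carrier X"
    and S_mult: "\<And>g x. \<lbrakk>g \<in> S; x \<in> carrier G\<rbrakk> \<Longrightarrow> (\<lambda>y. g (x \<otimes>\<^bsub>G\<^esub> y)) \<in> S"
      "\<And>g x. \<lbrakk>g \<in> S; x \<in> carrier G\<rbrakk> \<Longrightarrow> (\<lambda>y. g (y \<otimes>\<^bsub>G\<^esub> x)) \<in> S"
  shows "ideal {f \<in> carrier F. \<forall>g\<in>S. lin_ext K X g f = \<zero>\<^bsub>X\<^esub>} F"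
proof -
  interpret X: left_module K X by fact
  interpret FR: ring F by (rule F_ring)
  let ?J = "{f \<in> carrier F. \<forall>g\<in>S. lin_ext K X g f = \<zero>\<^bsub>X\<^esub>}"
  have L: "lin_ext K X g \<in> mod_hom K F X" if "g \<in> S" for g
    by (rule Fr.lin_ext_mod_hom[OF X S[OF that]])
  note La = mod_hom_add_hom[OF L]
  have L0: "lin_ext K X g \<zero>\<^bsub>F\<^esub> = \<zero>\<^bsub>X\<^esub>" if "g \<in> S" for g
    by (rule add_hom_zero[OF FM.M.abelian_group_axioms X.M.abelian_group_axioms La[OF that]])
  have Lb: "lin_ext K X g (\<delta> x) = g x" if "g \<in> S" "x \<in> carrier G" for g x
    by (rule Fr.lin_ext_basis[OF X S[OF that(1)] that(2)])
  have left: "lin_ext K X g (\<delta> x \<star> f) = lin_ext K X (\<lambda>y. g (x \<otimes>\<^bsub>G\<^esub> y)) f"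
    if g: "g \<in> S" and x: "x \<in> carrier G" and f: "f \<in> carrier F" for g x f
    using Fr.free_hom_ext[OF X mod_hom_comp[OF F_mult_right_hom[OF Fr.basis_closed[OF x]] L[OF g]]
        L[OF S_mult(1)[OF g x]] _ f] x
    by (simp add: basis_mult Lb[OF g] Lb[OF S_mult(1)[OF g x]])
  have right: "lin_ext K X g (f \<star> \<delta> x) = lin_ext K X (\<lambda>y. g (y \<otimes>\<^bsub>G\<^esub> x)) f"
    if g: "g \<in> S" and x: "x \<in> carrier G" and f: "f \<in> carrier F" for g x f
    using Fr.free_hom_ext[OF X mod_hom_comp[OF F_mult_left_hom[OF Fr.basis_closed[OF x]] L[OF g]]
        L[OF S_mult(2)[OF g x]] _ f] x
    by (simp add: basis_mult Lb[OF g] Lb[OF S_mult(2)[OF g x]])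
  show ?thesis
  proof (rule idealI[OF F_ring])
    show "subgroup ?J (add_monoid F)"
    proof (rule FM.M.add.subgroupI)
      show "?J \<noteq> {}" using L0 FM.M.zero_closed by blast
    qed (auto simp: add_hom_inv[OF FM.M.abelian_group_axioms X.M.abelian_group_axioms La]
        add_hom_add[OF La])
    fix f p assume f: "f \<in> ?J" and p: "p \<in> carrier F"
    then have fF: "f \<in> carrier F" by simp
    have z: "(\<lambda>_. \<zero>\<^bsub>X\<^esub>) \<in> mod_hom K F X" by (auto simp: mod_hom_def X.smult_zero)
    have "lin_ext K X g (p \<star> f) = \<zero>\<^bsub>X\<^esub>" "lin_ext K X g (f \<star> p) = \<zero>\<^bsub>X\<^esub>" if g: "g \<in> S" for g
      using f S_mult g
        Fr.free_hom_ext[OF X mod_hom_comp[OF F_mult_left_hom[OF fF] L[OF g]] z _ p]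
        Fr.free_hom_ext[OF X mod_hom_comp[OF F_mult_right_hom[OF fF] L[OF g]] z _ p]
      by (simp_all add: left[OF g _ fF] right[OF g _ fF])
    then show "p \<star> f \<in> ?J" "f \<star> p \<in> ?J" using F_mult_closed p fF by simp_all
  qed
qed

section \<open>The tensor product of two algebras and its universal property\<close>

locale tensor =
  fixes K :: "('k, 'z) ring_scheme" (structure) and A :: "('k, 'a, 'x) graded_scheme" and B :: "('k, 'b, 'y) graded_scheme"
  assumes algebra_A: "assoc_algebra K A" and algebra_B: "assoc_algebra K B"
begin

sublocale K: cring K
  using algebra_A by (simp add: assoc_algebra_def Module.module_def)

sublocale Al: left_module K A by (rule assoc_algebra_left_module[OF algebra_A])

sublocale Bl: left_module K B by (rule assoc_algebra_left_module[OF algebra_B])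

sublocale Ar: ring A using algebra_A by (simp add: assoc_algebra_def)

sublocale Br: ring B using algebra_B by (simp add: assoc_algebra_def)

lemmas A_smult_mult = assoc_algebra.smult_mult_left[OF algebra_A] assoc_algebra.smult_mult_right[OF algebra_A]
lemmas B_smult_mult = assoc_algebra.smult_mult_left[OF algebra_B] assoc_algebra.smult_mult_right[OF algebra_B]

definition W :: "int \<Rightarrow> ('a \<times> 'b) set" where "W n = (\<Union>i. hpart A i \<times> hpart B (n - i))"

sublocale MA: monoid_alg K "A \<times>\<times> B" W
  by (intro monoid_alg.intro K.is_cring DirProd_monoid Ar.monoid_axioms Br.monoid_axioms)

lemma F_pairs: "pairs_algebra K A B = MA.F"
  by (simp add: pairs_algebra_def W_def[abs_def])

abbreviation "FF \<equiv> MA.F"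
abbreviation "\<delta> \<equiv> basis_elem K"
abbreviation "I \<equiv> Idl\<^bsub>FF\<^esub> (bilinear_relations K A B)"
abbreviation "coset f \<equiv> I +>\<^bsub>FF\<^esub> f"
abbreviation "T \<equiv> tensor_product K A B"

lemma T_def: "T = quot FF I"
  by (simp add: tensor_product_def F_pairs)

sublocale FR: ring FF by (rule MA.F_ring)

lemma delta_closed: "\<lbrakk>a \<in> carrier A; b \<in> carrier B\<rbrakk> \<Longrightarrow> \<delta> (a, b) \<in> carrier FF"
  by (rule MA.Fr.basis_closed) simp

lemmas bilinear_relations_eq = bilinear_relations_def[of K A B, unfolded Let_def F_pairs]

lemma relations_closed: "bilinear_relations K A B \<subseteq> carrier FF"
  unfolding bilinear_relations_eq
  by (auto intro!: MA.FM.M.minus_closed MA.FM.M.a_closed delta_closed MA.FM.smult_closed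
      Al.smult_closed Bl.smult_closed)

lemma I_ideal: "ideal I FF"
  by (rule FR.genideal_ideal[OF relations_closed])

lemma relation_I: "r \<in> bilinear_relations K A B \<Longrightarrow> r \<in> I"
  using FR.genideal_self[OF relations_closed] by blast

sublocale Q: quotient_group FF I
  by (intro quotient_group.intro quotient_group_axioms.intro MA.FM.M.abelian_group_axioms ideal.axioms(1)[OF I_ideal])

definition tens :: "'a \<Rightarrow> 'b \<Rightarrow> ('a \<times> 'b \<Rightarrow> 'k) set" where
  "tens a b = coset (\<delta> (a, b))"

lemma T_ring: "ring T"
proof (rule ring_cong[OF _ _ _ _ _ ideal.quotient_is_ring[OF I_ideal]])
qed (simp_all add: T_def quot_def)

sublocale Tr: ring T by (rule T_ring)

lemma T_carrier: "carrier T = coset ` carrier FF"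
  unfolding T_def by (rule quot_carrier)

lemma T_add: "\<lbrakk>f \<in> carrier FF; g \<in> carrier FF\<rbrakk> \<Longrightarrow>
    coset f \<oplus>\<^bsub>T\<^esub> coset g = coset (f \<oplus>\<^bsub>FF\<^esub> g)"
  unfolding T_def by (rule Q.quot_add)

lemma T_mult: "\<lbrakk>f \<in> carrier FF; g \<in> carrier FF\<rbrakk> \<Longrightarrow>
    coset f \<otimes>\<^bsub>T\<^esub> coset g = coset (f \<otimes>\<^bsub>FF\<^esub> g)"
  using ideal.rcoset_mult_add[OF I_ideal] by (simp add: T_def quot_def FactRing_def)

lemma T_zero: "\<zero>\<^bsub>T\<^esub> = coset \<zero>\<^bsub>FF\<^esub>"
  unfolding T_def by (rule Q.quot_zero)

lemma T_one: "\<one>\<^bsub>T\<^esub> = tens \<one>\<^bsub>A\<^esub> \<one>\<^bsub>B\<^esub>"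
  by (simp add: T_def quot_def FactRing_def tens_def MA.F_one)

text \<open>Scalars act through multiples of the unit, so an ideal is automatically a
  subspace.\<close>

lemma I_smult:
  assumes c: "c \<in> carrier K" and f: "f \<in> I"
  shows "c \<odot>\<^bsub>FF\<^esub> f \<in> I"
proof -
  have fF: "f \<in> carrier FF" by (rule Q.I_subset[OF f])
  have "c \<odot>\<^bsub>FF\<^esub> f = c \<odot>\<^bsub>FF\<^esub> (\<one>\<^bsub>FF\<^esub> \<otimes>\<^bsub>FF\<^esub> f)" using fF by simp
  also have "\<dots> = (c \<odot>\<^bsub>FF\<^esub> \<one>\<^bsub>FF\<^esub>) \<otimes>\<^bsub>FF\<^esub> f"
    using mod_hom_smult[OF MA.F_mult_left_hom[OF fF] c FR.one_closed] by simp
  finally show ?thesis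
    using ideal.I_l_closed[OF I_ideal f MA.FM.smult_closed[OF c FR.one_closed]] by simp
qed

lemma T_smult: "\<lbrakk>c \<in> carrier K; f \<in> carrier FF\<rbrakk> \<Longrightarrow>
    c \<odot>\<^bsub>T\<^esub> coset f = coset (c \<odot>\<^bsub>FF\<^esub> f)"
  unfolding T_def by (rule Q.quot_smult[OF MA.FM.smult_add_hom I_smult])

lemma T_left_module: "left_module K T"
  by (rule left_module_image[where f = coset, OF MA.FM.left_module_axioms T_carrier T_zero]) (simp_all add: T_add T_smult)

sublocale Tl: left_module K T by (rule T_left_module)

lemma tens_closed: "\<lbrakk>a \<in> carrier A; b \<in> carrier B\<rbrakk> \<Longrightarrow> tens a b \<in> carrier T"
  by (auto simp: tens_def T_carrier delta_closed)

lemma tens_mult: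
  "\<lbrakk>a \<in> carrier A; b \<in> carrier B; a' \<in> carrier A; b' \<in> carrier B\<rbrakk> \<Longrightarrow>
    tens a b \<otimes>\<^bsub>T\<^esub> tens a' b' = tens (a \<otimes>\<^bsub>A\<^esub> a') (b \<otimes>\<^bsub>B\<^esub> b')"
  by (simp add: tens_def T_mult delta_closed MA.basis_mult)

lemma tens_bilin: "bilin K A B T (\<lambda>(a, b). tens a b)"
proof (rule bilinI; unfold prod.case)
  have rel: "coset f = coset g" if "f \<ominus>\<^bsub>FF\<^esub> g \<in> bilinear_relations K A B" "f \<in> carrier FF" "g \<in> carrier FF"
    for f g
    using Q.coset_eq[OF that(2,3)] relation_I[OF that(1)] by simp
  show "tens a b \<in> carrier T" if "a \<in> carrier A" "b \<in> carrier B" for a b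
    by (rule tens_closed[OF that])
  show "tens (a \<oplus>\<^bsub>A\<^esub> a') b = tens a b \<oplus>\<^bsub>T\<^esub> tens a' b" if "a \<in> carrier A" "a' \<in> carrier A" "b \<in> carrier B" for a a' b
    unfolding tens_def T_add[OF delta_closed[OF that(1,3)] delta_closed[OF that(2,3)]]
    using that by (intro rel) (auto simp: bilinear_relations_eq delta_closed)
  show "tens a (b \<oplus>\<^bsub>B\<^esub> b') = tens a b \<oplus>\<^bsub>T\<^esub> tens a b'" if "a \<in> carrier A" "b \<in> carrier B" "b' \<in> carrier B" for a b b'
    unfolding tens_def T_add[OF delta_closed[OF that(1,2)] delta_closed[OF that(1,3)]]
    using that by (intro rel) (auto simp: bilinear_relations_eq delta_closed)
  show "tens (c \<odot>\<^bsub>A\<^esub> a) b = c \<odot>\<^bsub>T\<^esub> tens a b" if "c \<in> carrier K" "a \<in> carrier A" "b \<in> carrier B" for c a b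
    unfolding tens_def T_smult[OF that(1) delta_closed[OF that(2,3)]]
    using that by (intro rel) (auto simp: bilinear_relations_eq delta_closed Al.smult_closed MA.FM.smult_closed)
  show "tens a (c \<odot>\<^bsub>B\<^esub> b) = c \<odot>\<^bsub>T\<^esub> tens a b" if "c \<in> carrier K" "a \<in> carrier A" "b \<in> carrier B" for c a b
    unfolding tens_def T_smult[OF that(1) delta_closed[OF that(2,3)]]
    using that by (intro rel) (auto simp: bilinear_relations_eq delta_closed Bl.smult_closed MA.FM.smult_closed)
qed

lemmas tensD = bilinD[OF tens_bilin, unfolded prod.case]

text \<open>Scalars can be absorbed into the first factor, so sums of pure tensors exhaust
  \<open>T\<close>.\<close>

lemma T_induct [consumes 1, case_names zero add]:
  assumes "t \<in> carrier T" "P \<zero>\<^bsub>T\<^esub>"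
    and step: "\<And>t a b. \<lbrakk>t \<in> carrier T; P t; a \<in> carrier A; b \<in> carrier B\<rbrakk> \<Longrightarrow> P (t \<oplus>\<^bsub>T\<^esub> tens a b)"
  shows "P t"
proof -
  obtain f where f: "f \<in> carrier FF" "t = coset f" using assms(1) by (auto simp: T_carrier)
  from f(1) have "P (coset f)"
  proof (induction rule: MA.Fr.free_induct)
    case zero
    show ?case using assms(2) by (simp add: T_zero)
  next
    case (step p x r)
    obtain a b where x: "x = (a, b)" "a \<in> carrier A" "b \<in> carrier B" using step.hyps(2) by auto
    have "coset (p \<oplus>\<^bsub>FF\<^esub> r \<odot>\<^bsub>FF\<^esub> \<delta> x) = coset p \<oplus>\<^bsub>T\<^esub> tens (r \<odot>\<^bsub>A\<^esub> a) b"
      using step.hyps x by (simp add: T_add[symmetric] T_smult[symmetric] delta_closed MA.FM.smult_closed tensD tens_def[symmetric])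
    then show ?case using step x assms(3) by (simp add: T_carrier Al.smult_closed)
  qed
  then show ?thesis using f by simp
qed

text \<open>The relations generate a two-sided ideal, so their products have to be killed as well.
  Translating the argument of a bilinear map gives a bilinear map again; hence the common kernel of
  all bilinear maps into \<open>X\<close> is an ideal, and it contains the relations.\<close>

lemma lift_relation:
  assumes X: "left_module K X" and g: "bilin K A B X g" and f: "f \<in> I"
  shows "lin_ext K X g f = \<zero>\<^bsub>X\<^esub>"
proof -
  interpret X: left_module K X by fact
  let ?S = "{g. bilin K A B X g}"
  let ?J = "{f \<in> carrier FF. \<forall>g\<in>?S. lin_ext K X g f = \<zero>\<^bsub>X\<^esub>}"
  have S: "g \<in> carrier (A \<times>\<times> B) \<rightarrow> carrier X" if "g \<in> ?S" for g
    using that by (auto simp: bilinD(1)[of K A B X g])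
  have J: "ideal ?J FF"
  proof (rule MA.lin_ext_kernel_ideal[OF X S])
    fix g x assume g: "g \<in> ?S" and x: "x \<in> carrier (A \<times>\<times> B)"
    from g have "bilin K A B X g" by simp
    note gD = bilinD[OF this]
    obtain a b where ab: "x = (a, b)" "a \<in> carrier A" "b \<in> carrier B" using x by auto
    show "(\<lambda>y. g (x \<otimes>\<^bsub>A \<times>\<times> B\<^esub> y)) \<in> ?S" unfolding mem_Collect_eq
      by (rule bilinI) (simp_all add: ab gD Ar.r_distr Br.r_distr A_smult_mult B_smult_mult Al.smult_closed Bl.smult_closed)
    show "(\<lambda>y. g (y \<otimes>\<^bsub>A \<times>\<times> B\<^esub> x)) \<in> ?S" unfolding mem_Collect_eq
      by (rule bilinI) (simp_all add: ab gD Ar.l_distr Br.l_distr A_smult_mult B_smult_mult Al.smult_closed Bl.smult_closed)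
  qed
  have "bilinear_relations K A B \<subseteq> ?J"
  proof
    fix r assume r: "r \<in> bilinear_relations K A B"
    have "lin_ext K X g r = \<zero>\<^bsub>X\<^esub>" if g: "bilin K A B X g" for g
    proof -
      note gD = bilinD[OF g]
      have gS: "g \<in> carrier (A \<times>\<times> B) \<rightarrow> carrier X" using S g by simp
      note L = MA.Fr.lin_ext_mod_hom[OF X gS]
      note Lb = MA.Fr.lin_ext_basis[OF X gS]
      have Lm: "lin_ext K X g (p \<ominus>\<^bsub>FF\<^esub> q) = lin_ext K X g p \<ominus>\<^bsub>X\<^esub> lin_ext K X g q"
        if "p \<in> carrier FF" "q \<in> carrier FF" for p q
        by (rule add_hom_minus[OF MA.FM.M.abelian_group_axioms X.M.abelian_group_axioms mod_hom_add_hom[OF L] that])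
      show ?thesis
        using r unfolding bilinear_relations_eq
        by (auto simp: Lm Lb mod_hom_add[OF L] mod_hom_smult[OF L] gD delta_closed Al.smult_closed
            Bl.smult_closed MA.FM.smult_closed a_minus_def[of X] X.M.r_neg X.smult_closed)
    qed
    then show "r \<in> ?J" using relations_closed r by blast
  qed
  then have "I \<subseteq> ?J" by (rule FR.genideal_minimal[OF J])
  then show ?thesis using f g by blast
qed

text \<open>All members of a coset give the same value, which is what the definite description in
  \<open>tensor_lift\<close> relies on.\<close>

lemma tensor_lift_coset:
  assumes X: "left_module K X" and g: "bilin K A B X g" and f: "f \<in> carrier FF"
  shows "tensor_lift K X g (coset f) = lin_ext K X g f"
proof -
  interpret X: left_module K X by fact
  have gS: "g \<in> carrier (A \<times>\<times> B) \<rightarrow> carrier X" by (auto simp: bilinD(1)[OF g])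
  note L = MA.Fr.lin_ext_mod_hom[OF X gS]
  have eq: "lin_ext K X g f' = lin_ext K X g f" if f': "f' \<in> coset f" for f'
  proof -
    obtain h where h: "h \<in> I" "f' = h \<oplus>\<^bsub>FF\<^esub> f" using f' by (auto simp: a_r_coset_def')
    then show ?thesis
      using mod_hom_add[OF L Q.I_subset[OF h(1)] f] lift_relation[OF X g h(1)] mod_hom_closed[OF L f] by simp
  qed
  have f_mem: "f \<in> coset f"
    using additive_subgroup.zero_closed[OF Q.I_subgroup] f by (force simp: a_r_coset_def')
  show ?thesis
    unfolding tensor_lift_def lin_ext_def[symmetric]
    by (rule the_equality) (use f_mem eq in blast)+
qed

lemma tensor_lift_hom:
  assumes X: "left_module K X" and g: "bilin K A B X g"
  shows "tensor_lift K X g \<in> mod_hom K T X"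
    and "\<lbrakk>a \<in> carrier A; b \<in> carrier B\<rbrakk> \<Longrightarrow> tensor_lift K X g (tens a b) = g (a, b)"
proof -
  have gS: "g \<in> carrier (A \<times>\<times> B) \<rightarrow> carrier X" by (auto simp: bilinD(1)[OF g])
  note L = MA.Fr.lin_ext_mod_hom[OF X gS]
  show "tensor_lift K X g \<in> mod_hom K T X"
    by (rule mod_homI)
      (auto simp: T_carrier T_add T_smult tensor_lift_coset[OF X g] mod_homD[OF L] MA.FM.smult_closed)
  show "tensor_lift K X g (tens a b) = g (a, b)" if "a \<in> carrier A" "b \<in> carrier B"
    using that MA.Fr.lin_ext_basis[OF X gS, of "(a, b)"]
    by (simp add: tens_def tensor_lift_coset[OF X g] delta_closed)
qed

end

section \<open>The grading of a tensor product\<close>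

text \<open>For the projections of a tensor product to one degree, which are sums over the bidegrees
  with that total.\<close>

lemma bilin_finsum:
  assumes X: "left_module K X" and fin: "finite J" and g: "\<And>i. i \<in> J \<Longrightarrow> bilin K A B X (g i)"
  shows "bilin K A B X (\<lambda>p. \<Oplus>\<^bsub>X\<^esub>i\<in>J. g i p)"
proof -
  interpret X: left_module K X by fact
  note gD = bilinD[OF g]
  show ?thesis
  proof (rule bilinI)
    show "(\<Oplus>\<^bsub>X\<^esub>i\<in>J. g i (a, b)) \<in> carrier X" if "a \<in> carrier A" "b \<in> carrier B" for a b
      using gD(1) that by (intro X.M.finsum_closed) auto
    show "(\<Oplus>\<^bsub>X\<^esub>i\<in>J. g i (a \<oplus>\<^bsub>A\<^esub> a', b)) = (\<Oplus>\<^bsub>X\<^esub>i\<in>J. g i (a, b)) \<oplus>\<^bsub>X\<^esub> (\<Oplus>\<^bsub>X\<^esub>i\<in>J. g i (a', b))"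
      if "a \<in> carrier A" "a' \<in> carrier A" "b \<in> carrier B" for a a' b
    proof -
      have "(\<Oplus>\<^bsub>X\<^esub>i\<in>J. g i (a \<oplus>\<^bsub>A\<^esub> a', b)) = (\<Oplus>\<^bsub>X\<^esub>i\<in>J. g i (a, b) \<oplus>\<^bsub>X\<^esub> g i (a', b))"
        using that by (intro X.M.finsum_cong' refl) (auto simp: gD)
      then show ?thesis using that by (simp add: X.M.finsum_addf Pi_def gD(1))
    qed
    show "(\<Oplus>\<^bsub>X\<^esub>i\<in>J. g i (a, b \<oplus>\<^bsub>B\<^esub> b')) = (\<Oplus>\<^bsub>X\<^esub>i\<in>J. g i (a, b)) \<oplus>\<^bsub>X\<^esub> (\<Oplus>\<^bsub>X\<^esub>i\<in>J. g i (a, b'))"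
      if "a \<in> carrier A" "b \<in> carrier B" "b' \<in> carrier B" for a b b'
    proof -
      have "(\<Oplus>\<^bsub>X\<^esub>i\<in>J. g i (a, b \<oplus>\<^bsub>B\<^esub> b')) = (\<Oplus>\<^bsub>X\<^esub>i\<in>J. g i (a, b) \<oplus>\<^bsub>X\<^esub> g i (a, b'))"
        using that by (intro X.M.finsum_cong' refl) (auto simp: gD)
      then show ?thesis using that by (simp add: X.M.finsum_addf Pi_def gD(1))
    qed
    show "(\<Oplus>\<^bsub>X\<^esub>i\<in>J. g i (c \<odot>\<^bsub>A\<^esub> a, b)) = c \<odot>\<^bsub>X\<^esub> (\<Oplus>\<^bsub>X\<^esub>i\<in>J. g i (a, b))"
      if "c \<in> carrier K" "a \<in> carrier A" "b \<in> carrier B" for c a b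
      using that gD(1)
      by (subst add_hom_finsum[OF X.M.abelian_group_axioms X.M.abelian_group_axioms X.smult_add_hom fin])
        (auto intro!: X.M.finsum_cong' X.smult_closed simp: gD(4))
    show "(\<Oplus>\<^bsub>X\<^esub>i\<in>J. g i (a, c \<odot>\<^bsub>B\<^esub> b)) = c \<odot>\<^bsub>X\<^esub> (\<Oplus>\<^bsub>X\<^esub>i\<in>J. g i (a, b))"
      if "c \<in> carrier K" "a \<in> carrier A" "b \<in> carrier B" for c a b
      using that gD(1)
      by (subst add_hom_finsum[OF X.M.abelian_group_axioms X.M.abelian_group_axioms X.smult_add_hom fin])
        (auto intro!: X.M.finsum_cong' X.smult_closed simp: gD(5))
  qed
qed

lemma nat_graded_algebraD:
  assumes "nat_graded_algebra K A"
  shows "assoc_algebra K A" "direct_graded_group A" "i < 0 \<Longrightarrow> hpart A i = {\<zero>\<^bsub>A\<^esub>}"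
    "\<one>\<^bsub>A\<^esub> \<in> hpart A 0" "\<lbrakk>x \<in> hpart A i; y \<in> hpart A j\<rbrakk> \<Longrightarrow> x \<otimes>\<^bsub>A\<^esub> y \<in> hpart A (i + j)"
    "\<lbrakk>c \<in> carrier K; x \<in> hpart A i\<rbrakk> \<Longrightarrow> c \<odot>\<^bsub>A\<^esub> x \<in> hpart A i"
proof -
  interpret nat_graded_algebra K A by fact
  show "assoc_algebra K A" by (rule assoc_algebra_axioms)
  show "direct_graded_group A" by (intro direct_graded_group.intro abelian_group_axioms direct_grading_axioms)
  show "i < 0 \<Longrightarrow> hpart A i = {\<zero>\<^bsub>A\<^esub>}" by (rule hpart_neg)
  show "\<one>\<^bsub>A\<^esub> \<in> hpart A 0" by (rule hpart_one)
  show "\<lbrakk>x \<in> hpart A i; y \<in> hpart A j\<rbrakk> \<Longrightarrow> x \<otimes>\<^bsub>A\<^esub> y \<in> hpart A (i + j)" by (rule hpart_mult)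
  show "\<lbrakk>c \<in> carrier K; x \<in> hpart A i\<rbrakk> \<Longrightarrow> c \<odot>\<^bsub>A\<^esub> x \<in> hpart A i"
    using hpart_subspace by (rule submodule.smult_closed)
qed

lemma nat_graded_hcomp_smult:
  assumes A: "nat_graded_algebra K A" and c: "c \<in> carrier K" and a: "a \<in> carrier A"
  shows "hcomp A (c \<odot>\<^bsub>A\<^esub> a) i = c \<odot>\<^bsub>A\<^esub> hcomp A a i"
proof -
  interpret left_module K A by (rule assoc_algebra_left_module[OF nat_graded_algebraD(1)[OF A]])
  show ?thesis
    using hcomp_map[OF nat_graded_algebraD(2)[OF A] nat_graded_algebraD(2)[OF A] smult_add_hom[OF c], of 0 a i]
      nat_graded_algebraD(6)[OF A c] a by simp
qed

locale graded_tensor =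
  fixes K :: "('k, 'z) ring_scheme" (structure) and A :: "('k, 'a, 'x) graded_scheme" and B :: "('k, 'b, 'y) graded_scheme"
  assumes graded_A: "nat_graded_algebra K A" and graded_B: "nat_graded_algebra K B"

sublocale graded_tensor \<subseteq> tensor
  by (intro tensor.intro nat_graded_algebraD(1) graded_A graded_B)

context graded_tensor
begin

sublocale GA: direct_graded_group A by (rule nat_graded_algebraD(2)[OF graded_A])
sublocale GB: direct_graded_group B by (rule nat_graded_algebraD(2)[OF graded_B])

lemma F_hpart: "f \<in> hpart FF n \<longleftrightarrow> f \<in> carrier FF \<and> (\<forall>x. f x \<noteq> \<zero> \<longrightarrow> x \<in> W n)"
  by (auto simp: MA.F_hpart)

lemma T_hpart: "hpart T n = coset ` hpart FF n"
  unfolding T_def by (rule quot_hpart)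

lemma F_hpart_subgroup: "additive_subgroup (hpart FF n) FF"
proof (intro additive_subgroupI MA.FM.M.add.subgroupI)
  show "hpart FF n \<subseteq> carrier FF" by (auto simp: F_hpart)
  have "\<zero>\<^bsub>FF\<^esub> \<in> hpart FF n" using MA.Fr.F_zero_closed by (simp add: F_hpart MA.Fr.zero_F)
  then show "hpart FF n \<noteq> {}" by blast
  show "\<ominus>\<^bsub>FF\<^esub> f \<in> hpart FF n" if f: "f \<in> hpart FF n" for f
  proof -
    have fF: "f \<in> carrier FF" using f by (simp add: F_hpart)
    have "(\<ominus>\<^bsub>FF\<^esub> f) x = \<ominus> f x" for x
    proof -
      have "(\<lambda>f. f x) \<in> add_hom FF K" by (auto simp: add_hom_def MA.Fr.add_F MA.Fr.F_closed)
      from add_hom_inv[OF MA.FM.M.abelian_group_axioms K.abelian_group_axioms this fF] show ?thesis .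
    qed
    then show ?thesis using f MA.FM.M.a_inv_closed[OF fF] by (auto simp: F_hpart) (metis K.minus_zero_eq)
  qed
  show "f \<oplus>\<^bsub>FF\<^esub> g \<in> hpart FF n" if "f \<in> hpart FF n" "g \<in> hpart FF n" for f g
  proof -
    have "f x \<noteq> \<zero> \<or> g x \<noteq> \<zero>" if "(f \<oplus>\<^bsub>FF\<^esub> g) x \<noteq> \<zero>" for x
      using that by (auto simp: MA.Fr.add_F)
    then show ?thesis using that MA.Fr.F_add_closed[of f g] unfolding F_hpart by blast
  qed
qed

lemma coset_add_hom: "coset \<in> add_hom FF T"
  by (auto simp: add_hom_def T_carrier T_add)

lemma T_graded_group: "graded_group T"
  unfolding graded_group_def graded_group_axioms_def T_hpart
  using additive_subgroup_image[OF MA.FM.M.abelian_group_axioms Tr.abelian_group_axioms F_hpart_subgroup coset_add_hom]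
    Tr.abelian_group_axioms by blast

sublocale GT: graded_group T by (rule T_graded_group)

lemma tens_hpart:
  assumes "a \<in> hpart A i" "b \<in> hpart B j"
  shows "tens a b \<in> hpart T (i + j)"
proof -
  have "(a, b) \<in> hpart A i \<times> hpart B (i + j - i)" using assms by simp
  then have "(a, b) \<in> W (i + j)" unfolding W_def by blast
  then have "\<delta> (a, b) \<in> hpart FF (i + j)"
    using delta_closed assms GA.hpart_closed GB.hpart_closed by (auto simp: F_hpart basis_elem_def)
  then show ?thesis by (auto simp: T_hpart tens_def)
qed

text \<open>The degree \<open>n\<close> part of the pairs algebra is itself free, on the pairs of
  total degree \<open>n\<close>, so the induction can stay inside one degree.\<close>

lemma T_hpart_induct [consumes 1, case_names zero add]:
  assumes t: "t \<in> hpart T n" and zero: "P \<zero>\<^bsub>T\<^esub>"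
    and step: "\<And>t i a b. \<lbrakk>t \<in> hpart T n; P t; a \<in> hpart A i; b \<in> hpart B (n - i)\<rbrakk> \<Longrightarrow> P (t \<oplus>\<^bsub>T\<^esub> tens a b)"
  shows "P t"
proof -
  define F' where "F' = FF\<lparr>carrier := hpart FF n\<rparr>"
  let ?X = "W n \<inter> carrier (A \<times>\<times> B)"
  have "hpart FF n = fin_supp K ?X"
    by (auto simp: F_hpart MA.Fr.carrier_F fin_supp_def)
  then have "free_left_module K F' ?X"
    by (intro free_left_module.intro free_left_module_axioms.intro K.ring_axioms)
      (simp_all add: F'_def MA.Fr.zero_F MA.Fr.add_F MA.Fr.smult_F)
  then interpret F': free_left_module K F' ?X .
  have F'_ops: "\<zero>\<^bsub>F'\<^esub> = \<zero>\<^bsub>FF\<^esub>" "p \<oplus>\<^bsub>F'\<^esub> q = p \<oplus>\<^bsub>FF\<^esub> q" "r \<odot>\<^bsub>F'\<^esub> p = r \<odot>\<^bsub>FF\<^esub> p"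
    "carrier F' = hpart FF n" for p q r
    by (simp_all add: F'_def)
  obtain f where f: "f \<in> hpart FF n" "t = coset f" using t by (auto simp: T_hpart)
  from f(1) have "f \<in> carrier F'" by (simp add: F'_def)
  then have "P (coset f)"
  proof (induction rule: F'.free_induct)
    case zero
    show ?case using assms(2) by (simp add: T_zero F'_ops)
  next
    case (step p x r)
    have p: "p \<in> hpart FF n" "p \<in> carrier FF" using step.hyps by (simp_all add: F'_ops F_hpart)
    obtain i a b where x: "x = (a, b)" "a \<in> hpart A i" "b \<in> hpart B (n - i)"
      using step.hyps(2) by (auto simp: W_def)
    note ab = GA.hpart_closed[OF x(2)] GB.hpart_closed[OF x(3)]
    have "coset (p \<oplus>\<^bsub>FF\<^esub> r \<odot>\<^bsub>FF\<^esub> \<delta> x) = coset p \<oplus>\<^bsub>T\<^esub> tens (r \<odot>\<^bsub>A\<^esub> a) b"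
      using step.hyps(3) p x(1) ab
      by (simp add: T_add[symmetric] T_smult[symmetric] delta_closed MA.FM.smult_closed tensD tens_def[symmetric])
    moreover have "coset p \<in> hpart T n" using p by (auto simp: T_hpart)
    ultimately show ?case
      using assms(3)[of "coset p" "r \<odot>\<^bsub>A\<^esub> a" i b] step x nat_graded_algebraD(6)[OF graded_A]
      by (simp add: F'_ops)
  qed
  then show ?thesis using f by simp
qed

lemma tens_add_hom:
  shows "a \<in> carrier A \<Longrightarrow> (\<lambda>b. tens a b) \<in> add_hom B T" "b \<in> carrier B \<Longrightarrow> (\<lambda>a. tens a b) \<in> add_hom A T"
  by (auto simp: add_hom_def tensD)

lemma tens_zero: "a \<in> carrier A \<Longrightarrow> tens a \<zero>\<^bsub>B\<^esub> = \<zero>\<^bsub>T\<^esub>" "b \<in> carrier B \<Longrightarrow> tens \<zero>\<^bsub>A\<^esub> b = \<zero>\<^bsub>T\<^esub>"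
  using add_hom_zero[OF Bl.M.abelian_group_axioms Tr.abelian_group_axioms tens_add_hom(1)]
    add_hom_zero[OF Al.M.abelian_group_axioms Tr.abelian_group_axioms tens_add_hom(2)] by auto

text \<open>The summation range \<open>{0..n}\<close> suffices because \<open>A\<close> and \<open>B\<close> vanish in negative degrees.\<close>

definition comp_part :: "int \<Rightarrow> ('a \<times> 'b \<Rightarrow> 'k) set \<Rightarrow> ('a \<times> 'b \<Rightarrow> 'k) set" where
  "comp_part n = tensor_lift K T (\<lambda>p. \<Oplus>\<^bsub>T\<^esub>i\<in>{0..n}. tens (hcomp A (fst p) i) (hcomp B (snd p) (n - i)))"

lemma comp_part_bilin:
  "bilin K A B T (\<lambda>p. \<Oplus>\<^bsub>T\<^esub>i\<in>{0..n}. tens (hcomp A (fst p) i) (hcomp B (snd p) (n - i)))"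
  by (rule bilin_finsum[OF T_left_module]; (rule bilinI)?)
    (simp_all add: tensD GA.hcomp_closed GB.hcomp_closed GA.hcomp_add GB.hcomp_add
      nat_graded_hcomp_smult[OF graded_A] nat_graded_hcomp_smult[OF graded_B])

lemma comp_part_add_hom: "comp_part n \<in> add_hom T T"
  unfolding comp_part_def by (rule mod_hom_add_hom[OF tensor_lift_hom(1)[OF T_left_module comp_part_bilin]])

lemma comp_part_tens:
  assumes a: "a \<in> hpart A i" and b: "b \<in> hpart B j"
  shows "comp_part n (tens a b) = (if n = i + j then tens a b else \<zero>\<^bsub>T\<^esub>)"
proof -
  note ab = GA.hpart_closed[OF a] GB.hpart_closed[OF b]
  have eq: "comp_part n (tens a b) = (\<Oplus>\<^bsub>T\<^esub>l\<in>{0..n}. tens (hcomp A a l) (hcomp B b (n - l)))"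
    unfolding comp_part_def using tensor_lift_hom(2)[OF T_left_module comp_part_bilin ab] by simp
  have c: "tens (hcomp A a l) (hcomp B b (n - l)) = (if l = i \<and> n = i + j then tens a b else \<zero>\<^bsub>T\<^esub>)" for l
    using ab by (auto simp: GA.hcomp_homog[OF a] GB.hcomp_homog[OF b] tens_zero)
  show ?thesis
  \<comment> \<open>If \<open>n = i + j\<close> and one of \<open>i\<close>, \<open>j\<close> is
    negative, the index \<open>i\<close> lies outside \<open>{0..n}\<close>; but then
    \<open>a\<close> or \<open>b\<close> is zero and so is the tensor.\<close>
  proof (cases "n = i + j \<and> 0 \<le> i \<and> 0 \<le> j")
    case True
    then show ?thesis
      unfolding eq c using tens_closed[OF ab] by (subst Tr.finsum_single[of _ i]) auto
  next
    case False
    have "tens a b = \<zero>\<^bsub>T\<^esub>" if "i < 0 \<or> j < 0"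
      using that a b ab nat_graded_algebraD(3)[OF graded_A] nat_graded_algebraD(3)[OF graded_B]
      by (auto simp: tens_zero)
    with False have "(if l = i \<and> n = i + j then tens a b else \<zero>\<^bsub>T\<^esub>) = \<zero>\<^bsub>T\<^esub>"
      and "(if n = i + j then tens a b else \<zero>\<^bsub>T\<^esub>) = \<zero>\<^bsub>T\<^esub>" for l by auto
    then show ?thesis unfolding eq c by (simp add: Tr.finsum_zero)
  qed
qed

lemma comp_part_hpart: "t \<in> hpart T j \<Longrightarrow> comp_part n t = (if n = j then t else \<zero>\<^bsub>T\<^esub>)"
proof (induction rule: T_hpart_induct)
  case zero
  show ?case
    using add_hom_zero[OF Tr.abelian_group_axioms Tr.abelian_group_axioms comp_part_add_hom] by simp
next
  case (add t i a b)
  have "comp_part n (t \<oplus>\<^bsub>T\<^esub> tens a b) = comp_part n t \<oplus>\<^bsub>T\<^esub> comp_part n (tens a b)"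
    using add.hyps
    by (intro add_hom_add[OF comp_part_add_hom] GT.hpart_closed tens_closed GA.hpart_closed GB.hpart_closed)
  then show ?case
    using add.IH comp_part_tens[OF add.hyps(2,3)] by simp
qed

text \<open>Pure tensors are additive in each factor, so splitting first \<open>a\<close> and then
  \<open>b\<close> into components reduces to homogeneous factors.\<close>

lemma T_decomp: "t \<in> carrier T \<Longrightarrow> \<exists>c. homog_decomp T c t"
proof (induction rule: T_induct)
  case zero
  show ?case using GT.decomp_zero by blast
next
  case (add t a b)
  have "\<exists>c. homog_decomp T c (tens a b)"
    using add.hyps(2)
  proof (induction rule: GA.homog_induct)
    case zero
    show ?case using GT.decomp_zero add.hyps(3) by (auto simp: tens_zero)
  next
    case (add i a' a)
    have a: "a \<in> carrier A" by (rule GA.hpart_closed[OF add.hyps(2)])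
    have "\<exists>c. homog_decomp T c (tens a b)"
      using \<open>b \<in> carrier B\<close>
    proof (induction rule: GB.homog_induct)
      case zero
      show ?case using GT.decomp_zero a by (auto simp: tens_zero)
    next
      case (add j b' b)
      then obtain c where c: "homog_decomp T c (tens a b')" by blast
      have "homog_decomp T (\<lambda>l. if l = i + j then tens a b else \<zero>\<^bsub>T\<^esub>) (tens a b)"
        by (rule GT.decomp_homog[OF tens_hpart[OF \<open>a \<in> hpart A i\<close> \<open>b \<in> hpart B j\<close>]])
      from GT.decomp_add[OF this c] show ?case
        using a add.hyps GB.hpart_closed by (auto simp: tensD)
    qed
    then obtain c c' where "homog_decomp T c (tens a b)" "homog_decomp T c' (tens a' b)" using add.IH by blast
    from GT.decomp_add[OF this] show ?case
      using a add.hyps \<open>b \<in> carrier B\<close> by (auto simp: tensD)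
  qed
  then show ?case using add.IH GT.decomp_add by blast
qed

text \<open>A pair of inhomogeneous elements has no degree in the pairs algebra, so the grading is
  not simply that of a quotient by a homogeneous ideal. Uniqueness of components comes instead from
  the projections \<open>comp_part\<close>, which exist by the universal property.\<close>

lemma T_direct_grading: "direct_grading T"
  by (rule direct_gradingI[OF T_graded_group T_decomp comp_part_add_hom comp_part_hpart])

lemma T_hpart_mult:
  assumes s: "s \<in> hpart T m" and t: "t \<in> hpart T n"
  shows "s \<otimes>\<^bsub>T\<^esub> t \<in> hpart T (m + n)"
  using s
proof (induction rule: T_hpart_induct)
  case zero
  show ?case using GT.hpart_closed[OF t] GT.hpart_zero by simp
next
  case (add s i a b)
  note ab = GA.hpart_closed[OF add.hyps(2)] GB.hpart_closed[OF add.hyps(3)]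
  have "tens a b \<otimes>\<^bsub>T\<^esub> t \<in> hpart T (m + n)"
    using t
  proof (induction rule: T_hpart_induct)
    case zero
    show ?case using tens_closed[OF ab] GT.hpart_zero by simp
  next
    case (add t j a' b')
    note ab' = GA.hpart_closed[OF add.hyps(2)] GB.hpart_closed[OF add.hyps(3)]
    have "tens (a \<otimes>\<^bsub>A\<^esub> a') (b \<otimes>\<^bsub>B\<^esub> b') \<in> hpart T ((i + j) + ((m - i) + (n - j)))"
      using add.hyps \<open>a \<in> hpart A i\<close> \<open>b \<in> hpart B (m - i)\<close>
      by (intro tens_hpart nat_graded_algebraD(5)[OF graded_A] nat_graded_algebraD(5)[OF graded_B])
    then have "tens a b \<otimes>\<^bsub>T\<^esub> tens a' b' \<in> hpart T (m + n)"
      using ab ab' by (simp add: tens_mult algebra_simps)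
    then show ?case
      using add.IH GT.hpart_closed[OF add.hyps(1)] tens_closed[OF ab] tens_closed[OF ab']
      by (simp add: Tr.r_distr GT.hpart_add)
  qed
  then show ?case
    using add.IH GT.hpart_closed[OF add.hyps(1)] GT.hpart_closed[OF t] tens_closed[OF ab]
    by (simp add: Tr.l_distr GT.hpart_add)
qed

lemma T_graded_ring: "graded_ring T"
  by (intro graded_ring.intro graded_ring_axioms.intro T_ring T_direct_grading T_hpart_mult)

end

section \<open>The enveloping algebra\<close>

lemma opposite_simps [simp]:
  "carrier (opposite A) = carrier A" "zero (opposite A) = zero A" "one (opposite A) = one A"
  "add (opposite A) = add A" "smult (opposite A) = smult A" "hpart (opposite A) = hpart A"
  "x \<otimes>\<^bsub>opposite A\<^esub> y = y \<otimes>\<^bsub>A\<^esub> x"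
  by (simp_all add: opposite_def)

lemma opposite_nat_graded_algebra:
  assumes "nat_graded_algebra K A"
  shows "nat_graded_algebra K (opposite A)"
proof -
  interpret A: nat_graded_algebra K A by fact
  have ab: "abelian_group (opposite A)"
    by (rule abelian_group_cong[OF _ _ _ left_module.axioms(2)[OF assoc_algebra_left_module[OF A.assoc_algebra_axioms]]]) simp_all
  have ring: "ring (opposite A)"
    using ab by (intro ringI monoidI) (auto simp: A.m_assoc A.l_distr A.r_distr)
  have alg: "assoc_algebra K (opposite A)"
    using ab ring
    by (intro assoc_algebra.intro assoc_algebra_axioms.intro Module.module.intro module_axioms.intro A.is_cring)
      (auto simp: A.smult_l_distr A.smult_r_distr A.smult_assoc1 A.smult_mult_left A.smult_mult_right)
  have grad: "direct_grading (opposite A)"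
    by (rule direct_grading_cong[OF _ _ _ _ A.direct_grading_axioms]) simp_all
  have sub: "submodule (hpart (opposite A) i) K (opposite A)" for i
  proof -
    interpret G: graded_group "opposite A"
      using ab grad by (simp add: graded_group_def graded_group_axioms_def direct_grading_def)
    show ?thesis
      using submodule.smult_closed[OF A.hpart_subspace] G.hpart_subgroup[of i]
      by (intro submodule.intro submodule_axioms.intro) (auto simp: additive_subgroup_def)
  qed
  have "y \<otimes>\<^bsub>A\<^esub> x \<in> hpart A (i + j)" if "x \<in> hpart A i" "y \<in> hpart A j" for x y i j
    using A.hpart_mult[OF that(2,1)] by (simp add: add.commute)
  then show ?thesis
    using A.hpart_neg A.hpart_one sub
    by (intro nat_graded_algebra.intro nat_graded_algebra_axioms.intro A.field_axioms alg grad) auto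
qed

locale env_algebra =
  fixes K :: "('k, 'z) ring_scheme" and S :: "('k, 'a, 'x) graded_scheme" (structure)
  assumes graded_S: "nat_graded_algebra K S"

sublocale env_algebra \<subseteq> graded_tensor K S "opposite S"
  by (intro graded_tensor.intro graded_S opposite_nat_graded_algebra)

lemma env_left_simps [simp]:
  "carrier (env_left K S) = carrier S" "zero (env_left K S) = zero S" "add (env_left K S) = add S"
  "hpart (env_left K S) = hpart S"
  by (simp_all add: env_left_def)

lemma env_twist_simps [simp]:
  "carrier (env_twist K S \<nu>) = carrier S" "zero (env_twist K S \<nu>) = zero S" "add (env_twist K S \<nu>) = add S"
  "hpart (env_twist K S \<nu>) = hpart S"
  by (simp_all add: env_twist_def)

definition galg_endo ::
  "('k, 'z) ring_scheme \<Rightarrow> ('k, 'a, 'x) graded_scheme \<Rightarrow> ('a \<Rightarrow> 'a) \<Rightarrow> bool" where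
  "galg_endo K S \<sigma> \<longleftrightarrow> graded_endo S \<sigma> \<and> (\<forall>c\<in>carrier K. \<forall>x\<in>carrier S. \<sigma> (c \<odot>\<^bsub>S\<^esub> x) = c \<odot>\<^bsub>S\<^esub> \<sigma> x)"

lemma galg_endoD:
  assumes "galg_endo K S \<sigma>"
  shows "x \<in> carrier S \<Longrightarrow> \<sigma> x \<in> carrier S"
    "\<lbrakk>x \<in> carrier S; y \<in> carrier S\<rbrakk> \<Longrightarrow> \<sigma> (x \<otimes>\<^bsub>S\<^esub> y) = \<sigma> x \<otimes>\<^bsub>S\<^esub> \<sigma> y"
    "\<lbrakk>x \<in> carrier S; y \<in> carrier S\<rbrakk> \<Longrightarrow> \<sigma> (x \<oplus>\<^bsub>S\<^esub> y) = \<sigma> x \<oplus>\<^bsub>S\<^esub> \<sigma> y"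
    "\<sigma> \<one>\<^bsub>S\<^esub> = \<one>\<^bsub>S\<^esub>" "x \<in> hpart S i \<Longrightarrow> \<sigma> x \<in> hpart S i"
    "\<lbrakk>c \<in> carrier K; x \<in> carrier S\<rbrakk> \<Longrightarrow> \<sigma> (c \<odot>\<^bsub>S\<^esub> x) = c \<odot>\<^bsub>S\<^esub> \<sigma> x"
  using assms graded_endoD[of S \<sigma>] by (auto simp: galg_endo_def)

section \<open>\<open>S\<close> as a graded left module over its enveloping algebra\<close>

context env_algebra
begin

abbreviation "E \<equiv> env_left K S"

lemma act_bilin: "c \<in> carrier S \<Longrightarrow> bilin K S (opposite S) S (\<lambda>(a, b). a \<otimes> c \<otimes> b)"
  by (rule bilinI) (simp_all add: Ar.l_distr Ar.r_distr A_smult_mult Al.smult_closed)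

lemma act_hom:
  assumes c: "c \<in> carrier S"
  shows "(\<lambda>t. t \<odot>\<^bsub>E\<^esub> c) \<in> add_hom T S"
    and "\<lbrakk>a \<in> carrier S; b \<in> carrier S\<rbrakk> \<Longrightarrow> tens a b \<odot>\<^bsub>E\<^esub> c = a \<otimes> c \<otimes> b"
  using mod_hom_add_hom[OF tensor_lift_hom(1)[OF Al.left_module_axioms act_bilin[OF c]]]
    tensor_lift_hom(2)[OF Al.left_module_axioms act_bilin[OF c], of a b]
  by (simp_all add: env_left_def)

lemmas act_closed = add_hom_closed[OF act_hom(1)]
lemmas act_add = add_hom_add[OF act_hom(1)]

lemma act_zero: "c \<in> carrier S \<Longrightarrow> \<zero>\<^bsub>T\<^esub> \<odot>\<^bsub>E\<^esub> c = \<zero>"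
  by (rule add_hom_zero[OF Tr.abelian_group_axioms Al.M.abelian_group_axioms act_hom(1)])

lemma tens_closed': "\<lbrakk>a \<in> carrier S; b \<in> carrier S\<rbrakk> \<Longrightarrow> tens a b \<in> carrier T"
  using tens_closed[of a b] by simp

lemma act_add_right:
  assumes t: "t \<in> carrier T" and c: "c \<in> carrier S" "c' \<in> carrier S"
  shows "t \<odot>\<^bsub>E\<^esub> (c \<oplus> c') = t \<odot>\<^bsub>E\<^esub> c \<oplus> t \<odot>\<^bsub>E\<^esub> c'"
  using t
proof (induction rule: T_induct)
  case zero
  then show ?case using c by (simp add: act_zero)
next
  case (add t a b)
  then show ?case
    using c by (simp add: act_add act_closed tens_closed' act_hom(2) Ar.l_distr Ar.r_distr Al.M.add.m_ac)
qed

lemma act_mult: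
  assumes s: "s \<in> carrier T" and t: "t \<in> carrier T" and c: "c \<in> carrier S"
  shows "(s \<otimes>\<^bsub>T\<^esub> t) \<odot>\<^bsub>E\<^esub> c = s \<odot>\<^bsub>E\<^esub> (t \<odot>\<^bsub>E\<^esub> c)"
  using s
proof (induction rule: T_induct)
  case zero
  then show ?case using t c by (simp add: act_zero act_closed)
next
  case (add s a b)
  then have a: "a \<in> carrier S" and b: "b \<in> carrier S" by simp_all
  have "(tens a b \<otimes>\<^bsub>T\<^esub> t) \<odot>\<^bsub>E\<^esub> c = a \<otimes> (t \<odot>\<^bsub>E\<^esub> c) \<otimes> b"
    using t
  proof (induction rule: T_induct)
    case zero
    then show ?case using a b c by (simp add: act_zero tens_closed')
  next
    case (add t a' b')
    then have a': "a' \<in> carrier S" and b': "b' \<in> carrier S" by simp_all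
    \<comment> \<open>The second factor multiplies in the opposite algebra, hence in the order
      \<open>b'\<close>, \<open>b\<close>; this is what makes the two-sided action
      associative.\<close>
    have "tens a b \<otimes>\<^bsub>T\<^esub> tens a' b' = tens (a \<otimes> a') (b' \<otimes> b)"
      using tens_mult[of a b a' b'] a b a' b' by simp
    then show ?case
      using a b a' b' c add
      by (simp add: Tr.r_distr act_add tens_closed' act_closed act_hom(2) Ar.l_distr Ar.r_distr Ar.m_assoc)
  qed
  then show ?case
    using add.hyps add.IH a b t c by (simp add: Tr.l_distr act_add tens_closed' act_closed act_hom(2))
qed

lemma env_left_module: "left_module T E"
proof (intro left_module.intro left_module_axioms.intro T_ring)
  show "abelian_group E" by (rule abelian_group_cong[OF _ _ _ Al.M.abelian_group_axioms]) simp_all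
  show "\<one>\<^bsub>T\<^esub> \<odot>\<^bsub>E\<^esub> c = c" if "c \<in> carrier E" for c
    using that by (simp add: T_one act_hom(2))
qed (simp_all add: act_closed act_add act_add_right act_mult)

lemma env_left_graded: "graded_module T E"
proof -
  have "t \<odot>\<^bsub>E\<^esub> c \<in> hpart S (i + j)" if t: "t \<in> hpart T i" and c: "c \<in> hpart S j" for t c i j
    using t
  proof (induction rule: T_hpart_induct)
    case zero
    then show ?case using GA.hpart_closed[OF c] by (simp add: act_zero GA.hpart_zero)
  next
    case (add t n a b)
    have a: "a \<in> carrier S" and b: "b \<in> carrier S"
      using add.hyps GA.hpart_closed by auto
    have "a \<otimes> c \<otimes> b \<in> hpart S ((n + j) + (i - n))"
      using add.hyps c by (intro nat_graded_algebraD(5)[OF graded_S]) auto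
    then show ?case
      using add a b GA.hpart_closed[OF c] GT.hpart_closed
      by (simp add: act_add tens_closed' act_hom(2) GA.hpart_add algebra_simps)
  qed
  moreover have "direct_grading E"
    by (rule direct_grading_cong[OF _ _ _ _ GA.direct_grading_axioms]) simp_all
  ultimately show ?thesis using env_left_module by (simp add: graded_module_def)
qed

section \<open>The endomorphism of the enveloping algebra induced by one of \<open>S\<close>\<close>

definition env_map :: "('a \<Rightarrow> 'a) \<Rightarrow> ('a \<times> 'a \<Rightarrow> 'k) set \<Rightarrow> ('a \<times> 'a \<Rightarrow> 'k) set" where
  "env_map \<sigma> = tensor_lift K T (\<lambda>(a, b). tens (\<sigma> a) (\<sigma> b))"

lemma env_map_hom:
  assumes \<sigma>: "galg_endo K S \<sigma>"
  shows "env_map \<sigma> \<in> add_hom T T"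
    and "\<lbrakk>a \<in> carrier S; b \<in> carrier S\<rbrakk> \<Longrightarrow> env_map \<sigma> (tens a b) = tens (\<sigma> a) (\<sigma> b)"
proof -
  have b: "bilin K S (opposite S) T (\<lambda>(a, b). tens (\<sigma> a) (\<sigma> b))"
    using tensD galg_endoD[OF \<sigma>] by (intro bilinI) simp_all
  show "env_map \<sigma> \<in> add_hom T T"
    unfolding env_map_def by (rule mod_hom_add_hom[OF tensor_lift_hom(1)[OF T_left_module b]])
  show "\<lbrakk>a \<in> carrier S; b \<in> carrier S\<rbrakk> \<Longrightarrow> env_map \<sigma> (tens a b) = tens (\<sigma> a) (\<sigma> b)"
    unfolding env_map_def using tensor_lift_hom(2)[OF T_left_module b, of a b] by simp
qed

text \<open>A map multiplicative on \<open>S\<close> is multiplicative on the opposite algebra too,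
  so the same \<open>\<sigma>\<close> may act on both factors.\<close>

lemma env_map_graded_endo:
  assumes \<sigma>: "galg_endo K S \<sigma>"
  shows "graded_endo T (env_map \<sigma>)"
proof -
  note h = env_map_hom[OF \<sigma>] and \<sigma>D = galg_endoD[OF \<sigma>]
  note hc = add_hom_closed[OF h(1)] and ha = add_hom_add[OF h(1)]
  have h0: "env_map \<sigma> \<zero>\<^bsub>T\<^esub> = \<zero>\<^bsub>T\<^esub>"
    by (rule add_hom_zero[OF Tr.abelian_group_axioms Tr.abelian_group_axioms h(1)])
  have mult: "env_map \<sigma> (s \<otimes>\<^bsub>T\<^esub> t) = env_map \<sigma> s \<otimes>\<^bsub>T\<^esub> env_map \<sigma> t"
    if s: "s \<in> carrier T" and t: "t \<in> carrier T" for s t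
    using s
  proof (induction rule: T_induct)
    case zero
    then show ?case using t by (simp add: h0 hc)
  next
    case (add s a b)
    then have a: "a \<in> carrier S" and b: "b \<in> carrier S" by simp_all
    have "env_map \<sigma> (tens a b \<otimes>\<^bsub>T\<^esub> t) = tens (\<sigma> a) (\<sigma> b) \<otimes>\<^bsub>T\<^esub> env_map \<sigma> t"
      using t
    proof (induction rule: T_induct)
      case zero
      then show ?case using a b by (simp add: h0 tens_closed' \<sigma>D)
    next
      case (add t a' b')
      then have a': "a' \<in> carrier S" and b': "b' \<in> carrier S" by simp_all
      have "tens x y \<otimes>\<^bsub>T\<^esub> tens x' y' = tens (x \<otimes> x') (y' \<otimes> y)"
        if "x \<in> carrier S" "y \<in> carrier S" "x' \<in> carrier S" "y' \<in> carrier S" for x y x' y'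
        using tens_mult[of x y x' y'] that by simp
      then show ?case
        using a b a' b' add by (simp add: Tr.r_distr ha hc tens_closed' h(2) \<sigma>D)
    qed
    then show ?case
      using add.hyps add.IH a b t by (simp add: Tr.l_distr ha hc tens_closed' h(2) \<sigma>D)
  qed
  have hp: "env_map \<sigma> t \<in> hpart T n" if "t \<in> hpart T n" for t n
    using that
  proof (induction rule: T_hpart_induct)
    case zero
    then show ?case by (simp add: h0 GT.hpart_zero)
  next
    case (add t i a b)
    have a: "a \<in> carrier S" and b: "b \<in> carrier S"
      using add.hyps GA.hpart_closed by auto
    have "tens (\<sigma> a) (\<sigma> b) \<in> hpart T (i + (n - i))"
      using add.hyps \<sigma>D(5) by (intro tens_hpart) auto
    then show ?case using add a b GT.hpart_closed by (simp add: ha tens_closed' h(2) GT.hpart_add)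
  qed
  have "env_map \<sigma> \<one>\<^bsub>T\<^esub> = \<one>\<^bsub>T\<^esub>" by (simp add: T_one h(2) \<sigma>D)
  then show ?thesis
    using mult hc ha hp by (auto simp: graded_endo_def intro!: ring_hom_memI)
qed

lemma env_map_inverse:
  assumes \<sigma>: "galg_endo K S \<sigma>" and \<sigma>': "galg_endo K S \<sigma>'"
    and inv: "\<And>x. x \<in> carrier S \<Longrightarrow> \<sigma>' (\<sigma> x) = x" and t: "t \<in> carrier T"
  shows "env_map \<sigma>' (env_map \<sigma> t) = t"
  using t
proof (induction rule: T_induct)
  case zero
  show ?case
    using add_hom_zero[OF Tr.abelian_group_axioms Tr.abelian_group_axioms env_map_hom(1)] \<sigma> \<sigma>' by simp
next
  case (add t a b)
  then show ?case
    by (simp add: add_hom_add[OF env_map_hom(1)[OF \<sigma>]] add_hom_add[OF env_map_hom(1)[OF \<sigma>']] tens_closed'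
        add_hom_closed[OF env_map_hom(1)[OF \<sigma>]] env_map_hom(2)[OF \<sigma>] env_map_hom(2)[OF \<sigma>'] galg_endoD[OF \<sigma>] inv)
qed

text \<open>On pure tensors this is the multiplicativity of \<open>\<sigma>\<close> on the product
  \<open>a \<otimes> c \<otimes> b\<close>.\<close>

lemma env_left_semilinear:
  assumes \<sigma>: "galg_endo K S \<sigma>"
  shows "\<sigma> \<in> degree_hom T 0 E (twist (env_map \<sigma>) E)"
proof -
  note h = env_map_hom[OF \<sigma>] and \<sigma>D = galg_endoD[OF \<sigma>]
  have \<sigma>0: "\<sigma> \<zero> = \<zero>"
    by (rule add_hom_zero[OF Al.M.abelian_group_axioms Al.M.abelian_group_axioms]) (auto simp: add_hom_def \<sigma>D)
  have "\<sigma> (t \<odot>\<^bsub>E\<^esub> c) = env_map \<sigma> t \<odot>\<^bsub>E\<^esub> \<sigma> c" if t: "t \<in> carrier T" and c: "c \<in> carrier S" for t c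
    using t
  proof (induction rule: T_induct)
    case zero
    show ?case
      using c add_hom_zero[OF Tr.abelian_group_axioms Tr.abelian_group_axioms h(1)]
      by (simp add: act_zero \<sigma>0 \<sigma>D)
  next
    case (add t a b)
    then show ?case
      using c by (simp add: act_add tens_closed' act_closed act_hom(2) add_hom_add[OF h(1)] add_hom_closed[OF h(1)] h(2) \<sigma>D)
  qed
  then show ?thesis by (auto simp: degree_hom_def \<sigma>D intro!: mod_homI)
qed

text \<open>In the convention for right modules the second tensor factor acts from the left, whence
  the order \<open>b\<close>, \<open>a\<close>.\<close>

lemma env_twist_act:
  assumes \<nu>: "galg_endo K S \<nu>" and c: "c \<in> carrier S" and "b \<in> carrier S" "a \<in> carrier S"
  shows "tens b a \<odot>\<^bsub>env_twist K S \<nu>\<^esub> c = \<nu> a \<otimes> c \<otimes> b"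
proof -
  have "bilin K S (opposite S) S (\<lambda>(b, a). \<nu> a \<otimes> c \<otimes> b)"
    using c by (intro bilinI) (simp_all add: Ar.l_distr Ar.r_distr A_smult_mult Al.smult_closed galg_endoD[OF \<nu>])
  from tensor_lift_hom(2)[OF Al.left_module_axioms this, of b a] assms show ?thesis
    by (simp add: env_twist_def)
qed

end

section \<open>The Nakayama automorphism\<close>

text \<open>The choice made in \<open>graded_Ext\<close> does not depend on the degree, so one
  \<open>P\<close> serves every \<open>i\<close>. It yields an actual resolution because the
  encodings supply one in the prescribed type.\<close>

lemma (in env_algebra) graded_Ext_resolution:
  "\<exists>P d e. graded_projective_resolution T E (P :: nat \<Rightarrow> (_, (('a \<times> 'a \<Rightarrow> 'k) set, 'a) univ) graded) d e \<and>
     (\<forall>i. graded_Ext T i E (regular_bimod T) = cohomology T P d (regular_bimod T) i)"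
proof -
  obtain enc0 :: "int \<times> 'a \<Rightarrow> (('a \<times> 'a \<Rightarrow> 'k) set + 'a) list" where enc0: "inj enc0"
    using int_pair_list_encoding by blast
  obtain enc :: "int \<times> ((('a \<times> 'a \<Rightarrow> 'k) set, 'a) univ) \<Rightarrow> (('a \<times> 'a \<Rightarrow> 'k) set + 'a) list"
    where enc: "inj_on enc (UNIV \<times> fin_supp T UNIV)"
    using fin_supp_list_encoding by blast
  have ex: "\<exists>p. case p of (P :: nat \<Rightarrow> (_, (('a \<times> 'a \<Rightarrow> 'k) set, 'a) univ) graded, d, e) \<Rightarrow> graded_projective_resolution T E P d e"
    using graded_projective_resolution_ex[OF T_graded_ring env_left_graded enc0 enc]
    by simp
  obtain P d e where Pde: "(SOME (P :: nat \<Rightarrow> (_, (('a \<times> 'a \<Rightarrow> 'k) set, 'a) univ) graded, d, e).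
      graded_projective_resolution T E P d e) = (P, d, e)"
    by (metis prod_cases3)
  with someI_ex[OF ex] have "graded_projective_resolution T E P d e" by simp
  moreover have "graded_Ext T i E (regular_bimod T) = cohomology T P d (regular_bimod T) i" for i
    unfolding graded_Ext_def Pde by simp
  ultimately show ?thesis by blast
qed

lemma galg_iso_endo: "\<sigma> \<in> galg_iso K S S \<Longrightarrow> galg_endo K S \<sigma>"
  by (auto simp: galg_iso_def galg_endo_def graded_endo_def ring_iso_def)

text \<open>The inverse has to be a graded algebra endomorphism in its own right, since it is lifted
  to the resolution alongside \<open>\<sigma>\<close>.\<close>

lemma galg_iso_inverse:
  assumes "nat_graded_algebra K S" and \<sigma>: "\<sigma> \<in> galg_iso K S S"
  shows "galg_endo K S (inv_into (carrier S) \<sigma>)"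
    "x \<in> carrier S \<Longrightarrow> inv_into (carrier S) \<sigma> (\<sigma> x) = x"
    "x \<in> carrier S \<Longrightarrow> \<sigma> (inv_into (carrier S) \<sigma> x) = x"
proof -
  interpret S: direct_graded_group S by (rule nat_graded_algebraD(2)[OF assms(1)])
  interpret left_module K S by (rule assoc_algebra_left_module[OF nat_graded_algebraD(1)[OF assms(1)]])
  interpret ring S using nat_graded_algebraD(1)[OF assms(1)] by (simp add: assoc_algebra_def)
  let ?\<tau> = "inv_into (carrier S) \<sigma>"
  have bij: "bij_betw \<sigma> (carrier S) (carrier S)" and iso: "\<sigma> \<in> ring_iso S S"
    and lin: "\<And>c x. \<lbrakk>c \<in> carrier K; x \<in> carrier S\<rbrakk> \<Longrightarrow> \<sigma> (c \<odot>\<^bsub>S\<^esub> x) = c \<odot>\<^bsub>S\<^esub> \<sigma> x"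
    and hp: "\<And>i. \<sigma> ` hpart S i = hpart S i"
    using \<sigma> by (auto simp: galg_iso_def ring_iso_def)
  show l: "?\<tau> (\<sigma> x) = x" if "x \<in> carrier S" for x
    by (rule bij_betw_inv_into_left[OF bij that])
  show r: "\<sigma> (?\<tau> x) = x" if "x \<in> carrier S" for x
    by (rule bij_betw_inv_into_right[OF bij that])
  have c: "?\<tau> x \<in> carrier S" if "x \<in> carrier S" for x
    using bij_betwE[OF bij_betw_inv_into[OF bij]] that by blast
  have "?\<tau> \<in> ring_iso S S" by (rule ring_iso_set_sym[OF _ iso]) (rule ring_axioms)
  moreover have "?\<tau> x \<in> hpart S i" if x: "x \<in> hpart S i" for x i
  proof -
    from x obtain y where y: "y \<in> hpart S i" "x = \<sigma> y" using hp[of i] by blast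
    then show ?thesis using l[OF S.hpart_closed[OF y(1)]] by simp
  qed
  moreover have "?\<tau> (a \<odot>\<^bsub>S\<^esub> x) = a \<odot>\<^bsub>S\<^esub> ?\<tau> x" if "a \<in> carrier K" "x \<in> carrier S" for a x
    using l[OF smult_closed[OF that(1) c[OF that(2)]]] lin[OF that(1) c[OF that(2)]] r[OF that(2)] by simp
  ultimately show "galg_endo K S ?\<tau>"
    by (auto simp: galg_endo_def graded_endo_def ring_iso_def)
qed

theorem nakayama_commutes:
  fixes K :: "('k, 'z) ring_scheme" and S :: "('k, 'a) graded"
  assumes S: "connected_graded_algebra K S" and nak: "nakayama_automorphism K S d l \<nu>"
    and \<sigma>: "\<sigma> \<in> galg_iso K S S" and a: "a \<in> carrier S"
  shows "\<nu> (\<sigma> a) = \<sigma> (\<nu> a)"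
proof -
  interpret env_algebra K S
    by (rule env_algebra.intro[OF connected_graded_algebra.axioms(1)[OF S]])
  interpret Kf: field K
    by (rule nat_graded_algebra.axioms(1)[OF graded_S])
  have Se: "enveloping K S = T" by (simp add: enveloping_def)
  have \<nu>: "galg_endo K S \<nu>"
    using nak galg_iso_endo by (auto simp: nakayama_automorphism_def Let_def Aut_group_def)
  note \<sigma>e = galg_iso_endo[OF \<sigma>]
  define \<sigma>' where "\<sigma>' = inv_into (carrier S) \<sigma>"
  note inv = galg_iso_inverse[OF graded_S \<sigma>, folded \<sigma>'_def]
  note \<sigma>D = galg_endoD[OF \<sigma>e] and \<nu>D = galg_endoD[OF \<nu>]
  let ?N = "shift (env_twist K S \<nu>) l"
  obtain P \<Delta> e where res: "graded_projective_resolution T E (P :: nat \<Rightarrow> (_, (('a \<times> 'a \<Rightarrow> 'k) set, 'a) univ) graded) \<Delta> e"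
    and Ext: "\<And>i. graded_Ext T i E (regular_bimod T) = cohomology T P \<Delta> (regular_bimod T) i"
    using graded_Ext_resolution by blast
  interpret X: graded_resolved T E P \<Delta> e
    by (intro graded_resolved.intro graded_resolved_axioms.intro T_graded_ring
        graded_projective_resolutionD(1)[OF res env_left_graded])
  have N: "carrier ?N = carrier S" "zero ?N = zero S" "add ?N = add S" "smult ?N = smult (env_twist K S \<nu>)"
    "hpart ?N i = hpart S (l + i)" for i
    by (simp_all add: shift_def)
  have "gmod_isomorphic T (X.H d) ?N"
    using nak by (simp add: nakayama_automorphism_def Let_def Se Ext)
  then obtain \<theta> where \<theta>: "\<theta> \<in> mod_hom T (X.H d) ?N" "bij_betw \<theta> (carrier (X.H d)) (carrier S)"
    "\<And>i. \<theta> ` hpart (X.H d) i = hpart S (l + i)"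
    by (auto simp: gmod_isomorphic_def N)
  note \<theta>D = mod_homD[OF \<theta>(1), unfolded N]
  have H_sub: "x \<in> carrier (X.H d)" if "x \<in> hpart (X.H d) i" for x i
    using that unfolding X.H_hpart X.H_carrier by blast
  interpret Hd: abelian_group "X.H d" by (rule X.H_abelian_group)
  have \<theta>0: "\<theta> \<zero>\<^bsub>X.H d\<^esub> = \<zero>\<^bsub>S\<^esub>"
    by (rule add_hom_zero[OF Hd.abelian_group_axioms Al.M.abelian_group_axioms]) (auto simp: add_hom_def \<theta>D)
  \<comment> \<open>The shift puts the generator into degree \<open>- l\<close>: this is the part
    that \<open>\<theta>\<close> maps onto the degree zero part of \<open>S\<close>.\<close>
  have "\<one>\<^bsub>S\<^esub> \<in> \<theta> ` hpart (X.H d) (- l)" using \<theta>(3)[of "- l"] nat_graded_algebraD(4)[OF graded_S] by simp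
  then obtain \<omega> where \<omega>: "\<omega> \<in> hpart (X.H d) (- l)" "\<theta> \<omega> = \<one>\<^bsub>S\<^esub>" by auto
  note \<omega>c = H_sub[OF \<omega>(1)]
  have proj: "projective T (P i)" for i
    by (rule graded_projective_resolutionD(2)[OF res env_left_graded])
  \<comment> \<open>The maps of the enveloping algebra induced by \<open>\<sigma>\<close> and by its
    inverse play the roles of \<open>\<tau>\<close> and \<open>\<tau>'\<close>.\<close>
  obtain \<Psi> where \<Psi>: "\<And>x. x \<in> carrier (X.H d) \<Longrightarrow> \<Psi> x \<in> carrier (X.H d)"
    "\<And>x t. \<lbrakk>x \<in> carrier (X.H d); t \<in> carrier T\<rbrakk> \<Longrightarrow>
      \<Psi> (t \<odot>\<^bsub>X.H d\<^esub> x) = env_map \<sigma> t \<odot>\<^bsub>X.H d\<^esub> \<Psi> x"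
    "\<And>x j. x \<in> hpart (X.H d) j \<Longrightarrow> \<Psi> x \<in> hpart (X.H d) j"
    "\<And>x. \<lbrakk>x \<in> carrier (X.H d); \<Psi> x = \<zero>\<^bsub>X.H d\<^esub>\<rbrakk> \<Longrightarrow> x = \<zero>\<^bsub>X.H d\<^esub>"
    using X.semilinear_cohomology[OF proj env_map_graded_endo[OF \<sigma>e] env_map_graded_endo[OF inv(1)]
        env_map_inverse[OF inv(1) \<sigma>e inv(3)] env_map_inverse[OF \<sigma>e inv(1,2)]
        env_left_semilinear[OF \<sigma>e] env_left_semilinear[OF inv(1)] inv(2)[folded env_left_simps(1)[of K S]]]
    by blast
  define u where "u = \<theta> (\<Psi> \<omega>)"
  have "u \<in> hpart S 0" using \<Psi>(3)[OF \<omega>(1)] \<theta>(3)[of "- l"] by (auto simp: u_def)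
  then obtain c where c: "c \<in> carrier K" "u = c \<odot>\<^bsub>S\<^esub> \<one>\<^bsub>S\<^esub>" using connected_graded_algebra.hpart_zero[OF S] by auto
  \<comment> \<open>Otherwise \<open>\<Psi>\<close> would kill \<open>\<omega>\<close>; by
    injectivity \<open>\<omega>\<close>, and with it its image 1, would vanish.\<close>
  have "c \<noteq> \<zero>\<^bsub>K\<^esub>"
  proof
    assume "c = \<zero>\<^bsub>K\<^esub>"
    then have "\<theta> (\<Psi> \<omega>) = \<theta> \<zero>\<^bsub>X.H d\<^esub>" using c \<theta>0 by (simp add: u_def[symmetric] Al.zero_smult)
    then have "\<Psi> \<omega> = \<zero>\<^bsub>X.H d\<^esub>"
      using bij_betw_imp_inj_on[OF \<theta>(2)] \<Psi>(1)[OF \<omega>c] by (auto dest: inj_onD)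
    then have "\<omega> = \<zero>\<^bsub>X.H d\<^esub>" using \<Psi>(4)[OF \<omega>c] by simp
    then show False using \<omega>(2) \<theta>0 connected_graded_algebra.one_neq_zero[OF S] by simp
  qed
  \<comment> \<open>In \<open>\<^sub>\<nu>S\<^sub>1\<close> both \<open>1 \<otimes> a\<close> and \<open>\<nu>(a) \<otimes> 1\<close> send the generator \<open>1\<close> to \<open>\<nu>(a)\<close>.\<close>
  let ?t = "tens \<one>\<^bsub>S\<^esub> a" and ?s = "tens (\<nu> a) \<one>\<^bsub>S\<^esub>"
  have ts: "?t \<in> carrier T" "?s \<in> carrier T" using a by (simp_all add: tens_closed' \<nu>D)
  have "\<theta> (?t \<odot>\<^bsub>X.H d\<^esub> \<omega>) = \<theta> (?s \<odot>\<^bsub>X.H d\<^esub> \<omega>)"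
    using a by (simp add: \<theta>D(3)[OF ts(1) \<omega>c] \<theta>D(3)[OF ts(2) \<omega>c] \<omega>(2) env_twist_act[OF \<nu>] \<nu>D)
  then have "?t \<odot>\<^bsub>X.H d\<^esub> \<omega> = ?s \<odot>\<^bsub>X.H d\<^esub> \<omega>"
    using bij_betw_imp_inj_on[OF \<theta>(2)] X.H_smult_closed[OF ts(1) \<omega>c] X.H_smult_closed[OF ts(2) \<omega>c]
    by (auto dest: inj_onD)
  then have "env_map \<sigma> ?t \<odot>\<^bsub>X.H d\<^esub> \<Psi> \<omega> = env_map \<sigma> ?s \<odot>\<^bsub>X.H d\<^esub> \<Psi> \<omega>"
    using \<Psi>(2)[OF \<omega>c ts(1)] \<Psi>(2)[OF \<omega>c ts(2)] by simp
  then have eq: "\<theta> (tens \<one>\<^bsub>S\<^esub> (\<sigma> a) \<odot>\<^bsub>X.H d\<^esub> \<Psi> \<omega>) = \<theta> (tens (\<sigma> (\<nu> a)) \<one>\<^bsub>S\<^esub> \<odot>\<^bsub>X.H d\<^esub> \<Psi> \<omega>)"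
    using a by (simp add: env_map_hom(2)[OF \<sigma>e] \<sigma>D \<nu>D)
  have ts': "tens \<one>\<^bsub>S\<^esub> (\<sigma> a) \<in> carrier T" "tens (\<sigma> (\<nu> a)) \<one>\<^bsub>S\<^esub> \<in> carrier T"
    using a by (simp_all add: tens_closed' \<sigma>D \<nu>D)
  have uc: "u \<in> carrier S" using c by (simp add: Al.smult_closed)
  \<comment> \<open>In the twisted bimodule \<open>1 \<otimes> \<sigma> a\<close> multiplies
    \<open>u\<close> on the left by \<open>\<nu> (\<sigma> a)\<close>, while
    \<open>\<sigma> (\<nu> a) \<otimes> 1\<close> multiplies it on the right by
    \<open>\<sigma> (\<nu> a)\<close>, as \<open>\<nu>\<close> fixes 1.\<close>
  have "\<nu> (\<sigma> a) \<otimes>\<^bsub>S\<^esub> u = u \<otimes>\<^bsub>S\<^esub> \<sigma> (\<nu> a)"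
    using eq a uc
    unfolding \<theta>D(3)[OF ts'(1) \<Psi>(1)[OF \<omega>c]] \<theta>D(3)[OF ts'(2) \<Psi>(1)[OF \<omega>c]] u_def[symmetric]
    by (simp add: env_twist_act[OF \<nu>] \<nu>D \<sigma>D)
  \<comment> \<open>Being a multiple of 1, \<open>u\<close> can be pulled out of either product as
    the scalar \<open>c\<close>.\<close>
  then have eqc: "c \<odot>\<^bsub>S\<^esub> \<nu> (\<sigma> a) = c \<odot>\<^bsub>S\<^esub> \<sigma> (\<nu> a)"
    using a c by (simp add: A_smult_mult \<nu>D \<sigma>D)
  have ci: "inv\<^bsub>K\<^esub> c \<in> carrier K" "inv\<^bsub>K\<^esub> c \<otimes>\<^bsub>K\<^esub> c = \<one>\<^bsub>K\<^esub>"
    using \<open>c \<noteq> \<zero>\<^bsub>K\<^esub>\<close> c(1) Kf.field_Units by auto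
  have "inv\<^bsub>K\<^esub> c \<odot>\<^bsub>S\<^esub> (c \<odot>\<^bsub>S\<^esub> \<nu> (\<sigma> a)) = inv\<^bsub>K\<^esub> c \<odot>\<^bsub>S\<^esub> (c \<odot>\<^bsub>S\<^esub> \<sigma> (\<nu> a))" using eqc by simp
  then show ?thesis
    using a c ci by (simp add: Al.smult_assoc[symmetric] Al.smult_one \<nu>D \<sigma>D)
qed

theorem corollary4p9:
  fixes K :: "('k, 'z) ring_scheme"
    and S :: "('k, 'a) graded"
    and m d :: nat
    and l :: int
    and \<nu> :: "'a \<Rightarrow> 'a"
  assumes "field K"
    and "m_koszul K m S"
    and "AS_regular K S d l"
    and "nakayama_automorphism K S d l \<nu>"
  shows "\<nu> \<in> group_center (Aut_group K S)"
proof -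
  have S: "connected_graded_algebra K S" using assms(3) by (simp add: AS_regular_def)
  have \<nu>: "\<nu> \<in> carrier (Aut_group K S)"
    using assms(4) by (simp add: nakayama_automorphism_def Let_def)
  have "\<nu> \<otimes>\<^bsub>Aut_group K S\<^esub> \<sigma> = \<sigma> \<otimes>\<^bsub>Aut_group K S\<^esub> \<nu>" if \<sigma>: "\<sigma> \<in> carrier (Aut_group K S)" for \<sigma>
  proof -
    have B: "\<nu> \<in> Bij (carrier S)" "\<sigma> \<in> Bij (carrier S)" "\<sigma> \<in> galg_iso K S S"
      using \<nu> \<sigma> by (auto simp: Aut_group_def)
    \<comment> \<open>The group law composes maps restricted to the carrier, so agreement on the
      carrier suffices.\<close>
    have "compose (carrier S) \<nu> \<sigma> = compose (carrier S) \<sigma> \<nu>"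
      using nakayama_commutes[OF S assms(4) B(3)] by (auto simp: compose_def intro!: restrict_ext)
    then show ?thesis using B by (simp add: Aut_group_def BijGroup_def)
  qed
  then show ?thesis using \<nu> by (simp add: group_center_def)
qed

end
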